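(* Let $(\ell_1,\ell_2)\in(1,2)^2$. There exist $\lambda_u>1$ and $\lambda_s\in(0,1)$ such that for every $f\in\mathcal W_{[1]}$ (a Fibonacci circle map with a flat piece) with critical exponents $(\ell_1,\ell_2)$ there are three couples of real numbers $(c_u(f),c_u'(f))$, $(c_+(f),c_+'(f))$ and $(c_s(f),c_s'(f))$ (geometrical invariants of $f$) such that for all $p\in\mathbb N$ $$\ln\alpha_{2p}\asymp c_u(f)\lambda_u^{p}+c_s(f)\lambda_s^{p}+c_+(f)$$ and $$\ln\alpha_{2p+1}\asymp c'_u(f)\lambda_u^{p}+c'_s(f)\lambda_s^{p}+c'_+(f).$$
   Context: **The class of maps.** Fix $\ell_1,\ell_2>1$. $\mathscr L$ is the set of tuples $f=(x_1,x_2,x_3,x_4,s,\varphi,\varphi^l,\varphi^r)$ with $x_1<0<x_3<x_4<1$, $0<x_2<1$, $0<s<1$ and $\varphi,\varphi^l,\varphi^r$ orientation-preserving $C^3$ diffeomorphisms of $[0,1]$. Such a tuple is identified with the circle map $f:[x_1,1]\to[x_1,1]$ (the points $x_1$ and $1$ being identified, so $[x_1,1]$ is a circle; lengths are measured in this coordinate) given by $f(x)=(1-x_2)\,q_s\big(\varphi(\tfrac{x_1-x}{x_1})\big)+x_2$ for $x\in[x_1,0)$; $f(x)=x_1\big(\varphi^l(\tfrac{x_3-x}{x_3})\big)^{\ell_1}$ for $x\in(0,x_3]$; $f(x)=0$ for $x\in[x_3,x_4]$; $f(x)=x_2\big(\varphi^r(\tfrac{x-x_4}{1-x_4})\big)^{\ell_2}$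 for $x\in[x_4,1]$; here $q_s(x)=\frac{[(1-s)x+s]^{\ell_2}-s^{\ell_2}}{1-s^{\ell_2}}$, and $f(0)$ is the point $x_1\sim 1$. The pair $(\ell_1,\ell_2)$ is the pair of critical exponents, and $U=U_f=(x_3,x_4)$ is the flat piece. The rotation number is $\rho(f)=\lim_n (F^n(x)-x)/n \pmod 1$ for a lift $F$. $\mathcal W_{[1]}$ is the set of $f\in\mathscr L$ with Fibonacci (golden mean) rotation number, i.e. $\rho(f)=\frac{1}{1+\frac{1}{1+\cdots}}$, and negative Schwarzian derivative: $\frac{D^3f(x)}{Df(x)}-\frac32\big(\frac{D^2f(x)}{Df(x)}\big)^2<0$ whenever $Df(x)\ne0$. **Scaling ratios.** $q_0=q_1=1$, $q_{n+1}=q_n+q_{n-1}$. For $i\in\mathbb Z$, $\underline i=f^i(U)$ (a preimage interval if $i<0$, a point if $i>0$); $|(\underline i,\underline j)|$ is the distance between the closest endpoints of $\underline i$ and $\underline j$, and $|[\underline i,\underline j)|=|\underline i|+|(\underline i,\underline j)|$. Then $\alpha_n=\dfrac{|(\underline{-q_n},\underline0)|}{|[\underline{-q_n},\underline0)|}$. **Notation.** $X_p\asymp Y_p$ means that the ratio $X_p/Y_p$ is bounded between two positive constants independent of $p$. *)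

theory Defs
  imports "HOL-Analysis.Analysis"
begin

section \<open>Diffeomorphisms of the unit interval\<close>

text \<open>Derivatives are taken relative to \<open>S\<close>, hence one-sided at the endpoints of a closed interval.\<close>

definition C3_on :: "real set \<Rightarrow> (real \<Rightarrow> real) \<Rightarrow> bool" where
  "C3_on S g \<longleftrightarrow> (\<exists>g1 g2 g3.
     (\<forall>x\<in>S. (g has_real_derivative g1 x) (at x within S) \<and>
            (g1 has_real_derivative g2 x) (at x within S) \<and>
            (g2 has_real_derivative g3 x) (at x within S)) \<and>
     continuous_on S g3)"

definition orientation_preserving_C3_diffeo :: "(real \<Rightarrow> real) \<Rightarrow> bool" where
  "orientation_preserving_C3_diffeo g \<longleftrightarrow>
     bij_betw g {0..1} {0..1} \<and> strict_mono_on {0..1} g \<and>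
     C3_on {0..1} g \<and> C3_on {0..1} (inv_into {0..1} g)"

section \<open>Circle maps with a flat piece\<close>

record flat_tuple =
  pt1 :: real
  pt2 :: real
  pt3 :: real
  pt4 :: real
  spar :: real
  phi :: "real \<Rightarrow> real"
  phil :: "real \<Rightarrow> real"
  phir :: "real \<Rightarrow> real"

text \<open>The class does not depend on the exponents; these enter through \<open>circle_map\<close>.\<close>

definition flat_class :: "flat_tuple set" where
  "flat_class = {f. pt1 f < 0 \<and> 0 < pt3 f \<and> pt3 f < pt4 f \<and> pt4 f < 1 \<and>
     0 < pt2 f \<and> pt2 f < 1 \<and> 0 < spar f \<and> spar f < 1 \<and>
     orientation_preserving_C3_diffeo (phi f) \<and>
     orientation_preserving_C3_diffeo (phil f) \<and>
     orientation_preserving_C3_diffeo (phir f)}"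

definition qmap :: "real \<Rightarrow> real \<Rightarrow> real \<Rightarrow> real" where
  "qmap l2 s x = (((1 - s) * x + s) powr l2 - s powr l2) / (1 - s powr l2)"

text \<open>
  The circle is \<open>{pt1 f..1}\<close> with \<open>pt1 f\<close> and \<open>1\<close> identified. The value at \<open>0\<close> is this
  point, here represented by \<open>pt1 f\<close>; both representatives have the same image \<open>pt2 f\<close>.
  Values outside \<open>{pt1 f..1}\<close> are irrelevant.
\<close>

definition circle_map :: "real \<Rightarrow> real \<Rightarrow> flat_tuple \<Rightarrow> real \<Rightarrow> real" where
  "circle_map l1 l2 f x =
    (if x < 0 then (1 - pt2 f) * qmap l2 (spar f) (phi f ((pt1 f - x) / pt1 f)) + pt2 f
     else if x = 0 then pt1 f
     else if x \<le> pt3 f then pt1 f * (phil f ((pt3 f - x) / pt3 f)) powr l1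
     else if x \<le> pt4 f then 0
     else pt2 f * (phir f ((x - pt4 f) / (1 - pt4 f))) powr l2)"

definition circle_length :: "flat_tuple \<Rightarrow> real" where
  "circle_length f = 1 - pt1 f"

text \<open>
  The continuous lift that maps \<open>pt1 f\<close> to \<open>pt2 f\<close>: a real is written as \<open>y + k * circle_length f\<close>
  with \<open>y\<close> in the fundamental domain \<open>{pt1 f..<1}\<close>. The circle map increases from \<open>pt2 f\<close>
  to \<open>1\<close> on \<open>{pt1 f..<0}\<close> and restarts from \<open>pt1 f\<close> at \<open>0\<close>, so one turn is added from there on.
\<close>

definition lift_map :: "real \<Rightarrow> real \<Rightarrow> flat_tuple \<Rightarrow> real \<Rightarrow> real" where
  "lift_map l1 l2 f x =
    (let k = real_of_int \<lfloor>(x - pt1 f) / circle_length f\<rfloor>;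
         y = x - k * circle_length f
     in circle_map l1 l2 f y + (if y < 0 then 0 else circle_length f) + k * circle_length f)"

text \<open>
  The translation number is divided by the length of the circle, so that it is measured in
  turns. The limit exists and does not depend on the base point, which is taken to be \<open>0\<close>.
\<close>

definition rotation_number :: "real \<Rightarrow> real \<Rightarrow> flat_tuple \<Rightarrow> real" where
  "rotation_number l1 l2 f =
     frac (lim (\<lambda>n. ((lift_map l1 l2 f ^^ n) 0 - 0) / (real n * circle_length f)))"

definition golden_continued_fraction :: real where
  "golden_continued_fraction = lim (\<lambda>n. ((\<lambda>x. 1 / (1 + x)) ^^ n) 1)"

lemma golden_continued_fraction_eq: "golden_continued_fraction = (sqrt 5 - 1) / 2"
proof -
  define g :: real where "g = (sqrt 5 - 1) / 2"
  define a :: "nat \<Rightarrow> real" where "a = (\<lambda>n. ((\<lambda>x. 1 / (1 + x)) ^^ n) 1)"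
  have s: "2 < sqrt 5" "sqrt 5 < 3" by (auto intro: real_less_rsqrt real_less_lsqrt)
  have g: "0 < g" "g < 1" using s by (auto simp: g_def)
  have "(1 + g) * g = 1" by (simp add: g_def field_simps)
  then have gi: "1 / (1 + g) = g" using g by (simp add: field_simps)
  have a_Suc: "a (Suc n) = 1 / (1 + a n)" for n by (simp add: a_def)
  have a_pos: "0 < a n" for n by (induction n) (auto simp: a_Suc, simp add: a_def)
  have step: "\<bar>a (Suc n) - g\<bar> \<le> g * \<bar>a n - g\<bar>" for n
  proof -
    have "a (Suc n) - g = 1 / (1 + a n) - 1 / (1 + g)" by (simp add: a_Suc gi)
    also have "\<dots> = (g - a n) / (1 + a n) * (1 / (1 + g))"
      using a_pos[of n] g by (simp add: divide_simps)
    also have "\<dots> = (g - a n) / (1 + a n) * g" by (simp only: gi)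
    finally have "\<bar>a (Suc n) - g\<bar> = \<bar>a n - g\<bar> / (1 + a n) * g"
      using a_pos[of n] g by (simp add: abs_mult abs_minus_commute)
    also have "\<dots> \<le> \<bar>a n - g\<bar> * g"
      using a_pos[of n] g by (intro mult_right_mono) (auto simp: divide_le_eq mult_le_cancel_left1)
    finally show ?thesis by (simp add: mult.commute)
  qed
  have bound: "\<bar>a n - g\<bar> \<le> g ^ n * \<bar>a 0 - g\<bar>" for n
  proof (induction n)
    case (Suc n)
    have "g * \<bar>a n - g\<bar> \<le> g * (g ^ n * \<bar>a 0 - g\<bar>)" using Suc g by (intro mult_left_mono) auto
    with step[of n] show ?case by (simp add: mult.assoc)
  qed simp
  have "(\<lambda>n. g ^ n * \<bar>a 0 - g\<bar>) \<longlonglongrightarrow> 0"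
    using g by (intro tendsto_mult_left_zero LIMSEQ_realpow_zero) auto
  then have "(\<lambda>n. a n - g) \<longlonglongrightarrow> 0"
    by (rule Lim_null_comparison[rotated]) (use bound in auto)
  then have "a \<longlonglongrightarrow> g" by (simp add: LIM_zero_iff)
  then show ?thesis unfolding golden_continued_fraction_def a_def[symmetric] g_def[symmetric]
    by (rule limI)
qed

text \<open>
  The condition is imposed at the points where the first three derivatives exist. Every point
  has a punctured neighbourhood on which the lift of a map in the class is three times
  differentiable, except possibly at the single orbits of \<open>0\<close>, \<open>pt1 f\<close>, \<open>pt3 f\<close> and \<open>pt4 f\<close>
  under translation by the length, so iterating \<open>deriv\<close> gives genuine derivatives.
\<close>

definition negative_schwarzian :: "(real \<Rightarrow> real) \<Rightarrow> bool" where
  "negative_schwarzian F \<longleftrightarrow>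
    (\<forall>x. (\<forall>k<3. ((deriv ^^ k) F) differentiable (at x)) \<and> deriv F x \<noteq> 0 \<longrightarrow>
       (deriv ^^ 3) F x / deriv F x - 3 / 2 * ((deriv ^^ 2) F x / deriv F x)\<^sup>2 < 0)"

definition fibonacci_class :: "real \<Rightarrow> real \<Rightarrow> flat_tuple set" where
  "fibonacci_class l1 l2 = {f \<in> flat_class.
     rotation_number l1 l2 f = golden_continued_fraction \<and>
     negative_schwarzian (lift_map l1 l2 f)}"

section \<open>Scaling ratios\<close>

fun qseq :: "nat \<Rightarrow> nat" where
  "qseq 0 = 1"
| "qseq (Suc 0) = 1"
| "qseq (Suc (Suc n)) = qseq (Suc n) + qseq n"

definition flat_piece :: "flat_tuple \<Rightarrow> real set" where
  "flat_piece f = {pt3 f<..<pt4 f}"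

definition flat_iterate :: "real \<Rightarrow> real \<Rightarrow> flat_tuple \<Rightarrow> int \<Rightarrow> real set" where
  "flat_iterate l1 l2 f i =
    (if i < 0 then {x \<in> {pt1 f..1}. (circle_map l1 l2 f ^^ nat (- i)) x \<in> flat_piece f}
     else (circle_map l1 l2 f ^^ nat i) ` flat_piece f)"

text \<open>
  Endpoints and length are read off in the coordinate. If the rotation number is irrational,
  no preimage of the flat piece contains the cut point \<open>pt1 f\<close>: this point is the second image
  of the flat piece, which would then be periodic. So these preimages are intervals of reals.
\<close>

definition endpoints :: "real set \<Rightarrow> real set" where
  "endpoints A = {Inf A, Sup A}"

definition interval_length :: "real set \<Rightarrow> real" where
  "interval_length A = Sup A - Inf A"

definition circle_dist :: "flat_tuple \<Rightarrow> real \<Rightarrow> real \<Rightarrow> real" where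
  "circle_dist f x y = min \<bar>x - y\<bar> (circle_length f - \<bar>x - y\<bar>)"

definition gap :: "real \<Rightarrow> real \<Rightarrow> flat_tuple \<Rightarrow> int \<Rightarrow> int \<Rightarrow> real" where
  "gap l1 l2 f i j =
     Min {circle_dist f a b | a b.
            a \<in> endpoints (flat_iterate l1 l2 f i) \<and> b \<in> endpoints (flat_iterate l1 l2 f j)}"

definition half_closed_gap :: "real \<Rightarrow> real \<Rightarrow> flat_tuple \<Rightarrow> int \<Rightarrow> int \<Rightarrow> real" where
  "half_closed_gap l1 l2 f i j = interval_length (flat_iterate l1 l2 f i) + gap l1 l2 f i j"

definition scaling_ratio :: "real \<Rightarrow> real \<Rightarrow> flat_tuple \<Rightarrow> nat \<Rightarrow> real" where
  "scaling_ratio l1 l2 f n =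
     gap l1 l2 f (- int (qseq n)) 0 / half_closed_gap l1 l2 f (- int (qseq n)) 0"

text \<open>Since \<open>x / 0 = 0\<close>, the lower bound also forces \<open>Y p \<noteq> 0\<close>.\<close>

definition comparable :: "(nat \<Rightarrow> real) \<Rightarrow> (nat \<Rightarrow> real) \<Rightarrow> bool" where
  "comparable X Y \<longleftrightarrow> (\<exists>a b. 0 < a \<and> 0 < b \<and> (\<forall>p. a \<le> X p / Y p \<and> X p / Y p \<le> b))"

end

theory Submission
  imports Defs
begin

text \<open>
  Maps with negative Schwarzian derivative expand cross-ratios. Applied to quadruples of endpoints of
  preimages of the flat piece and of points of its orbit, iterated by the closest returns, this gives
  for \<open>w\<^sub>n = - ln \<alpha>\<^sub>n\<close> that \<open>\<ell> w\<^sub>n\<^sub>+\<^sub>2\<close> is at least \<open>w\<^sub>n\<^sub>+\<^sub>1 + w\<^sub>n\<close> up to a factor tending to \<open>1\<close>, where \<open>\<ell>\<close>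
  is the critical exponent on the side of the flat piece determined by the parity of \<open>n\<close>. Since
  \<open>\<ell> < 2\<close>, \<open>w\<close> grows exponentially, so \<open>\<alpha>\<^sub>n\<close> tends to \<open>0\<close> doubly exponentially. In this regime the
  complementary cross-ratios give the reverse inequality, and \<open>\<ell> w\<^sub>n\<^sub>+\<^sub>2 = w\<^sub>n\<^sub>+\<^sub>1 + w\<^sub>n + O(1)\<close>. The two-step
  matrix of this recursion has eigenvalues \<open>lam_s < 1 < lam_u\<close>, whence \<open>w\<^sub>2\<^sub>p\<close> and \<open>w\<^sub>2\<^sub>p\<^sub>+\<^sub>1\<close> are comparable
  to \<open>lam_u ^ p\<close>: the invariants may be taken to be \<open>c_u = - 1\<close> and \<open>c_s = c_plus = 0\<close>.
\<close>

section \<open>Cross-ratios and negative Schwarzian derivative\<close>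

text \<open>The chain of inequalities alternates two moves: \<open>G\<close>, the passage next to
  the flat piece, and \<open>H\<close>, the long passage from a neighbourhood of \<open>0\<close>
  back to it. The exponent enters through one quadruple straddling \<open>0\<close>; two rounds of
  \<open>G\<close> and \<open>H\<close> after it produce the two summands of the recursion. Closest
  returns alternate sides, so the exponent alternates between \<open>l2\<close> and
  \<open>l1\<close>. One obstacle looks circular: the corrections in the chain are factors such as
  \<open>U / (U + ta n)\<close>, which approach \<open>1\<close> only if the orbit accumulates at
  both ends of the flat piece, and the growth of \<open>w\<close> cannot be used to show this. So
  wandering intervals at these ends are excluded beforehand, by the same chain in a form free of
  additive errors. After that the power laws hold with errors that are small multiples of
  \<open>w\<close>, and once \<open>w\<close> is large, bounded errors are harmless. In the reverse
  inequality the danger is that gaps between neighbours in the ladder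
  \<open>ta (n + 2) < tg n < te n < ta n\<close>, or in its image near \<open>0\<close>, are far
  shorter than \<open>\<alpha>\<close> suggests; most of the work there bounds these relative gaps
  from below.\<close>

definition cross_ratio :: "real \<Rightarrow> real \<Rightarrow> real \<Rightarrow> real \<Rightarrow> real" where
  "cross_ratio p q r s = ((r - q) * (s - p)) / ((r - p) * (s - q))"

lemma cross_ratio_reverse: "cross_ratio s r q p = cross_ratio p q r s"
proof -
  have "(q - r) * (p - s) = (r - q) * (s - p)" "(q - s) * (p - r) = (r - p) * (s - q)"
    by (simp_all add: algebra_simps)
  then show ?thesis
    by (simp add: cross_ratio_def)
qed

lemma one_minus_cross_ratio:
  assumes "p \<noteq> r" "q \<noteq> s"
  shows "1 - cross_ratio p q r s = ((q - p) * (s - r)) / ((r - p) * (s - q))"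
proof -
  have "(r - p) * (s - q) \<noteq> 0" using assms by simp
  then show ?thesis
    unfolding cross_ratio_def by (simp add: divide_simps) (simp add: algebra_simps)
qed

lemma cross_ratio_affine:
  assumes "c \<noteq> 0"
  shows "cross_ratio (c * p + d) (c * q + d) (c * r + d) (c * s + d) = cross_ratio p q r s"
proof -
  have "((c * r + d) - (c * q + d)) * ((c * s + d) - (c * p + d)) = c\<^sup>2 * ((r - q) * (s - p))"
       "((c * r + d) - (c * p + d)) * ((c * s + d) - (c * q + d)) = c\<^sup>2 * ((r - p) * (s - q))"
    by (simp_all add: algebra_simps power2_eq_square)
  with assms show ?thesis
    by (simp add: cross_ratio_def)
qed

text \<open>The chord \<open>l\<close> of the convex function \<open>u = 1 / sqrt f1\<close> lies
  above \<open>u\<close>, so \<open>f1\<close> is at least \<open>1 / l^2\<close>. The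
  antiderivative \<open>N\<close> of \<open>1 / l^2\<close> is a Moebius map that vanishes at
  \<open>x\<close> and equals \<open>(y - x) / (u x * u y)\<close> at \<open>y\<close>.\<close>

lemma derivative_product_le_if_convex:
  fixes f f1 :: "real \<Rightarrow> real"
  assumes xy: "x < y"
    and cont: "continuous_on {x..y} f"
    and der: "\<And>t. x < t \<Longrightarrow> t < y \<Longrightarrow> (f has_real_derivative f1 t) (at t)"
    and pos: "\<And>t. x \<le> t \<Longrightarrow> t \<le> y \<Longrightarrow> 0 < f1 t"
    and conv: "convex_on {x..y} (\<lambda>t. 1 / sqrt (f1 t))"
  shows "f1 x * f1 y * (y - x)\<^sup>2 \<le> (f y - f x)\<^sup>2"
proof -
  define u where "u t = 1 / sqrt (f1 t)" for t
  have upos: "0 < u t" if "x \<le> t" "t \<le> y" for t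
    using pos[OF that] by (simp add: u_def)
  have u2: "1 / (u t)\<^sup>2 = f1 t" if "x \<le> t" "t \<le> y" for t
    using pos[OF that] by (simp add: u_def power_divide)
  define l where "l t = ((y - t) * u x + (t - x) * u y) / (y - x)" for t
  have l_ge: "u t \<le> l t" if "x \<le> t" "t \<le> y" for t
  proof -
    have eq: "t = (1 - (t - x) / (y - x)) *\<^sub>R x + ((t - x) / (y - x)) *\<^sub>R y"
      using xy by (simp add: divide_simps) (simp add: algebra_simps)
    have "u t \<le> (1 - (t - x) / (y - x)) * u x + ((t - x) / (y - x)) * u y"
      by (subst eq, unfold u_def, rule convex_onD[OF conv]) (use that xy in auto)
    also have "\<dots> = l t"
      using xy by (simp add: l_def divide_simps)
    finally show ?thesis .
  qed
  have lpos: "0 < l t" if "x \<le> t" "t \<le> y" for t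
    using l_ge[OF that] upos[OF that] by simp
  define N where "N t = (t - x) / (u x * l t)" for t
  have lder: "(l has_real_derivative (u y - u x) / (y - x)) (at t)" for t
    unfolding l_def using xy by (auto intro!: derivative_eq_intros)
  have lx: "l t = u x + (t - x) * ((u y - u x) / (y - x))" for t
    using xy by (simp add: l_def divide_simps) (simp add: algebra_simps)
  have Nder: "(N has_real_derivative 1 / (l t)\<^sup>2) (at t)" if "x \<le> t" "t \<le> y" for t
  proof -
    have "(N has_real_derivative
        (1 * (u x * l t) - (t - x) * (u x * ((u y - u x) / (y - x)))) / ((u x * l t) * (u x * l t))) (at t)"
      unfolding N_def
      using DERIV_divide[OF DERIV_diff[OF DERIV_ident DERIV_const] DERIV_cmult[OF lder], of "u x" t x]
        lpos[OF that] upos[of x] xy by simp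
    also have "1 * (u x * l t) - (t - x) * (u x * ((u y - u x) / (y - x))) = u x * u x"
      by (subst lx) (simp add: algebra_simps)
    finally show ?thesis
      using upos[of x] xy by (simp add: power2_eq_square)
  qed
  have "f x - N x \<le> f y - N y"
  proof (rule DERIV_nonneg_imp_increasing_open[OF less_imp_le[OF xy]])
    fix t assume t: "x < t" "t < y"
    have "((\<lambda>t. f t - N t) has_real_derivative f1 t - 1 / (l t)\<^sup>2) (at t)"
      by (rule DERIV_diff[OF der[OF t] Nder]) (use t in auto)
    moreover have "0 \<le> f1 t - 1 / (l t)\<^sup>2"
    proof -
      have "1 / (l t)\<^sup>2 \<le> 1 / (u t)\<^sup>2"
        using l_ge[of t] upos[of t] t by (intro divide_left_mono power_mono mult_pos_pos) auto
      then show ?thesis using u2[of t] t by simp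
    qed
    ultimately show "\<exists>d. ((\<lambda>t. f t - N t) has_real_derivative d) (at t) \<and> 0 \<le> d" by blast
  next
    have "continuous_on {x..y} N"
      by (rule DERIV_continuous_on) (use Nder in \<open>auto intro: DERIV_subset\<close>)
    then show "continuous_on {x..y} (\<lambda>t. f t - N t)"
      by (intro continuous_intros cont)
  qed
  moreover have "N x = 0" by (simp add: N_def)
  moreover have "l y = u y" using xy by (simp add: l_def)
  ultimately have *: "(y - x) / (u x * u y) \<le> f y - f x" by (simp add: N_def)
  have "f1 x * f1 y * (y - x)\<^sup>2 = ((y - x) / (u x * u y))\<^sup>2"
    using u2[of x] u2[of y] xy by (simp add: power_divide power_mult_distrib flip: u2)
  also have "\<dots> \<le> (f y - f x)\<^sup>2"
    using * upos[of x] upos[of y] xy by (intro power_mono) auto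
  finally show ?thesis .
qed

text \<open>By the preceding product bound, the mixed second derivative of
  \<open>ln ((f y - f x) / (y - x))\<close> is nonpositive. Integrating it over \<open>y\<close> in
  \<open>{c..d}\<close> and then over \<open>x\<close> in \<open>{a..b}\<close> gives the logarithm
  of the claim.\<close>

lemma cross_ratio_expand:
  fixes f f1 :: "real \<Rightarrow> real"
  assumes ord: "a < b" "b < c" "c < d"
    and cont: "continuous_on {a..d} f"
    and der: "\<And>t. a < t \<Longrightarrow> t < d \<Longrightarrow> (f has_real_derivative f1 t) (at t)"
    and pos: "\<And>t. a < t \<Longrightarrow> t < d \<Longrightarrow> 0 < f1 t"
    and conv: "convex_on {a<..<d} (\<lambda>t. 1 / sqrt (f1 t))"
  shows "cross_ratio a b c d \<le> cross_ratio (f a) (f b) (f c) (f d)"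
proof -
  have smono: "f x < f y" if "a \<le> x" "x < y" "y \<le> d" for x y
  proof (rule DERIV_pos_imp_increasing_open[OF that(2)])
    show "continuous_on {x..y} f" using that by (intro continuous_on_subset[OF cont]) auto
    fix t assume "x < t" "t < y"
    then show "\<exists>z. (f has_real_derivative z) (at t) \<and> 0 < z"
      using der[of t] pos[of t] that by auto
  qed
  have key: "f1 x * f1 y * (y - x)\<^sup>2 \<le> (f y - f x)\<^sup>2" if "a < x" "x < y" "y < d" for x y
    by (rule derivative_product_le_if_convex)
       (use that in \<open>auto intro: der pos continuous_on_subset[OF cont] convex_on_subset[OF conv]\<close>)
  \<comment> \<open>Minus the derivative of \<open>ln ((f y - f b) / (y - b))\<close> with respect
    to \<open>b\<close>; the product bound says that it increases in \<open>y\<close>.\<close>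
  define k where "k b y = f1 b / (f y - f b) - 1 / (y - b)" for b y
  have k_mono: "k x c \<le> k x d" if "a < x" "x \<le> b" for x
  proof (rule DERIV_nonneg_imp_increasing_open[OF less_imp_le[OF ord(3)]])
    fix y assume y: "c < y" "y < d"
    have ne: "f x < f y" using that y ord by (intro smono) auto
    have "((\<lambda>y. k x y) has_real_derivative - (f1 x * f1 y) / (f y - f x)\<^sup>2 + 1 / (y - x)\<^sup>2) (at y)"
    proof -
      have "(f has_real_derivative f1 y) (at y)" using y that ord by (intro der) auto
      from DERIV_diff[OF DERIV_divide[OF DERIV_const DERIV_diff[OF this DERIV_const], of "f x" "f1 x"]
          DERIV_divide[OF DERIV_const DERIV_diff[OF DERIV_ident DERIV_const], of y x 1]]
      show ?thesis unfolding k_def using that y ord ne by (simp add: power2_eq_square)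
    qed
    moreover have "0 \<le> - (f1 x * f1 y) / (f y - f x)\<^sup>2 + 1 / (y - x)\<^sup>2"
      using key[of x y] that y ord ne by (simp add: divide_simps)
    ultimately show "\<exists>D. ((\<lambda>y. k x y) has_real_derivative D) (at y) \<and> 0 \<le> D" by blast
  next
    have "f y - f x \<noteq> 0" if "y \<in> {c..d}" for y
      using smono[of x y] that \<open>a < x\<close> \<open>x \<le> b\<close> ord by auto
    then show "continuous_on {c..d} (k x)"
      unfolding k_def using that ord by (intro continuous_intros continuous_on_subset[OF cont]) auto
  qed
  define Q where "Q x = ln ((f c - f x) / (f d - f x) * ((d - x) / (c - x)))" for x
  have Q': "Q x = ln (f c - f x) - ln (f d - f x) + ln (d - x) - ln (c - x)" if "a \<le> x" "x \<le> b" for x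
    using smono[of x c] smono[of x d] that ord unfolding Q_def by (simp add: ln_div ln_mult)
  have "Q a \<le> Q b"
  proof (rule DERIV_nonneg_imp_increasing_open[OF less_imp_le[OF ord(1)]])
    fix x assume x: "a < x" "x < b"
    have ne: "f x < f c" "f x < f d" using x ord by (auto intro!: smono)
    have "((\<lambda>x. ln (f c - f x) - ln (f d - f x) + ln (d - x) - ln (c - x)) has_real_derivative k x d - k x c) (at x)"
    proof -
      have "(f has_real_derivative f1 x) (at x)" using x ord by (intro der) auto
      from DERIV_diff[OF DERIV_const this]
      have 1: "((\<lambda>x. f c - f x) has_real_derivative - f1 x) (at x)" "((\<lambda>x. f d - f x) has_real_derivative - f1 x) (at x)"
        by auto
      have 2: "((\<lambda>x. d - x) has_real_derivative - 1) (at x)" "((\<lambda>x. c - x) has_real_derivative - 1) (at x)"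
        by (auto intro!: derivative_eq_intros)
      have "((\<lambda>x. ln (f c - f x) - ln (f d - f x) + ln (d - x) - ln (c - x)) has_real_derivative
         1 / (f c - f x) * (- f1 x) - 1 / (f d - f x) * (- f1 x) + 1 / (d - x) * (- 1) - 1 / (c - x) * (- 1)) (at x)"
        by (intro DERIV_diff DERIV_add DERIV_chain2[OF DERIV_ln_divide] 1 2) (use x ord ne in auto)
      then show ?thesis by (simp add: k_def algebra_simps)
    qed
    then have "(Q has_real_derivative k x d - k x c) (at x)"
    proof (rule has_field_derivative_transform_within_open)
      show "open {a<..<b}" "x \<in> {a<..<b}" using x by simp_all
      show "ln (f c - f y) - ln (f d - f y) + ln (d - y) - ln (c - y) = Q y" if "y \<in> {a<..<b}" for y
        using that by (simp add: Q')
    qed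
    then show "\<exists>D. (Q has_real_derivative D) (at x) \<and> 0 \<le> D"
      using k_mono[of x] x by force
  next
    have "f x < f c" "f x < f d" if "x \<in> {a..b}" for x
      using that ord by (auto intro!: smono)
    then have "continuous_on {a..b} (\<lambda>x. ln (f c - f x) - ln (f d - f x) + ln (d - x) - ln (c - x))"
      using ord by (intro continuous_intros continuous_on_subset[OF cont]) force+
    then show "continuous_on {a..b} Q"
      by (rule continuous_on_eq) (auto simp: Q')
  qed
  moreover have fab: "f a < f b" "f b < f c" "f c < f d" using ord by (auto intro!: smono)
  ultimately have "(f c - f a) / (f d - f a) * ((d - a) / (c - a)) \<le> (f c - f b) / (f d - f b) * ((d - b) / (c - b))"
    unfolding Q_def using ord by (subst (asm) ln_le_cancel_iff) (auto intro!: mult_pos_pos divide_pos_pos)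
  then have "(d - a) * (c - b) / ((c - a) * (d - b)) \<le> (f c - f b) * (f d - f a) / ((f c - f a) * (f d - f b))"
    using ord fab by (simp add: divide_simps mult_ac)
  then show ?thesis by (simp add: cross_ratio_def mult_ac)
qed

text \<open>The second derivative of \<open>u = 1 / sqrt f1\<close> is \<open>- u / 2\<close> times
  the Schwarzian derivative.\<close>

lemma convex_inverse_sqrt_derivative:
  fixes f1 f2 f3 :: "real \<Rightarrow> real"
  assumes d1: "\<And>t. a < t \<Longrightarrow> t < d \<Longrightarrow> (f1 has_real_derivative f2 t) (at t)"
    and d2: "\<And>t. a < t \<Longrightarrow> t < d \<Longrightarrow> (f2 has_real_derivative f3 t) (at t)"
    and pos: "\<And>t. a < t \<Longrightarrow> t < d \<Longrightarrow> 0 < f1 t"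
    and S: "\<And>t. a < t \<Longrightarrow> t < d \<Longrightarrow> f3 t / f1 t - 3 / 2 * (f2 t / f1 t)\<^sup>2 < 0"
  shows "convex_on {a<..<d} (\<lambda>t. 1 / sqrt (f1 t))"
proof -
  let ?u1 = "\<lambda>t. - (1/2) * f1 t powr (-3/2) * f2 t"
  let ?u2 = "\<lambda>t. - (1/2) * f1 t powr (-1/2) * (f3 t / f1 t - 3 / 2 * (f2 t / f1 t)\<^sup>2)"
  show ?thesis
  proof (rule f''_ge0_imp_convex[where f' = ?u1 and f'' = ?u2])
    fix t assume t': "t \<in> {a<..<d}"
    then have t: "a < t" "t < d" by auto
    note p = pos[OF t]
    have "((\<lambda>t. f1 t powr (-1/2)) has_real_derivative ?u1 t) (at t)"
      using DERIV_fun_powr[OF d1[OF t] p, of "-1/2"] by simp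
    then show "((\<lambda>t. 1 / sqrt (f1 t)) has_real_derivative ?u1 t) (at t)"
    proof (rule has_field_derivative_transform_within_open)
      show "open {a<..<d}" "t \<in> {a<..<d}" using t' by simp_all
      show "f1 x powr (-1/2) = 1 / sqrt (f1 x)" if "x \<in> {a<..<d}" for x
        using powr_minus_divide[of "f1 x" "1/2"] powr_half_sqrt[of "f1 x"] pos[of x] that by auto
    qed
    obtain w where w: "f1 t powr (-1/2) = w" by blast
    have e: "f1 t powr (-3/2 - 1) = w / (f1 t)\<^sup>2" "f1 t powr (-3/2) = w / f1 t"
      using p powr_diff[of "f1 t" "-1/2" 2] powr_diff[of "f1 t" "-1/2" 1]
      unfolding w by (simp_all add: powr_numeral)
    have "(?u1 has_real_derivative
       - (1/2) * ((-3/2) * f1 t powr (-3/2 - 1) * f2 t) * f2 t + - (1/2) * f1 t powr (-3/2) * f3 t) (at t)"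
    proof -
      have "((\<lambda>t. f1 t powr (-3/2)) has_real_derivative (-3/2) * f1 t powr (-3/2 - 1) * f2 t) (at t)"
        using DERIV_fun_powr[OF d1[OF t] p, of "-3/2"] by simp
      from DERIV_mult[OF DERIV_cmult[OF this, of "-(1/2)"] d2[OF t]]
      show ?thesis by (simp add: algebra_simps)
    qed
    also have "- (1/2) * ((-3/2) * f1 t powr (-3/2 - 1) * f2 t) * f2 t + - (1/2) * f1 t powr (-3/2) * f3 t = ?u2 t"
      unfolding e w using p by (simp add: power2_eq_square algebra_simps)
    finally show "(?u1 has_real_derivative ?u2 t) (at t)" .
    show "0 \<le> ?u2 t" using S[OF t] by (simp add: mult_nonneg_nonpos2 mult_nonneg_nonpos)
  qed simp
qed

section \<open>Power laws at an endpoint\<close>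

text \<open>Equivalently \<open>v t = t powr l * exp (k t)\<close> near \<open>0\<close> with \<open>k\<close> Lipschitz.\<close>

definition power_like :: "real \<Rightarrow> (real \<Rightarrow> real) \<Rightarrow> bool" where
  "power_like l v \<longleftrightarrow> (\<exists>d>0. \<exists>K\<ge>0. \<forall>s t. 0 < s \<and> s \<le> t \<and> t < d \<longrightarrow>
     0 < v s \<and> \<bar>ln (v t) - ln (v s) - l * (ln t - ln s)\<bar> \<le> K * (t - s))"

lemma power_likeI:
  assumes "0 < d" "0 \<le> K"
    and "\<And>s t. 0 < s \<Longrightarrow> s \<le> t \<Longrightarrow> t < d \<Longrightarrow> 0 < v s"
    and "\<And>s t. 0 < s \<Longrightarrow> s \<le> t \<Longrightarrow> t < d \<Longrightarrow> \<bar>ln (v t) - ln (v s) - l * (ln t - ln s)\<bar> \<le> K * (t - s)"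
  shows "power_like l v"
  using assms unfolding power_like_def by blast

lemma ln_diff_le_if_less: "0 < s \<Longrightarrow> s \<le> t \<Longrightarrow> ln t - ln s \<le> (t - s) / s" for s t :: real
  using ln_le_minus_one[of "t / s"] by (simp add: ln_div field_simps)

lemma ln_diff_ge_if_less: "0 < s \<Longrightarrow> s \<le> t \<Longrightarrow> (t - s) / t \<le> ln t - ln s" for s t :: real
  using ln_le_minus_one[of "s / t"] by (simp add: ln_div field_simps)

lemma power_like_powr: "power_like l (\<lambda>t. t powr l)"
  by (rule power_likeI[of 1 0]) (auto simp: ln_powr algebra_simps)

lemma power_like_cmult:
  assumes "power_like l v" "0 < c" shows "power_like l (\<lambda>t. c * v t)"
proof -
  obtain d K where dK: "0 < d" "0 \<le> K"
    and v: "\<And>s t. 0 < s \<Longrightarrow> s \<le> t \<Longrightarrow> t < d \<Longrightarrow> 0 < v s \<and> \<bar>ln (v t) - ln (v s) - l * (ln t - ln s)\<bar> \<le> K * (t - s)"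
    using assms(1) unfolding power_like_def by blast
  show ?thesis
  proof (rule power_likeI[OF dK])
    fix s t :: real assume st: "0 < s" "s \<le> t" "t < d"
    show "0 < c * v s" using v[OF st] assms(2) by simp
    have "ln (c * v t) - ln (c * v s) = ln (v t) - ln (v s)"
      using v[OF st] v[of t t] st assms(2) by (simp add: ln_mult)
    then show "\<bar>ln (c * v t) - ln (c * v s) - l * (ln t - ln s)\<bar> \<le> K * (t - s)"
      using v[OF st] by simp
  qed
qed

lemma power_like_cong:
  assumes "power_like l v" "0 < e" "\<And>t. 0 < t \<Longrightarrow> t < e \<Longrightarrow> w t = v t"
  shows "power_like l w"
proof -
  obtain d K where dK: "0 < d" "0 \<le> K"
    and v: "\<And>s t. 0 < s \<Longrightarrow> s \<le> t \<Longrightarrow> t < d \<Longrightarrow> 0 < v s \<and> \<bar>ln (v t) - ln (v s) - l * (ln t - ln s)\<bar> \<le> K * (t - s)"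
    using assms(1) unfolding power_like_def by blast
  show ?thesis
    by (rule power_likeI[of "min d e" K]) (use dK v assms(2,3) in auto)
qed

text \<open>The error of \<open>u\<close> is measured by \<open>v t - v s\<close>, so
  \<open>v\<close> has to be shown increasing and Lipschitz near \<open>0\<close>. The hypothesis
  \<open>1 \<le> l\<close> yields \<open>v t \<le> B * t\<close>, from which the Lipschitz bound
  follows.\<close>

lemma power_like_compose:
  assumes u: "power_like m u" and v: "power_like l v" and l: "1 \<le> l"
    and lim: "\<And>e. 0 < e \<Longrightarrow> \<exists>d>0. \<forall>t. 0 < t \<and> t < d \<longrightarrow> v t < e"
  shows "power_like (m * l) (\<lambda>t. u (v t))"
proof -
  obtain d K where dK: "0 < d" "0 \<le> K"
    and v: "\<And>s t. 0 < s \<Longrightarrow> s \<le> t \<Longrightarrow> t < d \<Longrightarrow> 0 < v s"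
     "\<And>s t. 0 < s \<Longrightarrow> s \<le> t \<Longrightarrow> t < d \<Longrightarrow> \<bar>ln (v t) - ln (v s) - l * (ln t - ln s)\<bar> \<le> K * (t - s)"
    using v unfolding power_like_def by blast
  obtain d' K' where dK': "0 < d'" "0 \<le> K'"
    and u: "\<And>s t. 0 < s \<Longrightarrow> s \<le> t \<Longrightarrow> t < d' \<Longrightarrow> 0 < u s"
     "\<And>s t. 0 < s \<Longrightarrow> s \<le> t \<Longrightarrow> t < d' \<Longrightarrow> \<bar>ln (u t) - ln (u s) - m * (ln t - ln s)\<bar> \<le> K' * (t - s)"
    using u unfolding power_like_def by blast
  obtain e where e: "0 < e" "\<And>t. 0 < t \<Longrightarrow> t < e \<Longrightarrow> v t < d'" using lim[OF dK'(1)] by blast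
  \<comment> \<open>The bound \<open>1 / (K + 1)\<close> makes \<open>K * t \<le> 1\<close>, so the
    error \<open>K * (t - s)\<close> is at most \<open>ln t - ln s\<close> and cannot undo the
    growth of \<open>v\<close>.\<close>
  define t0 where "t0 = Min {d, e, 1 / (K + 1), 1} / 2"
  have t0: "0 < t0" "t0 < d" "t0 < e" "t0 * (K + 1) \<le> 1" "t0 \<le> 1"
  proof -
    show "0 < t0" using dK e by (simp add: t0_def)
    then have "2 * t0 \<le> 1 / (K + 1)" "2 * t0 \<le> d" "2 * t0 \<le> e" "2 * t0 \<le> 1"
      unfolding t0_def by simp_all
    with \<open>0 < t0\<close> show "t0 < d" "t0 < e" "t0 * (K + 1) \<le> 1" "t0 \<le> 1"
      using dK by (auto simp: field_simps)
  qed
  have vpos: "0 < v t" if "0 < t" "t \<le> t0" for t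
    using v(1)[of t t] that t0 by auto
  have ln_v: "\<bar>ln (v t) - ln (v s) - l * (ln t - ln s)\<bar> \<le> K * (t - s)" if "0 < s" "s \<le> t" "t \<le> t0" for s t
    using v(2)[of s t] that t0 by auto
  define B where "B = v t0 / t0 * exp K"
  have v_le: "v t \<le> B * t" if t: "0 < t" "t \<le> t0" for t
  proof -
    have "\<bar>ln (v t0) - ln (v t) - l * (ln t0 - ln t)\<bar> \<le> K * (t0 - t)"
      using ln_v[of t t0] t by auto
    also have "\<dots> \<le> K * 1" using dK t t0 by (intro mult_left_mono) auto
    finally have "ln (v t) \<le> ln (v t0) - l * (ln t0 - ln t) + K" by linarith
    moreover have "ln t0 - ln t \<le> l * (ln t0 - ln t)"
      using mult_right_mono[OF l, of "ln t0 - ln t"] t by simp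
    ultimately have "ln (v t) - ln t \<le> ln (v t0) - ln t0 + K" by linarith
    then have "ln (v t / t) \<le> ln B" using t t0 vpos[of t] vpos[of t0] by (simp add: B_def ln_div ln_mult)
    then have "v t / t \<le> B" using vpos[of t] vpos[of t0] t t0 by (simp add: B_def)
    then show ?thesis using t by (simp add: field_simps)
  qed
  have Bpos: "0 < B" using vpos[of t0] t0 by (simp add: B_def)
  have lip: "v t - v s \<le> 2 * B * (l + K) * (t - s) \<and> v s \<le> v t" if st: "0 < s" "s \<le> t" "t \<le> t0" for s t
  proof -
    have vs: "0 < v s" "0 < v t" using vpos st t0 by auto
    have lnt: "(t - s) / t \<le> ln t - ln s" "ln t - ln s \<le> (t - s) / s"
      using ln_diff_ge_if_less ln_diff_le_if_less st by auto
    have lnts: "0 \<le> ln t - ln s" using st by simp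
    have "K * (t - s) = (K * t) * ((t - s) / t)" using st by simp
    also have "\<dots> \<le> 1 * ((t - s) / t)"
    proof (rule mult_right_mono)
      have "K * t \<le> (K + 1) * t0" using dK st t0 by (intro mult_mono) auto
      then show "K * t \<le> 1" using t0 by (simp add: mult.commute)
    qed (use st in auto)
    finally have K1: "K * (t - s) \<le> ln t - ln s" using lnt by simp
    also have "\<dots> \<le> l * (ln t - ln s)" using l lnts mult_right_mono[of 1 l] by simp
    finally have "ln (v s) \<le> ln (v t)" using ln_v[OF st] by linarith
    then have le: "v s \<le> v t" using vs by simp
    have "v t - v s \<le> 2 * B * (l + K) * (t - s)"
    \<comment> \<open>If \<open>s\<close> is at most \<open>t / 2\<close>, then \<open>t\<close> is
      at most \<open>2 * (t - s)\<close> and \<open>v t \<le> B * t\<close> suffices. Otherwise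
      \<open>t / s < 2\<close>, and the logarithmic estimate turns into an additive one.\<close>
    proof (cases "s \<le> t / 2")
      case True
      have "v t - v s \<le> B * t" using v_le[of t] vs st by simp
      also have "\<dots> \<le> B * (2 * (t - s))" using True Bpos by (intro mult_left_mono) auto
      also have "\<dots> \<le> (l + K) * (2 * B * (t - s))"
      proof -
        have "0 \<le> B * (2 * (t - s))" using Bpos st by simp
        from mult_right_mono[OF _ this, of 1 "l + K"] show ?thesis using l dK by (simp add: mult_ac)
      qed
      finally show ?thesis by (simp add: algebra_simps)
    next
      case False
      have "(v t - v s) / v t \<le> ln (v t) - ln (v s)" using ln_diff_ge_if_less[OF vs(1) le] .
      also have "\<dots> \<le> l * (ln t - ln s) + K * (t - s)" using ln_v[OF st] by linarith
      also have "K * (t - s) \<le> K * (ln t - ln s)"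
      proof (rule mult_left_mono[OF _ dK(2)])
        have "(t - s) * t \<le> (t - s) * 1" using st t0 by (intro mult_left_mono) auto
        then show "t - s \<le> ln t - ln s" using lnt(1) st by (simp add: pos_le_divide_eq) (smt (verit) pos_le_divide_eq)
      qed
      finally have "(v t - v s) / v t \<le> (l + K) * (ln t - ln s)"
        by (simp add: algebra_simps)
      then have "v t - v s \<le> v t * ((l + K) * (ln t - ln s))"
        using vs by (simp add: pos_divide_le_eq mult.commute)
      also have "\<dots> \<le> (B * t) * ((l + K) * ((t - s) / s))"
        using v_le[of t] vs st l dK lnt lnts Bpos by (intro mult_mono) auto
      also have "\<dots> = (B * (l + K) * (t - s)) * (t / s)" by simp
      also have "\<dots> \<le> (B * (l + K) * (t - s)) * 2"
        using False st Bpos l dK by (intro mult_left_mono) (auto simp: pos_divide_le_eq)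
      finally show ?thesis by (simp add: mult_ac)
    qed
    with le show ?thesis by simp
  qed
  show ?thesis
  proof (rule power_likeI[of t0 "K' * (2 * B * (l + K)) + \<bar>m\<bar> * K"])
    show "0 < t0" by (rule t0)
    show "0 \<le> K' * (2 * B * (l + K)) + \<bar>m\<bar> * K" using dK dK' Bpos l by simp
    fix s t :: real assume st: "0 < s" "s \<le> t" "t < t0"
    have v': "0 < v s" "v s \<le> v t" "v t < d'" "v t - v s \<le> 2 * B * (l + K) * (t - s)"
      using vpos[of s] lip[of s t] e(2)[of t] st t0 by auto
    show "0 < u (v s)" using u(1)[OF v'(1-3)] .
    have "\<bar>ln (u (v t)) - ln (u (v s)) - m * l * (ln t - ln s)\<bar> \<le>
      \<bar>ln (u (v t)) - ln (u (v s)) - m * (ln (v t) - ln (v s))\<bar> + \<bar>m * (ln (v t) - ln (v s) - l * (ln t - ln s))\<bar>"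
      by (simp add: algebra_simps)
    also have "\<dots> \<le> K' * (v t - v s) + \<bar>m\<bar> * (K * (t - s))"
      unfolding abs_mult using ln_v[of s t] u(2)[OF v'(1-3)] st
      by (intro add_mono mult_left_mono) auto
    also have "K' * (v t - v s) \<le> K' * (2 * B * (l + K) * (t - s))"
      using v' dK' by (intro mult_left_mono) auto
    finally show "\<bar>ln (u (v t)) - ln (u (v s)) - m * l * (ln t - ln s)\<bar> \<le> (K' * (2 * B * (l + K)) + \<bar>m\<bar> * K) * (t - s)"
      by (simp add: algebra_simps)
  qed
qed

text \<open>Since \<open>h z = z * h' y\<close> for some \<open>y\<close> between \<open>0\<close>
  and \<open>z\<close>, the derivative of \<open>ln (h z / z)\<close> is
  \<open>(h' z - h' y) / h z\<close>. The numerator is at most \<open>K * z\<close> in absolute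
  value, the denominator at least \<open>c * z\<close>.\<close>

lemma power_like_one_if_derivative_Lipschitz:
  fixes h h' :: "real \<Rightarrow> real"
  assumes d: "0 < d" and K: "0 \<le> K" and h0: "h 0 = 0" and h'0: "0 < h' 0"
    and cont: "continuous_on {0..d} h"
    and der: "\<And>t. 0 < t \<Longrightarrow> t < d \<Longrightarrow> (h has_real_derivative h' t) (at t)"
    and lip: "\<And>t s. 0 \<le> t \<Longrightarrow> t \<le> d \<Longrightarrow> 0 \<le> s \<Longrightarrow> s \<le> d \<Longrightarrow> \<bar>h' t - h' s\<bar> \<le> K * \<bar>t - s\<bar>"
  shows "power_like 1 h"
proof -
  define c where "c = h' 0 / 2"
  define e where "e = min d (c / (K + 1))"
  have e: "0 < e" "e \<le> d" "0 < c" using d K h'0 by (auto simp: e_def c_def)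
  have h'_ge: "c \<le> h' t" if "0 \<le> t" "t \<le> e" for t
  proof -
    have "K * t \<le> (K + 1) * (c / (K + 1))" using that K e by (intro mult_mono) (auto simp: e_def)
    then have "K * t \<le> c" using K by simp
    then show ?thesis using lip[of t 0] that e d by (simp add: c_def)
  qed
  have mvt: "\<exists>z. 0 < z \<and> z < t \<and> h t = t * h' z" if t: "0 < t" "t \<le> e" for t
  proof -
    have "\<exists>l z. 0 < z \<and> z < t \<and> DERIV h z :> l \<and> h t - h 0 = (t - 0) * l"
    proof (rule MVT)
      show "continuous_on {0..t} h" using t e by (intro continuous_on_subset[OF cont]) auto
      show "h differentiable (at x)" if "0 < x" "x < t" for x
        using der[of x] that t e by (auto simp: real_differentiable_def)
    qed (use t in simp)
    then obtain l z where z: "0 < z" "z < t" "DERIV h z :> l" "h t = t * l" using h0 by auto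
    then have "l = h' z" using DERIV_unique[OF z(3) der[of z]] t e by auto
    with z show ?thesis by auto
  qed
  have h_ge: "c * t \<le> h t" if t: "0 < t" "t \<le> e" for t
  proof -
    obtain z where "0 < z" "z < t" "h t = t * h' z" using mvt[OF t] by blast
    then show ?thesis using h'_ge[of z] t by (simp add: mult.commute)
  qed
  have hpos: "0 < h t" if "0 < t" "t \<le> e" for t
    using h_ge[OF that] e that by (smt (verit) mult_pos_pos)
  show ?thesis
  proof (rule power_likeI[of e "K / c"])
    show "0 < e" "0 \<le> K / c" using e K by auto
    fix s t :: real assume st: "0 < s" "s \<le> t" "t < e"
    show "0 < h s" using hpos[of s] st by auto
    show "\<bar>ln (h t) - ln (h s) - 1 * (ln t - ln s)\<bar> \<le> K / c * (t - s)"
    proof (cases "s = t")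
      case False
      define g where "g t = ln (h t) - ln t" for t
      have g': "(g has_real_derivative h' x / h x - 1 / x) (at x)" if "s \<le> x" "x \<le> t" for x
      proof -
        have 1: "(h has_real_derivative h' x) (at x)" using that st e by (intro der) auto
        show ?thesis unfolding g_def
          using DERIV_diff[OF DERIV_chain2[OF DERIV_ln_divide 1] DERIV_ln_divide] hpos[of x] that st by auto
      qed
      have "\<exists>z>s. z < t \<and> g t - g s = (t - s) * (h' z / h z - 1 / z)"
        by (rule MVT2) (use False st g' in auto)
      then obtain z where z: "s < z" "z < t" "g t - g s = (t - s) * (h' z / h z - 1 / z)" by blast
      obtain y where y: "0 < y" "y < z" "h z = z * h' y" using mvt[of z] z st by auto
      have hz: "c * z \<le> h z" "0 < z" using h_ge[of z] z st by auto
      have "\<bar>h' z / h z - 1 / z\<bar> = \<bar>h' z - h' y\<bar> / h z"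
      proof -
        have hz0: "0 < h z" using hpos[of z] z st by auto
        have "h' z / h z - 1 / z = (h' z - h' y) / h z"
          using hz0 hz(2) y(3) by (auto simp: divide_simps)
        then show ?thesis using hz0 by (simp add: abs_divide)
      qed
      also have "\<dots> \<le> (K * z) / (c * z)"
      proof (rule frac_le)
        have "\<bar>h' z - h' y\<bar> \<le> K * \<bar>z - y\<bar>" using lip[of z y] z y st e by auto
        also have "\<dots> \<le> K * z" using y z K by (intro mult_left_mono) auto
        finally show "\<bar>h' z - h' y\<bar> \<le> K * z" .
      qed (use hz e K in auto)
      also have "\<dots> = K / c" using hz by simp
      finally have "(t - s) * \<bar>h' z / h z - 1 / z\<bar> \<le> (t - s) * (K / c)"
        using st by (intro mult_left_mono) auto
      then have "\<bar>g t - g s\<bar> \<le> K / c * (t - s)"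
        unfolding z(3) abs_mult using st by (simp add: mult.commute)
      then show ?thesis by (simp add: g_def algebra_simps)
    qed simp
  qed
qed

text \<open>The slope of \<open>ln (z + u)\<close> as a function of \<open>ln z\<close> is
  \<open>z / (z + u)\<close>, largest at \<open>z = y\<close>. With \<open>u\<close> the length of
  the flat piece, this turns corrections into a fraction of the quantity being corrected.\<close>

lemma ln_add_const_diff_le:
  fixes x y u :: real
  assumes "0 < x" "x \<le> y" "0 < u"
  shows "ln (y + u) - ln (x + u) \<le> y / (y + u) * (ln y - ln x)"
proof -
  define f where "f x = y / (y + u) * (ln y - ln x) - (ln (y + u) - ln (x + u))" for x
  have "f y \<le> f x"
  proof (rule DERIV_nonpos_imp_nonincreasing[OF assms(2)])
    fix z assume z: "x \<le> z" "z \<le> y"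
    have "(f has_real_derivative y / (y + u) * (0 - 1 / z) - (0 - 1 / (z + u))) (at z)"
      unfolding f_def using z assms
      by (auto intro!: derivative_eq_intros)
    moreover have "y / (y + u) * (0 - 1 / z) - (0 - 1 / (z + u)) \<le> 0"
    proof -
      have "z * (y + u) \<le> y * (z + u)" using z assms by (simp add: algebra_simps)
      then have "1 / (z + u) \<le> y / ((y + u) * z)" using z assms
        by (simp add: divide_simps mult_ac)
      then show ?thesis by simp
    qed
    ultimately show "\<exists>d. (f has_real_derivative d) (at z) \<and> d \<le> 0" by blast
  qed
  then show ?thesis by (simp add: f_def)
qed

section \<open>An approximate two-step linear recursion\<close>

text \<open>\<open>comparable\<close> quantifies over every index while the asymptotic bounds hold
  eventually; the finitely many remaining positive values go into the constants.\<close>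

lemma positive_bounds_if_eventually:
  fixes f :: "nat \<Rightarrow> real"
  assumes pos: "\<And>p. 0 < f p" and ab: "0 < a" "\<And>p. p1 \<le> p \<Longrightarrow> a \<le> f p \<and> f p \<le> b"
  shows "\<exists>a' b'. 0 < a' \<and> 0 < b' \<and> (\<forall>p. a' \<le> f p \<and> f p \<le> b')"
proof -
  define a' where "a' = Min (insert a (f ` {..<p1}))"
  define b' where "b' = Max (insert b (f ` {..<p1}))"
  have "a' \<le> f p \<and> f p \<le> b'" for p
  proof (cases "p < p1")
    case True
    then show ?thesis by (auto simp: a'_def b'_def intro!: Min_le Max_ge)
  next
    case False
    then have "a \<le> f p" "f p \<le> b" using ab(2)[of p] by auto
    moreover have "a' \<le> a" "b \<le> b'" by (simp_all add: a'_def b'_def)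
    ultimately show ?thesis by simp
  qed
  moreover have "0 < a'" using pos ab by (auto simp: a'_def)
  moreover from calculation have "0 < b'" using pos[of 0] by (meson less_le_trans)
  ultimately show ?thesis by blast
qed

lemma comparable_minus_geometric:
  fixes w :: "nat \<Rightarrow> real"
  assumes pos: "\<And>p. 0 < w p" and lam: "0 < lam"
    and c: "0 < c" "\<And>p. p1 \<le> p \<Longrightarrow> c * lam ^ p \<le> w p \<and> w p \<le> C * lam ^ p"
  shows "comparable (\<lambda>p. - w p) (\<lambda>p. (- 1) * lam ^ p + 0 * m ^ p + 0)"
proof -
  have "\<exists>a' b'. 0 < a' \<and> 0 < b' \<and> (\<forall>p. a' \<le> w p / lam ^ p \<and> w p / lam ^ p \<le> b')"
    by (rule positive_bounds_if_eventually[of _ c p1 C])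
       (use pos lam c in \<open>auto simp: pos_le_divide_eq pos_divide_le_eq\<close>)
  then show ?thesis unfolding comparable_def by simp
qed

text \<open>As \<open>lam * d = d + D\<close>, the quantity \<open>E - d\<close> grows at least by
  the factor \<open>lam\<close> and \<open>E + d\<close> at most. Divergence of \<open>E\<close>
  supplies an index where \<open>E - d\<close> is at least \<open>1\<close>.\<close>

lemma geometric_bounds_if_approximately_geometric:
  fixes E :: "nat \<Rightarrow> real"
  assumes lam: "1 < lam" and E: "\<And>p. p0 \<le> p \<Longrightarrow> \<bar>E (Suc p) - lam * E p\<bar> \<le> D"
    and lim: "filterlim E at_top sequentially"
  shows "\<exists>c>0. \<exists>C>0. \<exists>p1. \<forall>p\<ge>p1. c * lam ^ p \<le> E p \<and> E p \<le> C * lam ^ p"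
proof -
  define d where "d = D / (lam - 1)"
  have D: "0 \<le> D" using E[of p0] by simp
  have d: "lam * d = d + D" "0 \<le> d" using lam D by (auto simp: d_def field_simps)
  have "eventually (\<lambda>p. d + 1 \<le> E p) sequentially"
    using lim by (simp add: filterlim_at_top)
  then obtain p1 where p1: "\<And>p. p1 \<le> p \<Longrightarrow> d + 1 \<le> E p" by (auto simp: eventually_sequentially)
  define q where "q = max p0 p1"
  have lower: "lam ^ k * (E q - d) \<le> E (q + k) - d" for k
  proof (induction k)
    case (Suc k)
    have "lam ^ Suc k * (E q - d) \<le> lam * (E (q + k) - d)" using Suc lam by (simp add: mult.assoc)
    also have "\<dots> \<le> E (q + Suc k) - d"
      using E[of "q + k"] d by (simp add: q_def algebra_simps abs_le_iff)
    finally show ?case .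
  qed simp
  have upper: "E (q + k) + d \<le> lam ^ k * (E q + d)" for k
  proof (induction k)
    case (Suc k)
    have "E (q + Suc k) + d \<le> lam * (E (q + k) + d)"
      using E[of "q + k"] d by (simp add: q_def algebra_simps abs_le_iff)
    also have "\<dots> \<le> lam ^ Suc k * (E q + d)" using Suc lam by (simp add: mult.assoc)
    finally show ?case .
  qed simp
  have Eq: "d + 1 \<le> E q" using p1[of q] by (simp add: q_def)
  show ?thesis
  proof (intro exI conjI allI impI)
    show "0 < 1 / lam ^ q" "0 < (E q + d) / lam ^ q" using lam d Eq by auto
    fix p assume "q \<le> p"
    then obtain k where p: "p = q + k" using le_Suc_ex by blast
    have "1 / lam ^ q * lam ^ p = lam ^ k" using lam by (simp add: p power_add)
    also have "\<dots> \<le> lam ^ k * (E q - d)" using lam Eq by simp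
    also have "\<dots> \<le> E p" using lower[of k] d by (simp add: p)
    finally show "1 / lam ^ q * lam ^ p \<le> E p" .
    have "E p \<le> lam ^ k * (E q + d)" using upper[of k] d by (simp add: p)
    also have "\<dots> = (E q + d) / lam ^ q * lam ^ p" using lam by (simp add: p power_add)
    finally show "E p \<le> (E q + d) / lam ^ q * lam ^ p" .
  qed
qed

text \<open>The eigenvector controls only a combination of the even and the odd terms. Upper bounds
  for both follow by positivity; for the lower bounds one more application of the recursion
  distributes the growth to each parity.\<close>

lemma two_step_recursion_growth:
  fixes w :: "nat \<Rightarrow> real"
  assumes b: "0 < b1" "0 < b2" "b1 < 1" "b2 < 1"
    and lam: "1 < lam" "lam\<^sup>2 - (b1 + b2 + b1 * b2) * lam + b1 * b2 = 0"
    and pos: "\<And>n. 0 < w n"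
    and rec: "\<And>n. n0 \<le> n \<Longrightarrow> \<bar>w (n + 2) - (if even n then b2 else b1) * (w (n + 1) + w n)\<bar> \<le> C"
    and lim: "filterlim w at_top sequentially"
  shows "comparable (\<lambda>p. - w (2 * p)) (\<lambda>p. (- 1) * lam ^ p + 0 * m ^ p + 0)"
    and "comparable (\<lambda>p. - w (2 * p + 1)) (\<lambda>p. (- 1) * lam ^ p + 0 * m ^ p + 0)"
proof -
  define X where "X p = w (2 * p)" for p
  define Y where "Y p = w (2 * p + 1)" for p
  define u where "u = b1 * b2 / (lam - b2)"
  have u: "0 < u" using b lam by (simp add: u_def)
  have uX: "u * b2 + b1 * b2 = lam * u" using b lam by (simp add: u_def field_simps)
  have uY: "u * b2 + b1 * b2 + b1 = lam"
  proof -
    have "u * (lam - b2) = b1 * b2" using b lam by (simp add: u_def)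
    moreover have "(lam - b2) * (u * b2 + b1 * b2 + b1 - lam) = u * (lam - b2) * b2 + (lam - b2) * (b1 * b2 + b1 - lam)"
      by (simp add: algebra_simps)
    ultimately have "(lam - b2) * (u * b2 + b1 * b2 + b1 - lam) = - (lam\<^sup>2 - (b1 + b2 + b1 * b2) * lam + b1 * b2)"
      by (simp add: power2_eq_square algebra_simps)
    then show ?thesis using lam b by simp
  qed
  \<comment> \<open>the left eigenvector of the two-step matrix for the eigenvalue \<open>lam\<close>\<close>
  define E where "E p = u * X p + Y p" for p
  have C: "0 \<le> C" using rec[of n0] by (meson abs_ge_zero order_refl order_trans)
  have Xr: "\<bar>X (Suc p) - b2 * (X p + Y p)\<bar> \<le> C" if "n0 \<le> p" for p
    using rec[of "2 * p"] that by (simp add: X_def Y_def add.commute)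
  have Yr: "\<bar>Y (Suc p) - b1 * (X (Suc p) + Y p)\<bar> \<le> C" if "n0 \<le> p" for p
    using rec[of "2 * p + 1"] that by (simp add: X_def Y_def add.commute)
  have Er: "\<bar>E (Suc p) - lam * E p\<bar> \<le> (u + b1 + 1) * C" if p: "n0 \<le> p" for p
  proof -
    have "E (Suc p) - lam * E p = (u + b1) * (X (Suc p) - b2 * (X p + Y p)) + (Y (Suc p) - b1 * (X (Suc p) + Y p))
      + ((u * b2 + b1 * b2) - lam * u) * X p + ((u * b2 + b1 * b2 + b1) - lam) * Y p"
      unfolding E_def by (simp add: algebra_simps)
    also have "\<dots> = (u + b1) * (X (Suc p) - b2 * (X p + Y p)) + (Y (Suc p) - b1 * (X (Suc p) + Y p))"
    proof -
      have "(u * b2 + b1 * b2) - lam * u = 0" "(u * b2 + b1 * b2 + b1) - lam = 0" using uX uY by simp_all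
      then show ?thesis by (simp only: mult_zero_left add_0_right)
    qed
    also have "\<bar>\<dots>\<bar> \<le> (u + b1) * \<bar>X (Suc p) - b2 * (X p + Y p)\<bar> + \<bar>Y (Suc p) - b1 * (X (Suc p) + Y p)\<bar>"
      using u b by (intro order_trans[OF abs_triangle_ineq]) (simp add: abs_mult)
    also have "\<dots> \<le> (u + b1) * C + C"
      using Xr[OF p] Yr[OF p] u b by (intro add_mono mult_left_mono) auto
    finally show ?thesis by (simp add: algebra_simps)
  qed
  have XY: "0 < X p" "0 < Y p" for p using pos by (auto simp: X_def Y_def)
  have limY: "filterlim Y at_top sequentially"
    unfolding Y_def by (rule filterlim_compose[OF lim]) (auto intro!: filterlim_subseq strict_monoI)
  have "filterlim E at_top sequentially"
    by (rule filterlim_at_top_mono[OF limY]) (use XY u in \<open>auto simp: E_def less_imp_le intro!: always_eventually mult_nonneg_nonneg\<close>)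
  from geometric_bounds_if_approximately_geometric[OF lam(1) Er this]
  obtain c c' p1 where c: "0 < c" "0 < c'" and Eb: "\<And>p. p1 \<le> p \<Longrightarrow> c * lam ^ p \<le> E p \<and> E p \<le> c' * lam ^ p"
    by blast
  define k where "k = 1 / (u + 1)"
  have k: "0 < k" using u by (simp add: k_def)
  have XYE: "k * E p \<le> X p + Y p" for p
  proof -
    have "E p \<le> (u + 1) * (X p + Y p)" using XY[of p] u by (simp add: E_def algebra_simps)
    then show ?thesis using u by (simp add: k_def field_simps)
  qed
  \<comment> \<open>\<open>g * lam ^ p\<close> bounds \<open>b2 * (X r + Y r)\<close> from below for
    \<open>p = Suc r\<close>. The threshold \<open>4 * C / (b1 * g)\<close> makes \<open>C\<close>
    at most half of the main term in the lower bounds for both \<open>X\<close> and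
    \<open>Y\<close>.\<close>
  define g where "g = b2 * k * c / lam"
  have g: "0 < g" using b k c lam by (simp add: g_def)
  have "eventually (\<lambda>p. 4 * C / (b1 * g) \<le> lam ^ p) sequentially"
  proof -
    obtain r where "4 * C / (b1 * g) < lam ^ r" using real_arch_pow[OF lam(1)] by blast
    then show ?thesis
      unfolding eventually_sequentially using lam power_increasing[of r _ lam]
      by (intro exI[of _ r]) (auto intro: less_imp_le order_trans)
  qed
  then obtain p2 where p2: "\<And>p. p2 \<le> p \<Longrightarrow> 4 * C / (b1 * g) \<le> lam ^ p" by (auto simp: eventually_sequentially)
  define q where "q = Suc (max n0 (max p1 p2))"
  have X_ge: "g / 2 * lam ^ p \<le> X p" if p: "q \<le> p" for p
  proof -
    obtain r where r: "p = Suc r" "n0 \<le> r" "p1 \<le> r" "p2 \<le> r" using p by (cases p) (auto simp: q_def)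
    have "g * lam ^ p = b2 * (k * (c * lam ^ r))" using lam by (simp add: g_def r(1))
    also have "\<dots> \<le> b2 * (X r + Y r)"
      using Eb[OF r(3)] XYE[of r] k b by (intro mult_left_mono order_trans[OF mult_left_mono XYE]) auto
    also have "\<dots> \<le> X p + C" using Xr[OF r(2)] by (simp add: r(1) abs_le_iff)
    finally have "g * lam ^ p \<le> X p + C" .
    moreover have "2 * C \<le> g * lam ^ p"
    proof -
      have "4 * C \<le> lam ^ p * (b1 * g)" using p2[of p] r b g by (simp add: pos_divide_le_eq)
      also have "\<dots> \<le> lam ^ p * (1 * g)" using b g lam by (intro mult_left_mono mult_right_mono) auto
      finally show ?thesis using C by (simp add: mult.commute)
    qed
    ultimately show ?thesis by linarith
  qed
  have X_le: "X p \<le> c' / u * lam ^ p" if "q \<le> p" for p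
  proof -
    have "p1 \<le> p" using that by (simp add: q_def)
    from Eb[OF this] have "u * X p \<le> c' * lam ^ p" using XY[of p] by (simp add: E_def)
    then show ?thesis using u by (simp add: field_simps)
  qed
  have Y_le: "Y p \<le> c' * lam ^ p" if "q \<le> p" for p
  proof -
    have "p1 \<le> p" using that by (simp add: q_def)
    from Eb[OF this] show ?thesis using mult_pos_pos[OF u XY(1), of p] unfolding E_def by linarith
  qed
  have Y_ge: "b1 * g * (1/4) * lam ^ p \<le> Y p" if p: "q \<le> p" for p
  proof -
    obtain r where r: "p = Suc r" "n0 \<le> r" "p1 \<le> r" "p2 \<le> r" using p by (cases p) (auto simp: q_def)
    have "b1 * (g / 2 * lam ^ p) \<le> b1 * (X p + Y r)"
      using X_ge[OF p] XY[of r] b by (intro mult_left_mono) auto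
    also have "\<dots> \<le> Y p + C" using Yr[OF r(2)] by (simp add: r(1) abs_le_iff)
    finally have "b1 * (g / 2 * lam ^ p) \<le> Y p + C" .
    moreover have "4 * C \<le> lam ^ p * (b1 * g)" using p2[of p] r b g by (simp add: pos_divide_le_eq)
    ultimately show ?thesis by (simp add: algebra_simps)
  qed
  show "comparable (\<lambda>p. - w (2 * p)) (\<lambda>p. (- 1) * lam ^ p + 0 * m ^ p + 0)"
    by (rule comparable_minus_geometric[where c = "g / 2" and C = "c' / u" and ?p1.0 = q])
       (use pos lam g X_ge X_le in \<open>auto simp: X_def\<close>)
  show "comparable (\<lambda>p. - w (2 * p + 1)) (\<lambda>p. (- 1) * lam ^ p + 0 * m ^ p + 0)"
    by (rule comparable_minus_geometric[where c = "b1 * g * (1/4)" and C = c' and ?p1.0 = q])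
       (use pos lam g b Y_ge Y_le in \<open>auto simp: Y_def\<close>)
qed

text \<open>Weight \<open>nu / 2\<close> on each of two consecutive terms multiplies a common lower
  bound of them by \<open>nu\<close> every two steps.\<close>

lemma tendsto_at_top_if_two_step_growth:
  fixes w :: "nat \<Rightarrow> real"
  assumes pos: "\<And>n. 0 < w n" and nu: "1 < nu"
    and rec: "\<And>n. n0 \<le> n \<Longrightarrow> nu / 2 * (w n + w (n + 1)) \<le> w (n + 2)"
  shows "filterlim w at_top sequentially"
proof -
  define M where "M = min (w n0) (w (n0 + 1))"
  have M: "0 < M" using pos by (simp add: M_def)
  have *: "nu ^ k * M \<le> w (n0 + 2 * k) \<and> nu ^ k * M \<le> w (n0 + 2 * k + 1)" for k
  proof (induction k)
    case (Suc k)
    define x where "x = nu ^ k * M"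
    have x: "0 < x" using M nu by (simp add: x_def)
    have "nu / 2 * (x + x) \<le> nu / 2 * (w (n0 + 2 * k) + w (n0 + 2 * k + 1))"
      using Suc nu by (intro mult_left_mono add_mono) (auto simp: x_def)
    also have "\<dots> \<le> w (n0 + 2 * k + 2)" using rec[of "n0 + 2 * k"] by simp
    finally have 1: "nu * x \<le> w (n0 + 2 * k + 2)" by simp
    have "nu / 2 * (x + x) \<le> nu / 2 * (w (n0 + 2 * k + 1) + w (n0 + 2 * k + 2))"
    proof (intro mult_left_mono add_mono)
      show "x \<le> w (n0 + 2 * k + 2)" using 1 mult_right_mono[of 1 nu x] x nu by linarith
    qed (use Suc nu in \<open>auto simp: x_def\<close>)
    also have "\<dots> \<le> w (n0 + 2 * k + 3)" using rec[of "n0 + 2 * k + 1"] by (simp add: eval_nat_numeral)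
    finally have 2: "nu * x \<le> w (n0 + 2 * k + 3)" by simp
    show ?case using 1 2 by (simp add: x_def eval_nat_numeral mult.assoc)
  qed (simp add: M_def)
  show ?thesis unfolding filterlim_at_top eventually_sequentially
  proof
    fix Z :: real
    obtain r where r: "Z / M < nu ^ r" using real_arch_pow[OF nu] by blast
    have "Z \<le> w n" if "n0 + 2 * r \<le> n" for n
    proof -
      define k where "k = (n - n0) div 2"
      have k: "n = n0 + 2 * k \<or> n = n0 + 2 * k + 1" using that unfolding k_def by presburger
      then have "r \<le> k" using that by auto
      then have "nu ^ r * M \<le> nu ^ k * M" using nu M by (intro mult_right_mono power_increasing) auto
      also have "\<dots> \<le> w n" using k *[of k] by auto
      finally show ?thesis using r M by (simp add: pos_divide_less_eq)
    qed
    then show "\<exists>n0. \<forall>n\<ge>n0. Z \<le> w n" by blast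
  qed
qed

text \<open>At \<open>1\<close> the polynomial equals \<open>1 - b1 - b2\<close>. Exponents below
  \<open>2\<close> make this negative, since their reciprocals exceed \<open>1 / 2\<close>.\<close>

lemma recursion_eigenvalue:
  fixes b1 b2 :: real
  assumes "0 < b1" "0 < b2" "b1 < 1" "b2 < 1" "1 < b1 + b2"
  shows "\<exists>x>1. x\<^sup>2 - (b1 + b2 + b1 * b2) * x + b1 * b2 = 0"
proof -
  let ?p = "\<lambda>x. x\<^sup>2 - (b1 + b2 + b1 * b2) * x + b1 * b2"
  define t where "t = b1 + b2 + b1 * b2 + 1"
  have t: "1 \<le> t" using assms by (simp add: t_def)
  have p1: "?p 1 < 0" using assms by simp
  have "?p t = t + b1 * b2" by (simp add: t_def power2_eq_square algebra_simps)
  then have pt: "0 \<le> ?p t" using t assms mult_pos_pos[of b1 b2] by simp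
  have "\<exists>x\<ge>1. x \<le> t \<and> ?p x = 0"
    by (rule IVT') (use p1 pt t in \<open>auto intro!: continuous_intros\<close>)
  then obtain x where "1 \<le> x" "?p x = 0" by blast
  then show ?thesis using p1 by (intro exI[of _ x]) (auto simp: order_le_less)
qed

section \<open>Lifts with golden mean rotation number\<close>

text \<open>\<open>pseq n / qseq n\<close> are the convergents of the golden mean, so
  \<open>pseq n\<close> counts the turns made by the closest return of time
  \<open>qseq n\<close>.\<close>

fun pseq :: "nat \<Rightarrow> int" where
  "pseq 0 = 0"
| "pseq (Suc 0) = 1"
| "pseq (Suc (Suc n)) = pseq (Suc n) + pseq n"

lemma qseq_pos: "1 \<le> qseq n"
  by (induction n rule: qseq.induct) auto

lemma qseq_mono: "qseq n \<le> qseq (n + 1)"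
  by (cases n) auto

lemma qseq_ge_3: "3 \<le> n \<Longrightarrow> 3 \<le> qseq n"
  by (rule order_trans[OF _ lift_Suc_mono_le[of qseq 3 n]])
     (use qseq_mono in \<open>auto simp: eval_nat_numeral\<close>)

abbreviation golden :: real where "golden \<equiv> golden_continued_fraction"

lemma golden_bounds: "0 < golden" "golden < 1" and golden_square: "golden * golden = 1 - golden"
proof -
  have "2 < sqrt 5" "sqrt 5 < 3" by (auto intro: real_less_rsqrt real_less_lsqrt)
  then show "0 < golden" "golden < 1" by (auto simp: golden_continued_fraction_eq)
  show "golden * golden = 1 - golden"
    by (simp add: golden_continued_fraction_eq field_simps)
qed

text \<open>The alternating sign is the reason why consecutive closest returns lie on opposite
  sides. The induction step is \<open>golden * golden = 1 - golden\<close>.\<close>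

lemma convergent_error: "real (qseq n) * golden - of_int (pseq n) = (- 1) ^ n * golden ^ (n + 1)"
proof (induction n rule: qseq.induct)
  case 2
  then show ?case by (simp add: golden_square)
next
  case (3 n)
  have "golden ^ (Suc (Suc n) + 1) = golden * golden * golden ^ (n + 1)" by simp
  also have "\<dots> = golden ^ (n + 1) - golden ^ (Suc n + 1)" by (simp add: golden_square algebra_simps)
  finally have e: "golden ^ (Suc (Suc n) + 1) = golden ^ (n + 1) - golden ^ (Suc n + 1)" .
  have "real (qseq (Suc (Suc n))) * golden - of_int (pseq (Suc (Suc n))) =
      (real (qseq (Suc n)) * golden - of_int (pseq (Suc n))) + (real (qseq n) * golden - of_int (pseq n))"
    by (simp add: algebra_simps)
  also have "\<dots> = (- 1) ^ Suc (Suc n) * golden ^ (Suc (Suc n) + 1)"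
    unfolding 3 e by (simp add: right_diff_distrib)
  finally show ?case .
qed simp

text \<open>What the argument uses of the lift: \<open>L\<close> is the length of the circle,
  \<open>Lam\<close> a Lipschitz constant. The laws \<open>pow0_right\<close> and
  \<open>pow0_left\<close> concern two iterates because \<open>F\<close> may have breaks at
  \<open>0\<close> and at \<open>F 0\<close>; \<open>cross\<close> is restricted to intervals free
  of breaks and of the flat piece.\<close>

locale fibonacci_lift =
  fixes F :: "real \<Rightarrow> real" and L x1 x3 x4 l1 l2 Lam :: real
  assumes pts: "x1 < 0" "0 < x3" "x3 < x4" "x4 < x1 + L"
    and cont: "continuous_on UNIV F"
    and mono: "x \<le> y \<Longrightarrow> F x \<le> F y"
    and shift: "F (x + L) = F x + L"
    and F0: "F 0 = x1 + L"
    and flat_val: "x3 \<le> x \<Longrightarrow> x \<le> x4 \<Longrightarrow> F x = L"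
    and flat: "x < y \<Longrightarrow> F x = F y \<Longrightarrow> \<exists>k::int. x3 + of_int k * L \<le> x \<and> y \<le> x4 + of_int k * L"
    and rot: "0 < n \<Longrightarrow> (F ^^ n) x < x + of_int k * L \<longleftrightarrow> real n * golden < of_int k"
    and rot_neq: "0 < n \<Longrightarrow> (F ^^ n) x \<noteq> x + of_int k * L"
    and cross: "p < q \<Longrightarrow> q < r \<Longrightarrow> r < s \<Longrightarrow>
      (\<And>x k. p < x \<Longrightarrow> x < s \<Longrightarrow> x \<noteq> of_int k * L \<and> x \<noteq> x1 + of_int k * L \<and>
         \<not> (x3 + of_int k * L \<le> x \<and> x \<le> x4 + of_int k * L)) \<Longrightarrow>
      cross_ratio p q r s \<le> cross_ratio (F p) (F q) (F r) (F s)"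
    and lip: "x \<le> y \<Longrightarrow> y \<le> x + L \<Longrightarrow> F y - F x \<le> Lam * (y - x)"
    and exps: "1 < l1" "l1 < 2" "1 < l2" "l2 < 2"
    and pow_right: "power_like l2 (\<lambda>t. F (x4 + t) - L)"
    and pow_left: "power_like l1 (\<lambda>t. L - F (x3 - t))"
    and pow0_right: "power_like 1 (\<lambda>t. F (F t) - F (F 0))"
    and pow0_left: "power_like 1 (\<lambda>t. F (F 0) - F (F (- t)))"
begin

lemma L_pos: "0 < L" using pts by linarith

lemma shift_int: "F (x + of_int k * L) = F x + of_int k * L"
proof (induction k rule: int_induct[where k = 0])
  case (step1 i)
  then show ?case using shift[of "x + of_int i * L"] by (simp add: algebra_simps)
next
  case (step2 i)
  then show ?case using shift[of "x + of_int (i - 1) * L"] by (simp add: algebra_simps)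
qed simp

lemma funpow_shift: "(F ^^ n) (x + of_int k * L) = (F ^^ n) x + of_int k * L"
  by (induction n) (auto simp: shift_int)

lemma funpow_mono: "x \<le> y \<Longrightarrow> (F ^^ n) x \<le> (F ^^ n) y"
  by (induction n) (auto intro: mono)

lemma funpow_cont: "continuous_on UNIV (F ^^ n)"
proof (induction n)
  case (Suc n)
  then show ?case
    using continuous_on_compose[OF Suc continuous_on_subset[OF cont]] by simp
qed (simp add: continuous_on_id[unfolded id_def] id_def)

section \<open>Iterates up to whole turns, and their injectivity over the flat piece\<close>

definition S :: "nat \<Rightarrow> int \<Rightarrow> real \<Rightarrow> real" where
  "S m k x = (F ^^ m) x - of_int k * L"

lemma S_S: "S m k (S m' k' x) = S (m + m') (k + k') x"
  using funpow_shift[of m "(F ^^ m') x" "- k'"] by (simp add: S_def funpow_add algebra_simps)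

lemma S_mono: "x \<le> y \<Longrightarrow> S m k x \<le> S m k y"
  using funpow_mono by (simp add: S_def)

lemma S_less_cancel: "S m k x < S m k y \<Longrightarrow> x < y"
  using S_mono[of y x m k] by linarith

lemma S_cont: "continuous_on A (S m k)"
  unfolding S_def by (intro continuous_intros continuous_on_subset[OF funpow_cont]) auto

lemma S_surj: "\<exists>x. S m k x = y"
proof -
  define j where "j = \<lceil>\<bar>y - S m k 0\<bar> / L\<rceil>"
  have j: "\<bar>y - S m k 0\<bar> \<le> of_int j * L"
    using L_pos le_of_int_ceiling[of "\<bar>y - S m k 0\<bar> / L"] unfolding j_def by (simp only: pos_divide_le_eq)
  have e: "S m k (of_int i * L) = S m k 0 + of_int i * L" for i
    using funpow_shift[of m 0 i] by (simp add: S_def)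
  have "\<exists>x\<ge>of_int (- j) * L. x \<le> of_int j * L \<and> S m k x = y"
    by (rule IVT') (use j e[of j] e[of "- j"] S_cont in \<open>auto simp: abs_le_iff\<close>)
  then show ?thesis by blast
qed

text \<open>Points can merge only by entering a translate of the flat piece together, and such a
  translate is mapped to a translate of \<open>0\<close>.\<close>

lemma S_eq_imp_orbit:
  assumes "x < y" "S m k x = S m k y"
  shows "\<exists>i k'. S m k x = S i k' 0"
  using assms(2)
proof (induction m arbitrary: k)
  case 0
  then show ?case using assms(1) by (simp add: S_def)
next
  case (Suc m)
  have e: "S (Suc m) k z = S 1 k (S m 0 z)" for z by (simp add: S_S)
  show ?case
  proof (cases "S m 0 x = S m 0 y")
    case True
    then obtain i k' where "S m 0 x = S i k' 0" using Suc.IH by blast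
    then show ?thesis unfolding e by (metis S_S)
  next
    case False
    then have lt: "S m 0 x < S m 0 y" using S_mono[of x y m 0] assms(1) by simp
    moreover have "F (S m 0 x) = F (S m 0 y)" using Suc.prems unfolding e by (simp add: S_def)
    ultimately obtain j :: int where j: "x3 + of_int j * L \<le> S m 0 x" "S m 0 y \<le> x4 + of_int j * L"
      using flat by blast
    have "F (S m 0 x) = L + of_int j * L"
      using shift_int[of "S m 0 x - of_int j * L" j] flat_val[of "S m 0 x - of_int j * L"] j lt by simp
    then have "S 1 k (S m 0 x) = S 0 (k - 1 - j) 0" by (simp add: S_def algebra_simps)
    then show ?thesis unfolding e by blast
  qed
qed

text \<open>One further step would bring \<open>0\<close> back to a translate of itself, against
  \<open>rot_neq\<close>.\<close>

lemma orbit_not_in_flat: "\<not> (x3 \<le> S m k 0 \<and> S m k 0 \<le> x4)"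
proof
  assume "x3 \<le> S m k 0 \<and> S m k 0 \<le> x4"
  then have "F (S m k 0) = L" using flat_val by simp
  then have "S 1 0 (S m k 0) = L" by (simp add: S_def)
  then have "(F ^^ (Suc m)) 0 = 0 + of_int (k + 1) * L" unfolding S_S by (simp add: S_def algebra_simps)
  then show False using rot_neq[of "Suc m" 0 "k + 1"] by blast
qed

text \<open>This makes preimages of the edges unique, so the points \<open>NN\<close> and
  \<open>EE\<close> introduced below by choice are determined.\<close>

lemma S_inj_edge:
  assumes "S m k x = S m k y" "x3 \<le> S m k x" "S m k x \<le> x4"
  shows "x = y"
proof (rule ccontr)
  assume "x \<noteq> y"
  then have "x < y \<or> y < x" by linarith
  then show False
    using S_eq_imp_orbit[of x y m k] S_eq_imp_orbit[of y x m k] assms orbit_not_in_flat by metis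
qed

text \<open>The side on which the closest return of index \<open>n\<close> falls. Multiplying by it
  lets one statement cover both orientations.\<close>

definition s :: "nat \<Rightarrow> real" where "s n = (- 1) ^ n"

lemma s_cases: "s n = 1 \<and> even n \<or> s n = - 1 \<and> odd n" by (cases "even n") (auto simp: s_def)
lemma s_Suc: "s (Suc n) = - s n" by (simp add: s_def)
lemma s_square: "s n * s n = 1" using s_cases[of n] by auto
lemma s_add_2: "s (n + 2) = s n" by (simp add: s_def)
lemma s_add_3: "s (n + 3) = - s n" by (simp add: s_def eval_nat_numeral)
lemma s_nonzero: "s n \<noteq> 0" using s_cases[of n] by auto

lemma S_signed_less_cancel: "s n * S m k x < s n * S m k y \<Longrightarrow> s n * x < s n * y"
  using s_cases[of n] S_less_cancel by auto

lemma S_signed_mono: "s n * x \<le> s n * y \<Longrightarrow> s n * S m k x \<le> s n * S m k y"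
  using s_cases[of n] S_mono by auto

text \<open>
  \<open>T n\<close> lifts the closest return \<open>f^q\<^sub>n\<close> and \<open>H n\<close> the same iterate with the last passage near
  the flat piece left out; \<open>G\<close> is the lift of \<open>f\<close> that vanishes on \<open>{x3..x4}\<close>.
\<close>

definition T :: "nat \<Rightarrow> real \<Rightarrow> real" where "T n = S (qseq n) (pseq n)"
definition H :: "nat \<Rightarrow> real \<Rightarrow> real" where "H n = S (qseq n - 1) (pseq n - 1)"
definition G :: "real \<Rightarrow> real" where "G = S 1 1"

lemma G_eq: "G x = F x - L" by (simp add: G_def S_def)

lemma T_displacement: "0 < s n * (T n x - x)"
proof -
  have *: "real (qseq n) * golden - of_int (pseq n) = s n * golden ^ (n + 1)"
    using convergent_error by (simp add: s_def)
  have "0 < golden ^ (n + 1)" using golden_bounds by simp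
  moreover have q: "0 < qseq n" using qseq_pos[of n] by simp
  note rot[OF q, of x "pseq n"] rot_neq[OF q, of x "pseq n"]
  ultimately show ?thesis using * s_cases[of n] by (auto simp: T_def S_def)
qed

lemma G_H: "G (H n x) = T n x" and H_G: "H n (G x) = T n x"
  using qseq_pos[of n] by (simp_all add: G_def H_def T_def S_S)

lemma T_T: "T n (T m x) = T m (T n x)"
  and T_G: "T n (G x) = G (T n x)"
  and T_H: "T n (H m x) = H m (T n x)"
  by (simp_all add: T_def H_def G_def S_S add.commute)

lemma H_T_Suc: "H n (T (n + 1) x) = H (n + 2) x"
  and H_Suc_T: "H (n + 1) (T n x) = H (n + 2) x"
  and T_Suc_T: "T (n + 1) (T n x) = T (n + 2) x"
  using qseq_pos[of n] qseq_pos[of "n + 1"]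
  by (simp_all add: H_def T_def S_S algebra_simps)

lemma T_1: "T 1 x = F x - L" and H_1: "H 1 x = x"
  by (simp_all add: T_def H_def S_def)

definition edge :: "nat \<Rightarrow> real" where "edge n = (if even n then x4 else x3)"

lemma edge_add_2: "edge (n + 2) = edge n" by (simp add: edge_def)
lemma edge_add_3: "edge (n + 3) = edge (n + 1)" by (simp add: edge_def)
lemma edge_in: "x3 \<le> edge n" "edge n \<le> x4" using pts by (auto simp: edge_def)
lemma edge_diff: "s n * (edge n - edge (n + 1)) = x4 - x3"
  using s_cases[of n] by (auto simp: edge_def)
lemma G_edge: "G (edge n) = 0" using flat_val edge_in by (simp add: G_eq)

text \<open>
  In the notation of the paper \<open>AA n\<close> is the point \<open>q\<^sub>n\<close>, and \<open>NN n\<close> and \<open>EE n\<close> are the ends of the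
  preimage \<open>- q\<^sub>n\<^sub>+\<^sub>1\<close> that are near to and far from the flat piece; \<open>edge n\<close> is the end of the
  flat piece facing them. The single letters denote the images under \<open>f\<close>, which lie near \<open>0\<close>,
  on the side given by the sign \<open>s n\<close>.
\<close>

definition AA :: "nat \<Rightarrow> real" where "AA n = H n 0"
definition NN :: "nat \<Rightarrow> real" where "NN n = (SOME x. T (n + 1) x = edge (n + 1))"
definition EE :: "nat \<Rightarrow> real" where "EE n = (SOME x. T (n + 1) x = edge n)"
definition A :: "nat \<Rightarrow> real" where "A n = G (AA n)"
definition N :: "nat \<Rightarrow> real" where "N n = G (NN n)"
definition E :: "nat \<Rightarrow> real" where "E n = G (EE n)"

lemma T_NN: "T (n + 1) (NN n) = edge (n + 1)"
  unfolding NN_def T_def by (rule someI_ex[OF S_surj])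

lemma T_EE: "T (n + 1) (EE n) = edge n"
  unfolding EE_def T_def by (rule someI_ex[OF S_surj])

lemma T_inj_edge: "T n x = edge m \<Longrightarrow> T n y = edge m \<Longrightarrow> x = y"
  unfolding T_def using S_inj_edge[of "qseq n" "pseq n" x y] edge_in[of m] by auto

lemma A_eq: "A n = T n 0" by (simp add: A_def AA_def G_H)

lemma H_N: "H (n + 1) (N n) = edge (n + 1)" and H_E: "H (n + 1) (E n) = edge n"
  by (simp_all only: N_def E_def H_G T_NN T_EE)

text \<open>Both sides have the same image under \<open>T (n + 1)\<close>, an edge of the flat
  piece, and preimages of edges are unique. The next two identities are obtained in the same
  way.\<close>

lemma H_E_Suc: "H n (E (n + 1)) = NN n"
proof (rule T_inj_edge[OF _ T_NN])
  show "T (n + 1) (H n (E (n + 1))) = edge (n + 1)"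
    unfolding T_H E_def T_G H_G T_T[of n] 
    using T_EE[of "n + 1"] T_Suc_T[of n "EE (n + 1)"] T_T[of n "n+1" "EE (n+1)"] by (simp add: T_G H_G)
qed

lemma H_N_Suc: "H n (N (n + 1)) = EE n"
proof (rule T_inj_edge[OF _ T_EE])
  show "T (n + 1) (H n (N (n + 1))) = edge n"
    unfolding T_H N_def T_G H_G
    using T_NN[of "n + 1"] T_Suc_T[of n "NN (n + 1)"] T_T[of n "n+1" "NN (n+1)"] edge_add_2[of n] by simp
qed

lemma H_E_same: "H (n + 2) (E (n + 2)) = EE n"
proof (rule T_inj_edge[OF _ T_EE])
  have "T (n + 1) (H (n + 2) (E (n + 2))) = H (n + 2) (T (n + 1) (E (n + 2)))" by (rule T_H)
  also have "\<dots> = H (n + 3) (E (n + 2))" using H_Suc_T[of "n + 1" "E (n + 2)"] by (simp add: eval_nat_numeral)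
  also have "\<dots> = edge n" using H_E[of "n + 2"] edge_add_2[of n] by (simp add: eval_nat_numeral)
  finally show "T (n + 1) (H (n + 2) (E (n + 2))) = edge n" .
qed

lemma H_A_Suc: "H n (A (n + 1)) = AA (n + 2)"
  unfolding A_eq H_T_Suc AA_def ..

lemma T_N: "T (n + 1) (N n) = 0"
  using G_H[of "n + 1" "N n"] by (simp only: H_N G_edge)

lemma H_N_back: "H (n + 2) (N n) = AA n"
  using H_T_Suc[of n "N n"] T_N[of n] by (simp add: AA_def)

text \<open>
  Distances of \<open>AA\<close>, \<open>NN\<close>, \<open>EE\<close> from the flat piece and of \<open>A\<close>, \<open>N\<close>, \<open>E\<close> from \<open>0\<close>;
  so \<open>\<alpha>\<^sub>n\<^sub>+\<^sub>1\<close> is \<open>tg n / te n\<close> for large \<open>n\<close>.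
\<close>

definition ta :: "nat \<Rightarrow> real" where "ta n = s n * (AA n - edge n)"
definition tg :: "nat \<Rightarrow> real" where "tg n = s n * (NN n - edge n)"
definition te :: "nat \<Rightarrow> real" where "te n = s n * (EE n - edge n)"
definition a :: "nat \<Rightarrow> real" where "a n = s n * A n"
definition g :: "nat \<Rightarrow> real" where "g n = s n * N n"
definition e :: "nat \<Rightarrow> real" where "e n = s n * E n"

definition U :: real where "U = x4 - x3"

lemma U_pos: "0 < U" using pts by (simp add: U_def)

lemma AA_eq: "AA n = edge n + s n * ta n" and NN_eq: "NN n = edge n + s n * tg n"
  and EE_eq: "EE n = edge n + s n * te n"
  using s_cases[of n] by (auto simp: ta_def tg_def te_def)

lemma a_pos: "0 < a n"
  using T_displacement[of n 0] by (simp add: a_def A_eq)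

lemma ta_pos: "0 < ta n"
proof -
  have "s n * S 1 1 (edge n) < s n * S 1 1 (AA n)"
    using a_pos[of n] G_edge[of n] by (simp add: a_def A_def G_def)
  from S_signed_less_cancel[OF this] show ?thesis unfolding ta_def right_diff_distrib by linarith
qed

lemma AA_side: "s n * AA (n + 3) < s n * edge (n + 1)" "s n * edge n < s n * AA (n + 2)"
  using ta_pos[of "n + 3"] ta_pos[of "n + 2"]
  unfolding ta_def s_add_2 s_add_3 edge_add_2 edge_add_3 by (simp_all only: right_diff_distrib)

lemma edge_side: "s n * edge (n + 1) < s n * edge n"
  using edge_diff[of n] pts by (simp add: algebra_simps)

lemma T_signed_less_cancel: "s n * T i x < s n * T i y \<Longrightarrow> s n * x < s n * y"
  and H_signed_less_cancel: "s n * H i x < s n * H i y \<Longrightarrow> s n * x < s n * y"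
  unfolding T_def H_def by (rule S_signed_less_cancel, assumption)+

text \<open>The map \<open>T (n + 1)\<close> carries \<open>AA (n + 2)\<close>, \<open>NN n\<close>,
  \<open>EE n\<close>, \<open>AA n\<close> to \<open>AA (n + 3)\<close>, the two edges and
  \<open>AA (n + 2)\<close>. Their order is known, and a nondecreasing map reflects strict order.
  The ladder near \<open>0\<close> is obtained likewise with \<open>H (n + 1)\<close>.\<close>

lemma ta_tg: "ta (n + 2) < tg n" and tg_te: "tg n < te n" and te_ta: "te n < ta n"
proof -
  have 1: "T (n + 1) (AA (n + 2)) = AA (n + 3)"
    using H_Suc_T[of "n + 1" 0] by (simp add: AA_def T_H eval_nat_numeral)
  have 2: "T (n + 1) (AA n) = AA (n + 2)"
    using H_T_Suc[of n 0] by (simp add: AA_def T_H)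
  have "s n * AA (n + 2) < s n * NN n"
    by (rule T_signed_less_cancel[of n "n + 1"]) (simp only: 1 T_NN AA_side)
  then show "ta (n + 2) < tg n" unfolding ta_def tg_def s_add_2 edge_add_2 right_diff_distrib by linarith
  have "s n * NN n < s n * EE n"
    by (rule T_signed_less_cancel[of n "n + 1"]) (simp only: T_NN T_EE edge_side)
  then show "tg n < te n" unfolding te_def tg_def right_diff_distrib by linarith
  have "s n * EE n < s n * AA n"
    by (rule T_signed_less_cancel[of n "n + 1"]) (simp only: 2 T_EE AA_side)
  then show "te n < ta n" unfolding te_def ta_def right_diff_distrib by linarith
qed

lemma a_g: "a (n + 2) < g n" and g_e: "g n < e n" and e_a: "e n < a n"
proof -
  have 1: "H (n + 1) (A (n + 2)) = AA (n + 3)"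
    using H_A_Suc[of "n + 1"] by (simp add: eval_nat_numeral)
  have 2: "H (n + 1) (A n) = AA (n + 2)"
    using H_Suc_T[of n 0] by (simp add: AA_def A_eq)
  have "s n * A (n + 2) < s n * N n"
    by (rule H_signed_less_cancel[of n "n + 1"]) (simp only: 1 H_N AA_side)
  then show "a (n + 2) < g n" unfolding a_def g_def s_add_2 .
  have "s n * N n < s n * E n"
    by (rule H_signed_less_cancel[of n "n + 1"]) (simp only: H_N H_E edge_side)
  then show "g n < e n" by (simp add: e_def g_def)
  have "s n * E n < s n * A n"
    by (rule H_signed_less_cancel[of n "n + 1"]) (simp only: 2 H_E AA_side)
  then show "e n < a n" by (simp add: e_def a_def)
qed

lemma tg_pos: "0 < tg n" and te_pos: "0 < te n" and g_pos: "0 < g n" and e_pos: "0 < e n"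
  using ta_pos[of "n + 2"] a_pos[of "n + 2"] ta_tg[of n] tg_te[of n] a_g[of n] g_e[of n] by simp_all

lemma a_decr: "a (n + 2) < a n" and ta_decr: "ta (n + 2) < ta n"
  using a_g[of n] g_e[of n] e_a[of n] ta_tg[of n] tg_te[of n] te_ta[of n] by linarith+

section \<open>Break points, and cross-ratios under iteration\<close>

definition in_flat :: "real \<Rightarrow> bool" where
  "in_flat x \<longleftrightarrow> (\<exists>k::int. x3 + of_int k * L \<le> x \<and> x \<le> x4 + of_int k * L)"

definition singular :: "real \<Rightarrow> bool" where
  "singular x \<longleftrightarrow> (\<exists>k::int. x = of_int k * L) \<or> (\<exists>k::int. x = x1 + of_int k * L) \<or> in_flat x"

lemma int_mult_L: "of_int j * L < of_int k * L \<longleftrightarrow> j < k"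
  using L_pos by simp

lemma int_mult_bounds:
  "of_int k * L < L \<Longrightarrow> k < 1" "- L < of_int k * L \<Longrightarrow> - 1 < k" "0 < of_int k * L \<Longrightarrow> 0 < k"
  using int_mult_L[of k 1] int_mult_L[of "- 1" k] int_mult_L[of 0 k] by simp_all

lemma multiple_in_unit: "x1 < x + of_int k * L \<Longrightarrow> x + of_int k * L < x1 + L \<Longrightarrow> x1 < x \<Longrightarrow> x < x1 + L \<Longrightarrow> k = 0"
proof -
  assume *: "x1 < x + of_int k * L" "x + of_int k * L < x1 + L" "x1 < x" "x < x1 + L"
  then have "of_int k * L < L" "- L < of_int k * L" by linarith+
  then have "k < 1" "- 1 < k" by (blast intro: int_mult_bounds)+
  then show "k = 0" by linarith
qed

lemma not_in_flat_0: "\<not> in_flat (of_int k * L)"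
proof
  assume "in_flat (of_int k * L)"
  then obtain j :: int where j: "x3 + of_int j * L \<le> of_int k * L" "of_int k * L \<le> x4 + of_int j * L"
    by (auto simp: in_flat_def)
  have "k - j = 0"
    by (rule multiple_in_unit[of 0]) (use j pts in \<open>auto simp: algebra_simps\<close>)
  with j pts show False by simp
qed

lemma F_eq_multiple_imp_in_flat: "F y = of_int k * L \<Longrightarrow> in_flat y"
proof -
  assume y: "F y = of_int k * L"
  let ?z = "x3 + of_int (k - 1) * L"
  have "F ?z = of_int k * L" using shift_int[of x3 "k - 1"] flat_val[of x3] pts by (simp add: algebra_simps)
  moreover have "in_flat ?z" using pts unfolding in_flat_def by (intro exI[of _ "k - 1"]) auto
  moreover have "in_flat y" if "y \<noteq> ?z" "F y = F ?z"
  proof (cases "y < ?z")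
    case True
    from flat[OF this that(2)] show ?thesis using True unfolding in_flat_def by (meson less_imp_le order_trans)
  next
    case False
    then have "?z < y" using that(1) by simp
    from flat[OF this that(2)[symmetric]] show ?thesis using False unfolding in_flat_def by (meson less_imp_le order_trans not_le)
  qed
  ultimately show "in_flat y" using y by metis
qed

text \<open>Hence an orbit that avoids the translates of \<open>0\<close> at one time avoids those
  of \<open>x1\<close> at the next.\<close>

lemma F_eq_shift_x1: "F y = x1 + of_int k * L \<Longrightarrow> y = of_int (k - 1) * L"
proof (rule ccontr)
  assume y: "F y = x1 + of_int k * L" and ne: "y \<noteq> of_int (k - 1) * L"
  have "F (of_int (k - 1) * L) = x1 + of_int k * L"
    using shift_int[of 0 "k - 1"] F0 by (simp add: algebra_simps)
  then have eq: "F y = F (of_int (k - 1) * L)" using y by simp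
  have "in_flat (of_int (k - 1) * L)"
  proof (cases "y < of_int (k - 1) * L")
    case True
    from flat[OF this eq] show ?thesis using True unfolding in_flat_def by (meson less_imp_le order_trans)
  next
    case False
    then have "of_int (k - 1) * L < y" using ne by simp
    from flat[OF this eq[symmetric]] show ?thesis using False unfolding in_flat_def by (meson less_imp_le order_trans not_le)
  qed
  then show False using not_in_flat_0 by blast
qed

lemma F_strict_if_regular:
  assumes "x < y" "\<And>z. x < z \<Longrightarrow> z < y \<Longrightarrow> \<not> singular z"
  shows "F x < F y"
proof (rule ccontr)
  assume "\<not> F x < F y"
  then have "F x = F y" using mono[of x y] assms(1) by simp
  then obtain k :: int where "x3 + of_int k * L \<le> x" "y \<le> x4 + of_int k * L" using flat assms(1) by blast
  then have "in_flat ((x + y) / 2)" using assms(1) unfolding in_flat_def by (intro exI[of _ k]) auto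
  then show False using assms(2)[of "(x + y) / 2"] assms(1) by (simp add: singular_def)
qed

lemma funpow_between:
  assumes "x < y" "(F ^^ j) x < w" "w < (F ^^ j) y"
  shows "\<exists>z. x < z \<and> z < y \<and> (F ^^ j) z = w"
proof -
  have "\<exists>z\<ge>x. z \<le> y \<and> (F ^^ j) z = w"
    by (rule IVT') (use assms continuous_on_subset[OF funpow_cont] in auto)
  then obtain z where "x \<le> z" "z \<le> y" "(F ^^ j) z = w" by blast
  then show ?thesis using assms by (intro exI[of _ z]) (auto simp: order_le_less)
qed

text \<open>By the intermediate value theorem the iterates of the open interval fill the open image
  interval, so regularity along orbits is what \<open>cross\<close> asks for at each step.\<close>

lemma funpow_cross:
  assumes ord: "p < q" "q < r" "r < t"
    and reg: "\<And>x j. p < x \<Longrightarrow> x < t \<Longrightarrow> j < m \<Longrightarrow> \<not> singular ((F ^^ j) x)"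
  shows "(F ^^ m) p < (F ^^ m) q \<and> (F ^^ m) q < (F ^^ m) r \<and> (F ^^ m) r < (F ^^ m) t \<and>
    cross_ratio p q r t \<le> cross_ratio ((F ^^ m) p) ((F ^^ m) q) ((F ^^ m) r) ((F ^^ m) t)"
  using reg
proof (induction m)
  case (Suc m)
  define f where "f = F ^^ m"
  have IH: "f p < f q" "f q < f r" "f r < f t" "cross_ratio p q r t \<le> cross_ratio (f p) (f q) (f r) (f t)"
    using Suc by (auto simp: f_def)
  have reg': "\<not> singular w" if "f p < w" "w < f t" for w
    using funpow_between[of p t m w] that ord Suc.prems[of _ m] by (auto simp: f_def)
  have "F (f p) < F (f q)" "F (f q) < F (f r)" "F (f r) < F (f t)"
    using IH reg' by (auto intro!: F_strict_if_regular)
  moreover have "cross_ratio (f p) (f q) (f r) (f t) \<le> cross_ratio (F (f p)) (F (f q)) (F (f r)) (F (f t))"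
    using reg' by (intro cross IH) (auto simp: singular_def in_flat_def)
  ultimately show ?case using IH(4) by (simp add: f_def)
qed (use ord in simp)

text \<open>Reversing the four points leaves the cross-ratio unchanged, which reduces the negative
  sign to the positive one.\<close>

lemma S_cross:
  assumes ord: "s n * p < s n * q" "s n * q < s n * r" "s n * r < s n * t"
    and reg: "\<And>x j. s n * p < s n * x \<Longrightarrow> s n * x < s n * t \<Longrightarrow> j < m \<Longrightarrow> \<not> singular ((F ^^ j) x)"
  shows "s n * S m k p < s n * S m k q" "s n * S m k q < s n * S m k r" "s n * S m k r < s n * S m k t"
    "cross_ratio p q r t \<le> cross_ratio (S m k p) (S m k q) (S m k r) (S m k t)"
proof -
  have *: "cross_ratio (S m k p) (S m k q) (S m k r) (S m k t) =
    cross_ratio ((F ^^ m) p) ((F ^^ m) q) ((F ^^ m) r) ((F ^^ m) t)" for p q r t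
    using cross_ratio_affine[of 1 _ "- of_int k * L"] by (simp add: S_def)
  have "s n * S m k p < s n * S m k q \<and> s n * S m k q < s n * S m k r \<and> s n * S m k r < s n * S m k t \<and>
    cross_ratio p q r t \<le> cross_ratio (S m k p) (S m k q) (S m k r) (S m k t)"
    using s_cases[of n]
  proof
    assume "s n = 1 \<and> even n"
    then show ?thesis using funpow_cross[of p q r t m] ord reg unfolding * by (simp add: S_def)
  next
    assume "s n = - 1 \<and> odd n"
    then show ?thesis using funpow_cross[of t r q p m] ord reg
      unfolding * cross_ratio_reverse[of p q r t] cross_ratio_reverse[of "(F ^^ m) p"] by (simp add: S_def cross_ratio_reverse)
  qed
  then show "s n * S m k p < s n * S m k q" "s n * S m k q < s n * S m k r" "s n * S m k r < s n * S m k t"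
    "cross_ratio p q r t \<le> cross_ratio (S m k p) (S m k q) (S m k r) (S m k t)" by auto
qed

text \<open>The interval around \<open>0\<close> on which the iterates below \<open>q\<^sub>m\<^sub>+\<^sub>3 - 1\<close> avoid the flat piece.\<close>

definition J :: "nat \<Rightarrow> real set" where
  "J m = {x. s m * x < g m \<and> s (m + 1) * x < g (m + 1)}"

lemma J_decr: "J (m + 1) \<subseteq> J m"
  using a_g[of m] g_e[of "m + 2"] e_a[of "m + 2"] by (auto simp: J_def s_def)

lemma N_0: "N 0 = x3"
  using H_N[of 0] H_1[of "N 0"] by (simp add: edge_def)

lemma J_0: "x \<in> J 0 \<Longrightarrow> x1 < x \<and> x < x3 \<and> x4 < F x \<and> F x \<le> L"
proof -
  assume x: "x \<in> J 0"
  have x3: "x < x3" using x by (simp add: J_def g_def N_0 s_def)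
  have N1: "N 1 < x" using x by (simp add: J_def g_def s_def)
  have "x1 < N 1" using g_e[of 1] e_a[of 1] F0 by (simp add: g_def a_def s_def A_eq T_1[simplified])
  have FN: "F (N 1) = x4" using H_N[of 1] by (simp add: H_def S_def edge_def eval_nat_numeral)
  have "x4 \<noteq> F x"
  proof
    assume "x4 = F x"
    then have "S 1 0 (N 1) = S 1 0 x" using FN by (simp add: S_def)
    then have "N 1 = x" by (rule S_inj_edge) (use FN pts in \<open>simp_all add: S_def\<close>)
    then show False using N1 by simp
  qed
  moreover have "x4 \<le> F x" using mono[of "N 1" x] N1 FN by simp
  moreover have "F x \<le> L" using mono[of x x3] flat_val[of x3] x3 pts by simp
  ultimately show ?thesis using \<open>x1 < N 1\<close> N1 x3 by simp
qed

lemma J_subset_J_0: "J m \<subseteq> J 0"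
proof (induction m)
  case (Suc m)
  then show ?case using J_decr[of m] by simp
qed simp

text \<open>As \<open>qseq (m + 4) = qseq (m + 3) + qseq (m + 2)\<close>, the times split into those
  below \<open>qseq (m + 2)\<close>, covered by \<open>J m\<close>, and those after the return
  \<open>T (m + 2)\<close>, which maps \<open>J (m + 1)\<close> into \<open>J m\<close>.\<close>

lemma J_not_in_flat: "x \<in> J m \<Longrightarrow> j < qseq (m + 3) - 1 \<Longrightarrow> \<not> in_flat ((F ^^ j) x)"
proof (induction m arbitrary: x j)
  case 0
  note x = J_0[OF 0(1)]
  have "j = 0 \<or> j = 1" using 0(2) by (auto simp: eval_nat_numeral)
  then show ?case
  proof
    assume "j = 0"
    show ?thesis
    proof
      assume "in_flat ((F ^^ j) x)"
      then obtain k :: int where k: "x3 + of_int k * L \<le> x" "x \<le> x4 + of_int k * L"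
        by (auto simp: in_flat_def \<open>j = 0\<close>)
      have "k = 0"
        by (rule multiple_in_unit[of "min (x - of_int k * L) x4"]) (use x k pts in auto)
      then show False using k x by simp
    qed
  next
    assume "j = 1"
    show ?thesis
    proof
      assume "in_flat ((F ^^ j) x)"
      then obtain k :: int where k: "x3 + of_int k * L \<le> F x" "F x \<le> x4 + of_int k * L"
        by (auto simp: in_flat_def \<open>j = 1\<close>)
      have "0 < of_int k * L" "of_int k * L < L" using k x pts by linarith+
      then have "0 < k" "k < 1" by (blast intro: int_mult_bounds)+
      then show False by linarith
    qed
  qed
next
  case (Suc m)
  have x: "x \<in> J m" using Suc.prems(1) J_decr[of m] by auto
  have q: "qseq (m + 2) \<le> qseq (m + 3) - 1" "qseq (m + 4) = qseq (m + 3) + qseq (m + 2)"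
    using qseq_pos[of "m + 1"] by (simp_all add: eval_nat_numeral)
  show ?case
  proof (cases "j < qseq (m + 2)")
    case True
    then show ?thesis using Suc.IH[OF x, of j] q by simp
  next
    case False
    define i where "i = j - qseq (m + 2)"
    have i: "j = i + qseq (m + 2)" "i < qseq (m + 3) - 1"
      using False Suc.prems(2) q by (auto simp: i_def eval_nat_numeral)
    have sx: "s m * x < s m * N (m + 2)" "s (m + 1) * x < g (m + 1)"
      using Suc.prems(1) by (simp_all add: J_def g_def s_def)
    have HN: "H (m + 3) (N (m + 2)) = edge (m + 1)"
      using H_N[of "m + 2"] edge_add_2[of "m + 1"] by (simp add: eval_nat_numeral)
    have "T (m + 2) x \<in> J m"
      unfolding J_def
    proof (intro CollectI conjI)
      show "s m * T (m + 2) x < g m"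
      \<comment> \<open>Otherwise \<open>H (m + 3) x\<close> would have reached
        \<open>edge (m + 1)\<close>, which is the image of \<open>N (m + 2)\<close>. Since
        \<open>x\<close> lies on the near side of \<open>N (m + 2)\<close>, the two images would
        coincide, and then the points as well.\<close>
      proof (rule ccontr)
        assume "\<not> s m * T (m + 2) x < g m"
        then have "s m * N m \<le> s m * T (m + 2) x" by (simp add: g_def)
        then have "s m * H (m + 1) (N m) \<le> s m * H (m + 1) (T (m + 2) x)"
          unfolding H_def by (rule S_signed_mono)
        then have "s m * edge (m + 1) \<le> s m * H (m + 3) x"
          using H_N[of m] H_T_Suc[of "m + 1" x] by (simp add: eval_nat_numeral)
        moreover have "s m * H (m + 3) x \<le> s m * H (m + 3) (N (m + 2))"
          unfolding H_def by (rule S_signed_mono) (use sx in simp)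
        ultimately have "H (m + 3) (N (m + 2)) = H (m + 3) x"
          using HN s_cases[of m] by auto
        then have "N (m + 2) = x" unfolding H_def
          by (rule S_inj_edge) (use HN[unfolded H_def] edge_in[of "m + 1"] in auto)
        then show False using sx by simp
      qed
      have "s (m + 1) * T (m + 2) x < s (m + 1) * x"
        using T_displacement[of "m + 2" x] by (simp add: s_def algebra_simps)
      then show "s (m + 1) * T (m + 2) x < g (m + 1)" using sx by simp
    qed
    from Suc.IH[OF this i(2)] have "\<not> in_flat ((F ^^ i) (T (m + 2) x))" .
    moreover have "(F ^^ i) (T (m + 2) x) = (F ^^ j) x + of_int (- pseq (m + 2)) * L"
    proof -
      have "T (m + 2) x = (F ^^ qseq (m + 2)) x + of_int (- pseq (m + 2)) * L"
        unfolding T_def S_def of_int_minus by linarith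
      then show ?thesis unfolding i(1) funpow_add comp_def by (simp only: funpow_shift)
    qed
    moreover have "in_flat (y + of_int k * L)" if "in_flat y" for y k
    proof -
      obtain k' :: int where "x3 + of_int k' * L \<le> y" "y \<le> x4 + of_int k' * L"
        using \<open>in_flat y\<close> by (auto simp: in_flat_def)
      then show ?thesis unfolding in_flat_def by (intro exI[of _ "k' + k"]) (simp add: algebra_simps)
    qed
    ultimately show ?thesis by metis
  qed
qed

text \<open>The orbit of \<open>0\<close> meets breaks at the times \<open>0\<close> and
  \<open>1\<close>, hence the alternative \<open>2 \<le> j\<close>.\<close>

lemma J_regular:
  assumes x: "x \<in> J m" and j: "j < qseq (m + 3) - 1" and x0: "x \<noteq> 0 \<or> 2 \<le> j"
  shows "\<not> singular ((F ^^ j) x)"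
proof -
  have x': "x1 < x" "x < x1 + L" using J_0[of x] J_subset_J_0[of m] x pts by auto
  have flat: "\<not> in_flat ((F ^^ i) x)" if "i \<le> j" for i using J_not_in_flat[OF x, of i] j that by simp
  have zero: "(F ^^ i) x \<noteq> of_int k * L" if i: "i \<le> j" "x \<noteq> 0 \<or> 1 \<le> i" for i and k :: int
  proof (cases i)
    case 0
    show ?thesis
    proof
      assume *: "(F ^^ i) x = of_int k * L"
      then have "k = 0"
        using multiple_in_unit[of 0 k] x' 0 pts by auto
      then show False using * 0 i by simp
    qed
  next
    case (Suc i')
    then show ?thesis using F_eq_multiple_imp_in_flat[of "(F ^^ i') x" k] flat[of i'] i by auto
  qed
  have "(F ^^ j) x \<noteq> x1 + of_int k * L" for k :: int
  proof (cases j)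
    case 0
    show ?thesis
    proof
      assume *: "(F ^^ j) x = x1 + of_int k * L"
      then have "0 < of_int k * L" "of_int k * L < L" using x' 0 by simp_all
      then have "0 < k" "k < 1" by (blast intro: int_mult_bounds)+
      then show False by linarith
    qed
  next
    case (Suc j')
    then show ?thesis using F_eq_shift_x1[of "(F ^^ j') x" k] zero[of j' "k - 1"] x0 by auto
  qed
  moreover have "(F ^^ j) x \<noteq> of_int k * L" for k :: int using zero[of j k] x0 by auto
  ultimately show ?thesis using flat[of j] by (simp add: singular_def)
qed

section \<open>Cross-ratio inequalities for the closest returns\<close>

lemma A_eq_a: "A n = s n * a n" and N_eq_g: "N n = s n * g n" and E_eq_e: "E n = s n * e n"
  using s_cases[of n] by (auto simp: a_def g_def e_def)

lemma cross_ratio_signed: "cross_ratio (d + s n * p) (d + s n * q) (d + s n * r) (d + s n * t) = cross_ratio p q r t"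
  using cross_ratio_affine[of "s n" p d q r t] s_nonzero[of n] by (simp add: add.commute)

text \<open>The open interval lies strictly on one side of \<open>0\<close>, so every iterate in
  \<open>H (m + 3)\<close> is usable; it stays in \<open>J m\<close> because
  \<open>e (m + 2)\<close> is below \<open>g m\<close>.\<close>

lemma H_cross:
  assumes ord: "0 \<le> p" "p < q" "q < r" "r < t" "t \<le> e (m + 2)"
    and im: "H (m + 3) (s m * p) = edge (m + 3) + s (m + 3) * p'"
      "H (m + 3) (s m * q) = edge (m + 3) + s (m + 3) * q'"
      "H (m + 3) (s m * r) = edge (m + 3) + s (m + 3) * r'"
      "H (m + 3) (s m * t) = edge (m + 3) + s (m + 3) * t'"
  shows "cross_ratio p q r t \<le> cross_ratio p' q' r' t'"
proof -
  have sm: "s m * (s m * x) = x" for x using s_square[of m] by (metis mult.assoc mult_1)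
  have "cross_ratio (s m * p) (s m * q) (s m * r) (s m * t) \<le>
    cross_ratio (H (m + 3) (s m * p)) (H (m + 3) (s m * q)) (H (m + 3) (s m * r)) (H (m + 3) (s m * t))"
    unfolding H_def
  proof (rule S_cross(4)[where n = m])
    fix x j assume x: "s m * (s m * p) < s m * x" "s m * x < s m * (s m * t)" and j: "j < qseq (m + 3) - 1"
    have "0 < s m * x" "s m * x < g m"
      using x ord e_a[of "m + 2"] a_g[of m] by (auto simp: sm)
    moreover from this have "s (m + 1) * x < g (m + 1)" "x \<noteq> 0"
      using g_pos[of "m + 1"] by (auto simp: s_Suc)
    ultimately show "\<not> singular ((F ^^ j) x)"
      by (intro J_regular[OF _ j]) (auto simp: J_def)
  qed (use ord in \<open>simp_all add: sm\<close>)
  then show ?thesis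
    unfolding im cross_ratio_signed using cross_ratio_signed[of 0 m] by simp
qed

text \<open>Moving outwards from \<open>0\<close>, the images approach the flat piece:
  \<open>0\<close> goes to the farthest point \<open>AA (m + 3)\<close>, \<open>g (m + 2)\<close> to
  the facing edge, and \<open>e (m + 2)\<close> across the flat piece to the other edge, with
  coordinate \<open>- U\<close>.\<close>

lemma H_images:
  "H (m + 3) (s m * 0) = edge (m + 3) + s (m + 3) * ta (m + 3)"
  "H (m + 3) (s m * g (m + 4)) = edge (m + 3) + s (m + 3) * te (m + 3)"
  "H (m + 3) (s m * e (m + 4)) = edge (m + 3) + s (m + 3) * tg (m + 3)"
  "H (m + 3) (s m * a (m + 4)) = edge (m + 3) + s (m + 3) * ta (m + 5)"
  "H (m + 3) (s m * g (m + 2)) = edge (m + 3) + s (m + 3) * 0"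
  "H (m + 3) (s m * e (m + 2)) = edge (m + 3) + s (m + 3) * (- U)"
proof -
  have s4: "s (m + 4) = s m" "s (m + 5) = s (m + 3)"
    by (simp_all add: s_def eval_nat_numeral)
  have e4: "edge (m + 5) = edge (m + 3)" "edge (m + 2) = edge (m + 4)"
    by (simp_all add: edge_def)
  have i: "m + 3 + 1 = m + 4" "m + 3 + 2 = m + 5" "m + 2 + 1 = m + 3" by simp_all
  show "H (m + 3) (s m * 0) = edge (m + 3) + s (m + 3) * ta (m + 3)"
    by (simp only: mult_zero_right flip: AA_eq AA_def)
  show "H (m + 3) (s m * g (m + 4)) = edge (m + 3) + s (m + 3) * te (m + 3)"
    using H_N_Suc[of "m + 3"] unfolding i N_eq_g EE_eq s4 .
  show "H (m + 3) (s m * e (m + 4)) = edge (m + 3) + s (m + 3) * tg (m + 3)"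
    using H_E_Suc[of "m + 3"] unfolding i E_eq_e NN_eq s4 .
  show "H (m + 3) (s m * a (m + 4)) = edge (m + 3) + s (m + 3) * ta (m + 5)"
    using H_A_Suc[of "m + 3"] unfolding i A_eq_a AA_eq s4 e4 .
  show "H (m + 3) (s m * g (m + 2)) = edge (m + 3) + s (m + 3) * 0"
    using H_N[of "m + 2"] unfolding i N_eq_g s_add_2 by (simp only: mult_zero_right add_0_right)
  have "edge (m + 2) = edge (m + 3) + s (m + 3) * (- U)"
  proof -
    have "s (m + 3) = - s (m + 2)" by (simp add: s_def eval_nat_numeral)
    then show ?thesis using s_cases[of "m + 2"] edge_diff[of "m + 2"] unfolding i U_def by auto
  qed
  then show "H (m + 3) (s m * e (m + 2)) = edge (m + 3) + s (m + 3) * (- U)"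
    using H_E[of "m + 2"] unfolding i E_eq_e s_add_2 by (simp only:)
qed

lemma order_side:
  "0 < a (m + 4)" "a (m + 4) < g (m + 2)" "g (m + 2) < e (m + 2)"
  "0 < g (m + 4)" "g (m + 4) < e (m + 4)" "e (m + 4) < a (m + 4)"
  using a_g[of "m + 2"] by (simp_all add: a_pos g_pos g_e e_a eval_nat_numeral)

text \<open>The first two quadruples enter the lower estimate of \<open>V\<close>; the last three
  are used through their complements in the upper bound for \<open>w\<close>.\<close>

lemma cross_g_e_a_e: "cross_ratio (g (m + 4)) (e (m + 4)) (a (m + 4)) (e (m + 2)) \<le>
    cross_ratio (te (m + 3)) (tg (m + 3)) (ta (m + 5)) (- U)"
  and cross_0_a_g_e: "cross_ratio 0 (a (m + 4)) (g (m + 2)) (e (m + 2)) \<le>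
    cross_ratio (ta (m + 3)) (ta (m + 5)) 0 (- U)"
  and cross_0_g_e_e: "cross_ratio 0 (g (m + 4)) (e (m + 4)) (e (m + 2)) \<le>
    cross_ratio (ta (m + 3)) (te (m + 3)) (tg (m + 3)) (- U)"
  and cross_e_a_g_e: "cross_ratio (e (m + 4)) (a (m + 4)) (g (m + 2)) (e (m + 2)) \<le>
    cross_ratio (tg (m + 3)) (ta (m + 5)) 0 (- U)"
  and cross_0_g_a_g: "cross_ratio 0 (g (m + 4)) (a (m + 4)) (g (m + 2)) \<le>
    cross_ratio (ta (m + 3)) (te (m + 3)) (ta (m + 5)) 0"
  by (rule H_cross[OF _ _ _ _ _ H_images(2,3,4,6)] H_cross[OF _ _ _ _ _ H_images(1,4,5,6)]
     H_cross[OF _ _ _ _ _ H_images(1,2,3,6)] H_cross[OF _ _ _ _ _ H_images(3,4,5,6)] H_cross[OF _ _ _ _ _ H_images(1,2,4,5)];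
     use order_side[of m] in simp)+

text \<open>Keeps the ladder inside the smooth branch adjacent to the edge, as needed for
  \<open>G_cross\<close>. The extreme cases are \<open>AA 1 = 0\<close> and
  \<open>AA 2 = x1 + L\<close>; later terms are nearer.\<close>

lemma ta_bound: "1 \<le> m \<Longrightarrow> ta m \<le> (if even m then x1 + L - x4 else x3)"
proof -
  have AA1: "AA 1 = 0" and AA2: "AA 2 = x1 + L"
    using F0 by (simp_all add: AA_def H_def S_def eval_nat_numeral)
  show "1 \<le> m \<Longrightarrow> ta m \<le> (if even m then x1 + L - x4 else x3)"
  proof (induction m rule: qseq.induct)
    case (3 m)
    show ?case
    proof (cases "m = 0")
      case True
      then show ?thesis using AA2 by (simp add: ta_def s_def edge_def eval_nat_numeral)
    next
      case False
      then show ?thesis using 3 ta_decr[of m] by auto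
    qed
  qed (use AA1 in \<open>auto simp: ta_def s_def edge_def\<close>)
qed

lemma G_cross:
  assumes "1 \<le> m" and ord: "0 \<le> p" "p < q" "q < r" "r < t" "t \<le> ta m"
  shows "cross_ratio p q r t \<le> cross_ratio (G (edge m + s m * p)) (G (edge m + s m * q))
    (G (edge m + s m * r)) (G (edge m + s m * t))"
proof -
  have sm: "s m * (s m * x) = x" for x using s_square[of m] by (metis mult.assoc mult_1)
  note bound = ta_bound[OF assms(1)]
  have "cross_ratio (edge m + s m * p) (edge m + s m * q) (edge m + s m * r) (edge m + s m * t) \<le>
    cross_ratio (G (edge m + s m * p)) (G (edge m + s m * q)) (G (edge m + s m * r)) (G (edge m + s m * t))"
    unfolding G_def
  proof (rule S_cross(4)[where n = m])
    fix x and j :: nat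
    assume x: "s m * (edge m + s m * p) < s m * x" "s m * x < s m * (edge m + s m * t)" and j: "j < 1"
    have "x4 < x \<and> x < x1 + L \<or> 0 < x \<and> x < x3"
      using s_cases[of m] x ord bound by (auto simp: edge_def)
    moreover have "\<not> singular x" if "x4 < x \<and> x < x1 + L \<or> 0 < x \<and> x < x3"
    proof
      assume "singular x"
      then consider k :: int where "x = of_int k * L" | k :: int where "x = x1 + of_int k * L"
        | k :: int where "x3 + of_int k * L \<le> x" "x \<le> x4 + of_int k * L"
        unfolding singular_def in_flat_def by blast
      then show False
      proof cases
        case 1
        then have "0 < of_int k * L" "of_int k * L < L" using that pts by linarith+
        then have "0 < k" "k < 1" by (blast intro: int_mult_bounds)+
        then show False by linarith
      next
        case 2
        then have "0 < of_int k * L" "of_int k * L < L" using that pts by linarith+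
        then have "0 < k" "k < 1" by (blast intro: int_mult_bounds)+
        then show False by linarith
      next
        case 3
        then have "- L < of_int k * L" "of_int k * L < L" using that pts by linarith+
        then have "- 1 < k" "k < 1" by (blast intro: int_mult_bounds)+
        then have "k = 0" by linarith
        then show False using 3 that pts by auto
      qed
    qed
    ultimately show "\<not> singular ((F ^^ j) x)" using j by simp
  qed (use ord in \<open>simp_all add: sm distrib_left\<close>)
  then show ?thesis unfolding cross_ratio_signed .
qed

lemma G_images:
  "G (edge n + s n * ta n) = s n * a n" "G (edge n + s n * tg n) = s n * g n" "G (edge n + s n * te n) = s n * e n"
  by (simp_all flip: AA_eq NN_eq EE_eq A_eq_a N_eq_g E_eq_e A_def N_def E_def)

lemma G_images_2:
  "G (edge n + s n * ta (n + 2)) = s n * a (n + 2)" "G (edge n + s n * tg (n + 2)) = s n * g (n + 2)"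
  "G (edge n + s n * te (n + 2)) = s n * e (n + 2)"
  using G_images[of "n + 2"] unfolding s_add_2 edge_add_2 .

lemma cross_0_ta_tg_te:
  assumes "1 \<le> n"
  shows "cross_ratio 0 (ta (n + 2)) (tg n) (te n) \<le> cross_ratio 0 (a (n + 2)) (g n) (e n)"
  using G_cross[OF assms, of 0 "ta (n + 2)" "tg n" "te n"] ta_pos[of "n + 2"] ta_tg[of n] tg_te[of n] te_ta[of n]
    G_edge[of n] cross_ratio_signed[of 0 n 0 "a (n + 2)" "g n" "e n"]
  unfolding G_images G_images_2 by simp

lemma cross_te_ta_te_tg:
  assumes "1 \<le> n"
  shows "cross_ratio (te n) (ta (n + 2)) (te (n + 2)) (tg (n + 2)) \<le> cross_ratio (e n) (a (n + 2)) (e (n + 2)) (g (n + 2))"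
proof -
  have "cross_ratio (tg (n + 2)) (te (n + 2)) (ta (n + 2)) (te n) \<le> cross_ratio (g (n + 2)) (e (n + 2)) (a (n + 2)) (e n)"
    using G_cross[OF assms, of "tg (n + 2)" "te (n + 2)" "ta (n + 2)" "te n"]
      tg_pos[of "n + 2"] tg_te[of "n + 2"] te_ta[of "n + 2"] ta_tg[of n] tg_te[of n] te_ta[of n]
      cross_ratio_signed[of 0 n "g (n + 2)" "e (n + 2)" "a (n + 2)" "e n"]
    unfolding G_images G_images_2 by simp
  then show ?thesis by (simp only: cross_ratio_reverse[of "te n"] cross_ratio_reverse[of "e n"])
qed

lemma funpow_strict:
  assumes "x < y" and reg: "\<And>z j. x < z \<Longrightarrow> z < y \<Longrightarrow> j < m \<Longrightarrow> \<not> singular ((F ^^ j) z)"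
  shows "(F ^^ m) x < (F ^^ m) y"
proof -
  have "x < (2 * x + y) / 3" "(2 * x + y) / 3 < (x + 2 * y) / 3" "(x + 2 * y) / 3 < y" using assms(1) by simp_all
  from funpow_cross[OF this, of m] reg show ?thesis by fastforce
qed

text \<open>
  On an interval through \<open>0\<close> the first two iterates of \<open>F\<close> are discarded, since \<open>F\<close> may have
  breaks at \<open>0\<close> and at its image.
\<close>

lemma H_cross_through_0:
  assumes ord: "s n * p < s n * q" "s n * q < s n * r" "s n * r < s n * t"
    and J: "\<And>x. s n * p < s n * x \<Longrightarrow> s n * x < s n * t \<Longrightarrow> x \<in> J m"
  shows "s n * F (F p) < s n * F (F q)" "s n * F (F q) < s n * F (F r)" "s n * F (F r) < s n * F (F t)"
    "s n * H (m + 3) p < s n * H (m + 3) q" "s n * H (m + 3) q < s n * H (m + 3) r" "s n * H (m + 3) r < s n * H (m + 3) t"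
    "cross_ratio (F (F p)) (F (F q)) (F (F r)) (F (F t)) \<le>
     cross_ratio (H (m + 3) p) (H (m + 3) q) (H (m + 3) r) (H (m + 3) t)"
proof -
  have q3: "3 \<le> qseq (m + 3)" using qseq_ge_3[of "m + 3"] by simp
  have F2: "(F ^^ 2) x = F (F x)" for x by (simp add: eval_nat_numeral)
  \<comment> \<open>\<open>0\<close> meets the breaks at the first two times, so an interval that
    contains it is cut there.\<close>
  have strict: "F (F x) < F (F y)"
    if xy: "x < y" and Jxy: "\<And>z. x < z \<Longrightarrow> z < y \<Longrightarrow> z \<in> J m" for x y
  proof -
    have pos: "F (F x) < F (F y)" if "x < y" "\<And>z. x < z \<Longrightarrow> z < y \<Longrightarrow> z \<in> J m \<and> z \<noteq> 0" for x y
      unfolding F2[symmetric]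
      by (rule funpow_strict[OF that(1)], rule J_regular) (use that(2) q3 in auto)
    show ?thesis
    proof (cases "x < 0 \<and> 0 < y")
      case True
      have "F (F x) < F (F 0)" "F (F 0) < F (F y)" using True Jxy by (auto intro!: pos)
      then show ?thesis by simp
    next
      case False
      then show ?thesis using Jxy by (intro pos xy) force
    qed
  qed
  have strict': "s n * F (F x) < s n * F (F y)"
    if xy: "s n * x < s n * y" "s n * p \<le> s n * x" "s n * y \<le> s n * t" for x y
    using s_cases[of n]
  proof
    assume "s n = 1 \<and> even n"
    then show ?thesis using strict[of x y] xy J by auto
  next
    assume "s n = - 1 \<and> odd n"
    then show ?thesis using strict[of y x] xy J by auto
  qed
  show F2ord: "s n * F (F p) < s n * F (F q)" "s n * F (F q) < s n * F (F r)" "s n * F (F r) < s n * F (F t)"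
    using ord by (auto intro!: strict')
  have H_eq: "H (m + 3) x = S (qseq (m + 3) - 3) (pseq (m + 3) - 1) (F (F x))" for x
  proof -
    have "F (F x) = S 2 0 x" by (simp add: S_def F2)
    moreover have "qseq (m + 3) - 3 + 2 = qseq (m + 3) - 1" using q3 by simp
    ultimately show ?thesis by (simp only: H_def S_S add_0_right)
  qed
  have reg: "\<not> singular ((F ^^ j) y)"
    if y: "s n * F (F p) < s n * y" "s n * y < s n * F (F t)" and j: "j < qseq (m + 3) - 3" for y j
  proof -
    have "\<exists>x. s n * p < s n * x \<and> s n * x < s n * t \<and> F (F x) = y"
      using s_cases[of n]
    proof
      assume "s n = 1 \<and> even n"
      then show ?thesis using funpow_between[of p t 2 y] y ord unfolding F2 by auto
    next
      assume "s n = - 1 \<and> odd n"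
      then show ?thesis using funpow_between[of t p 2 y] y ord unfolding F2 by auto
    qed
    then obtain x where x: "x \<in> J m" "F (F x) = y" using J by blast
    have "(F ^^ j) y = (F ^^ (j + 2)) x" using x(2) by (simp add: funpow_swap1)
    then show ?thesis using J_regular[OF x(1), of "j + 2"] j by simp
  qed
  show "s n * H (m + 3) p < s n * H (m + 3) q" "s n * H (m + 3) q < s n * H (m + 3) r"
    "s n * H (m + 3) r < s n * H (m + 3) t"
    "cross_ratio (F (F p)) (F (F q)) (F (F r)) (F (F t)) \<le>
     cross_ratio (H (m + 3) p) (H (m + 3) q) (H (m + 3) r) (H (m + 3) t)"
    unfolding H_eq by (rule S_cross[where n = n, OF F2ord reg]; assumption)+
qed

section \<open>Power laws at the edges and the lower estimate\<close>

definition v1 :: "nat \<Rightarrow> real \<Rightarrow> real" where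
  "v1 n t = s n * (F (edge n + s n * t) - L)"

text \<open>The passage next to the flat piece together with the two iterates that
  \<open>H_cross_through_0\<close> discards.\<close>

definition v3 :: "nat \<Rightarrow> real \<Rightarrow> real" where
  "v3 n t = s n * (F (F (F (edge n + s n * t))) - F (F (F (edge n))))"

lemma v1_images: "v1 n (ta n) = a n" "v1 n (tg n) = g n" "v1 n (te n) = e n"
  using G_images[of n] s_square[of n] unfolding v1_def G_eq by (simp_all flip: mult.assoc)

lemma v3_eq: "v3 n t = s n * (F (F (G (edge n + s n * t))) - F (F 0))"
proof -
  have "F (edge n) = 0 + of_int 1 * L" using G_edge[of n] by (simp add: G_eq)
  then have "F (F (F (edge n))) = F (F 0) + of_int 1 * L" by (simp only: shift_int)
  moreover have "F (edge n + s n * t) = G (edge n + s n * t) + of_int 1 * L" by (simp add: G_eq)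
  then have "F (F (F (edge n + s n * t))) = F (F (G (edge n + s n * t))) + of_int 1 * L" by (simp only: shift_int)
  ultimately show ?thesis unfolding v3_def by (simp add: algebra_simps)
qed

text \<open>The quadruple \<open>E (m + 3)\<close>, \<open>0\<close>, \<open>N (m + 4)\<close>,
  \<open>E (m + 4)\<close> straddles \<open>0\<close>. The ratio on the left is the cross-ratio of
  its second iterates without the factor \<open>(y4 - y1) / (y3 - y1)\<close>, which is at least
  \<open>1\<close>.\<close>

lemma v3_ratio_le: "v3 (m + 4) (tg (m + 4)) / v3 (m + 4) (te (m + 4)) \<le>
    cross_ratio (te (m + 1)) (ta (m + 3)) (te (m + 3)) (tg (m + 3))"
    and v3_pos: "0 < v3 (m + 4) (tg (m + 4))" "v3 (m + 4) (tg (m + 4)) < v3 (m + 4) (te (m + 4))"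
proof -
  have s4: "s (m + 4) = s m" "s (m + 3) = - s m" "s (m + 1) = - s m"
    by (simp_all add: s_def eval_nat_numeral)
  have e4: "edge (m + 1) = edge (m + 3)" by (simp add: edge_def)
  have ss: "s m * (s m * x) = x" for x using s_square[of m] by (metis mult.assoc mult_1)
  have ord: "s m * E (m + 3) < s m * 0" "s m * 0 < s m * N (m + 4)" "s m * N (m + 4) < s m * E (m + 4)"
    using e_pos[of "m + 3"] g_pos[of "m + 4"] g_e[of "m + 4"]
    by (simp_all add: E_eq_e N_eq_g s4 ss)
  have inJ: "x \<in> J m" if "s m * E (m + 3) < s m * x" "s m * x < s m * E (m + 4)" for x
  proof -
    have "s m * x < e (m + 4)" "- e (m + 3) < s m * x" using that by (simp_all add: E_eq_e s4 ss)
    moreover have "e (m + 4) < g m" "e (m + 3) < g (m + 1)"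
      using e_a[of "m + 4"] a_decr[of "m + 2"] a_g[of m] e_a[of "m + 3"] a_g[of "m + 1"]
      by (simp_all add: eval_nat_numeral)
    ultimately show ?thesis by (simp add: J_def s_Suc)
  qed
  note * = H_cross_through_0[of m, OF ord inJ]
  define y1 y2 y3 y4 where y: "y1 = s m * F (F (E (m + 3)))" "y2 = s m * F (F 0)" "y3 = s m * F (F (N (m + 4)))" "y4 = s m * F (F (E (m + 4)))"
  have yo: "y1 < y2" "y2 < y3" "y3 < y4" using *(1-3) by (simp_all add: y)
  have v: "v3 (m + 4) (tg (m + 4)) = y3 - y2" "v3 (m + 4) (te (m + 4)) = y4 - y2"
    unfolding v3_eq G_images by (simp_all add: y N_eq_g E_eq_e right_diff_distrib s4)
  show "0 < v3 (m + 4) (tg (m + 4))" "v3 (m + 4) (tg (m + 4)) < v3 (m + 4) (te (m + 4))"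
    using yo by (simp_all add: v)
  have "(y3 - y2) / (y4 - y2) = (y3 - y2) * 1 / (1 * (y4 - y2))" by simp
  also have "\<dots> \<le> (y3 - y2) * ((y4 - y1) / (y3 - y1)) / (1 * (y4 - y2))"
    using yo by (intro divide_right_mono mult_left_mono) auto
  also have "\<dots> = cross_ratio y1 y2 y3 y4" by (simp add: cross_ratio_def)
  also have "\<dots> = cross_ratio (F (F (E (m + 3)))) (F (F 0)) (F (F (N (m + 4)))) (F (F (E (m + 4))))"
    unfolding y using cross_ratio_signed[of 0 m] by simp
  also have "\<dots> \<le> cross_ratio (H (m + 3) (E (m + 3))) (H (m + 3) 0) (H (m + 3) (N (m + 4))) (H (m + 3) (E (m + 4)))"
    by (rule *(7))
  also have "\<dots> = cross_ratio (EE (m + 1)) (AA (m + 3)) (EE (m + 3)) (NN (m + 3))"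
    using H_E_same[of "m + 1"] H_N_Suc[of "m + 3"] H_E_Suc[of "m + 3"] by (simp add: AA_def eval_nat_numeral)
  also have "\<dots> = cross_ratio (te (m + 1)) (ta (m + 3)) (te (m + 3)) (tg (m + 3))"
    unfolding EE_eq AA_eq NN_eq s4 e4 cross_ratio_signed
    using cross_ratio_affine[of "- s m" _ "edge (m + 3)"] s_nonzero[of m] by (simp add: add.commute)
  finally show "v3 (m + 4) (tg (m + 4)) / v3 (m + 4) (te (m + 4)) \<le>
    cross_ratio (te (m + 1)) (ta (m + 3)) (te (m + 3)) (tg (m + 3))" by (simp add: v)
qed

definition ell :: "nat \<Rightarrow> real" where "ell n = (if even n then l2 else l1)"

definition w :: "nat \<Rightarrow> real" where "w n = ln (te n) - ln (tg n)"
text \<open>Unlike \<open>w\<close>, this telescopes along each parity, which is what the exclusion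
  of wandering intervals exploits.\<close>

definition \<mu> :: "nat \<Rightarrow> real" where "\<mu> n = ln (ta n) - ln (ta (n + 2))"
text \<open>\<open>w n\<close> seen through \<open>v3\<close>; near the edge the power law makes it
  \<open>ell n * w n\<close> up to a controlled error.\<close>

definition V :: "nat \<Rightarrow> real" where "V n = ln (v3 n (te n)) - ln (v3 n (tg n))"

lemma w_pos: "0 < w n" and w_le_mu: "w n \<le> \<mu> n"
proof -
  have "ln (tg n) < ln (te n)" "ln (te n) < ln (ta n)" "ln (ta (n + 2)) < ln (tg n)"
    using tg_pos[of n] te_pos[of n] ta_pos[of n] ta_pos[of "n + 2"] tg_te[of n] te_ta[of n] ta_tg[of n] by auto
  then show "0 < w n" "w n \<le> \<mu> n" by (auto simp: w_def \<mu>_def)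
qed

lemma power_like_v1: "power_like (ell n) (v1 n)"
  using pow_right pow_left s_cases[of n] by (auto simp: v1_def[abs_def] ell_def edge_def)

lemma v1_small: "0 < r \<Longrightarrow> \<exists>d>0. \<forall>t. 0 < t \<and> t < d \<longrightarrow> v1 n t < r"
proof -
  assume r: "0 < r"
  define d where "d = min L (r / (\<bar>Lam\<bar> + 1))"
  have d: "0 < d" using r L_pos by (simp add: d_def)
  have "v1 n t < r" if t: "0 < t" "t < d" for t
  proof -
    have "(\<bar>Lam\<bar> + 1) * t < r" using t by (simp add: d_def pos_less_divide_eq mult.commute)
    moreover have "Lam * t \<le> (\<bar>Lam\<bar> + 1) * t" using t by (intro mult_right_mono) auto
    moreover have "v1 n t \<le> Lam * t"
      using s_cases[of n] lip[of x4 "x4 + t"] lip[of "x3 - t" x3] t flat_val[of x3] flat_val[of x4] pts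
      by (auto simp: v1_def edge_def d_def)
    ultimately show ?thesis by linarith
  qed
  then show ?thesis using d by blast
qed

text \<open>The law of exponent \<open>ell n\<close> for \<open>v1\<close> is composed with the law
  of exponent \<open>1\<close> for two iterates at \<open>0\<close>, taken on the side given by the
  parity.\<close>

lemma power_like_v3: "power_like (ell n) (v3 n)"
proof -
  have ge1: "1 \<le> ell n" using exps by (simp add: ell_def)
  have G: "G (edge n + s n * t) = s n * v1 n t" for t
    using s_square[of n] by (simp add: v1_def G_eq flip: mult.assoc)
  from s_cases[of n] show ?thesis
  proof
    assume "s n = 1 \<and> even n"
    then have "v3 n = (\<lambda>t. F (F (v1 n t)) - F (F 0))" using v3_eq[of n] unfolding G by (auto simp: fun_eq_iff)
    then show ?thesis using power_like_compose[OF pow0_right power_like_v1[of n] ge1 v1_small] by simp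
  next
    assume "s n = - 1 \<and> odd n"
    then have "v3 n = (\<lambda>t. F (F 0) - F (F (- v1 n t)))" using v3_eq[of n] unfolding G by (auto simp: fun_eq_iff)
    then show ?thesis using power_like_compose[OF pow0_left power_like_v1[of n] ge1 v1_small] by simp
  qed
qed

lemma v3_mono: "t \<le> t' \<Longrightarrow> v3 n t \<le> v3 n t'" and v1_mono: "t \<le> t' \<Longrightarrow> v1 n t \<le> v1 n t'"
  using s_cases[of n] by (auto simp: v3_def v1_def intro!: mono)

lemma v3_positive: "0 < t \<Longrightarrow> 0 < v3 n t" and v1_positive: "0 < t \<Longrightarrow> 0 < v1 n t"
proof -
  assume t: "0 < t"
  have "\<exists>d>0. \<forall>t. 0 < t \<and> t < d \<longrightarrow> 0 < v t" if "power_like l v" for l v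
    using that unfolding power_like_def by (metis order_refl)
  then obtain d d' where d: "0 < d" "\<And>t. 0 < t \<Longrightarrow> t < d \<Longrightarrow> 0 < v3 n t"
    and d': "0 < d'" "\<And>t. 0 < t \<Longrightarrow> t < d' \<Longrightarrow> 0 < v1 n t"
    using power_like_v1[of n] power_like_v3[of n] by metis
  have "0 < v3 n (min t (d / 2))" "0 < v1 n (min t (d' / 2))" using d d' t by (auto intro!: d(2) d'(2) simp: min_less_iff_disj)
  then show "0 < v3 n t" "0 < v1 n t" using v3_mono[of "min t (d / 2)" t n] v1_mono[of "min t (d' / 2)" t n] by auto
qed

lemma v_add_2: "v1 (n + 2) = v1 n" "v3 (n + 2) = v3 n"
  unfolding v1_def[abs_def] v3_def[abs_def] s_add_2 edge_add_2 by simp_all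

lemma Lam_nonneg: "0 \<le> Lam"
  using lip[of 0 L] shift[of 0] L_pos by (simp add: zero_le_mult_iff)

lemma lip3:
  assumes "x \<le> y" "y \<le> x + L"
  shows "F (F (F y)) - F (F (F x)) \<le> Lam ^ 3 * (y - x)"
proof -
  have st: "F x \<le> F y" "F y \<le> F x + L" "F y - F x \<le> Lam * (y - x)" if "x \<le> y" "y \<le> x + L" for x y
    using that mono[of x y] mono[of y "x + L"] shift[of x] lip[of x y] by auto
  note 1 = st[OF assms]
  note 2 = st[OF 1(1,2)]
  note 3 = st[OF 2(1,2)]
  have "F (F (F y)) - F (F (F x)) \<le> Lam * (Lam * (Lam * (y - x)))"
    using 1 2 3 Lam_nonneg by (meson order_trans mult_left_mono)
  then show ?thesis by (simp add: power3_eq_cube mult.assoc)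
qed

lemma v3_lip:
  assumes "t \<le> t'" "t' \<le> t + L"
  shows "v3 n t' - v3 n t \<le> Lam ^ 3 * (t' - t)"
  using s_cases[of n]
proof
  assume "s n = 1 \<and> even n"
  then show ?thesis using lip3[of "edge n + t" "edge n + t'"] assms by (simp add: v3_def algebra_simps)
next
  assume "s n = - 1 \<and> odd n"
  then show ?thesis using lip3[of "edge n - t'" "edge n - t"] assms by (simp add: v3_def algebra_simps)
qed

text \<open>One \<open>G\<close> move followed by one \<open>H\<close> move. Up to the factors with
  \<open>U\<close> the bound is \<open>exp (- \<mu> (m + 4))\<close>: the source of the second
  summand in the recursion.\<close>

lemma cross_0_ta_tg_te_le:
  "cross_ratio 0 (ta (m + 5)) (tg (m + 3)) (te (m + 3)) \<le>
   ta (m + 6) * (U + ta (m + 4)) / (ta (m + 4) * (U + ta (m + 6)))"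
proof -
  have i: "m + 1 + 3 = m + 4" "m + 1 + 4 = m + 5" "m + 1 + 5 = m + 6" "m + 1 + 2 = m + 3" "m + 3 + 2 = m + 5" by simp_all
  have "cross_ratio 0 (ta (m + 5)) (tg (m + 3)) (te (m + 3)) \<le> cross_ratio 0 (a (m + 5)) (g (m + 3)) (e (m + 3))"
    using cross_0_ta_tg_te[of "m + 3"] unfolding i by simp
  also have "\<dots> \<le> cross_ratio (ta (m + 4)) (ta (m + 6)) 0 (- U)"
    using cross_0_a_g_e[of "m + 1"] unfolding i .
  also have "\<dots> = ta (m + 6) * (U + ta (m + 4)) / (ta (m + 4) * (U + ta (m + 6)))"
  proof -
    have "(0 - ta (m + 6)) * (- U - ta (m + 4)) = ta (m + 6) * (U + ta (m + 4))"
      "(0 - ta (m + 4)) * (- U - ta (m + 6)) = ta (m + 4) * (U + ta (m + 6))" by (simp_all add: algebra_simps)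
    then show ?thesis by (simp only: cross_ratio_def)
  qed
  finally show ?thesis .
qed

text \<open>
  The key estimate. Up to the distortion of \<open>v3\<close> and to terms vanishing with \<open>ta\<close> it reads
  \<open>ell (m + 5) * w (m + 5) \<ge> w (m + 3) + w (m + 4)\<close>, as \<open>w \<le> \<mu>\<close>.
\<close>

lemma V_lower:
  "w (m + 3) - (ln (te (m + 3) + U) - ln (tg (m + 3) + U)) +
   (\<mu> (m + 4) - (ln (ta (m + 4) + U) - ln (ta (m + 6) + U))) \<le> V (m + 5)"
proof -
  have i: "m + 1 + 3 = m + 4" "m + 1 + 4 = m + 5" "m + 1 + 1 = m + 2" "m + 2 + 2 = m + 4" "m + 4 + 2 = m + 6" by simp_all
  define x y z where xyz: "x = ta (m + 5)" "y = tg (m + 3)" "z = te (m + 3)"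
  have o: "0 < x" "x < y" "y < z" 
    using ta_pos[of "m + 5"] ta_tg[of "m + 3"] tg_te[of "m + 3"] by (simp_all add: xyz eval_nat_numeral)
  define p q where pq: "p = ta (m + 6)" "q = ta (m + 4)"
  have pq0: "0 < p" "0 < q" using ta_pos by (simp_all add: pq)
  note v = v3_pos[of "m + 1", unfolded i]
  have "v3 (m + 5) (tg (m + 5)) / v3 (m + 5) (te (m + 5)) \<le>
    cross_ratio (te (m + 2)) (ta (m + 4)) (te (m + 4)) (tg (m + 4))"
    using v3_ratio_le[of "m + 1"] unfolding i .
  also have "\<dots> \<le> cross_ratio (e (m + 2)) (a (m + 4)) (e (m + 4)) (g (m + 4))"
    using cross_te_ta_te_tg[of "m + 2"] unfolding i by simp
  also have "\<dots> = cross_ratio (g (m + 4)) (e (m + 4)) (a (m + 4)) (e (m + 2))" by (rule cross_ratio_reverse)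
  also have "\<dots> \<le> cross_ratio z y x (- U)" unfolding xyz by (rule cross_g_e_a_e)
  \<comment> \<open>The factor \<open>y / z\<close> is \<open>exp (- w (m + 3))\<close>; the
    remaining cross-ratio starts at the edge and admits a second round of \<open>G\<close> and
    \<open>H\<close>.\<close>
  also have "\<dots> = (y / z) * ((z + U) / (y + U)) * cross_ratio 0 x y z"
  proof -
    have "(x - y) * (- U - z) = (y - x) * (z + U)" "(x - z) * (- U - y) = (z - x) * (y + U)"
      by (simp_all add: algebra_simps)
    then show ?thesis unfolding cross_ratio_def using o U_pos by (simp add: mult.commute)
  qed
  also have "\<dots> \<le> (y / z) * ((z + U) / (y + U)) * (p * (U + q) / (q * (U + p)))"
    using cross_0_ta_tg_te_le[of m] o U_pos unfolding xyz pq by (intro mult_left_mono) auto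
  finally have le: "v3 (m + 5) (tg (m + 5)) / v3 (m + 5) (te (m + 5)) \<le> (y / z) * ((z + U) / (y + U)) * (p * (U + q) / (q * (U + p)))" .
  have "- V (m + 5) = ln (v3 (m + 5) (tg (m + 5)) / v3 (m + 5) (te (m + 5)))"
    using v by (simp add: V_def ln_div)
  also have "\<dots> \<le> ln ((y / z) * ((z + U) / (y + U)) * (p * (U + q) / (q * (U + p))))"
    using le v o pq0 U_pos by (subst ln_le_cancel_iff) (auto intro!: divide_pos_pos mult_pos_pos)
  also have "\<dots> = (ln y - ln z) + (ln (z + U) - ln (y + U)) + ((ln p + ln (U + q)) - (ln q + ln (U + p)))"
    using o pq0 U_pos by (simp add: ln_mult ln_div)
  finally show ?thesis unfolding w_def \<mu>_def i xyz pq by (simp add: add.commute)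
qed

text \<open>All corrections become factors on \<open>w\<close> and \<open>\<mu>\<close>. With no
  additive error the estimate says something even while \<open>w\<close> may be small.\<close>

lemma V_lower':
  "U / (U + ta (m + 3)) * w (m + 3) + U / (U + ta (m + 4)) * \<mu> (m + 4) \<le> V (m + 5)"
proof -
  have i: "m + 4 + 2 = m + 6" by simp
  have U1: "1 - y / (y + U) = U / (U + y)" if "0 < y" for y using that U_pos by (simp add: field_simps)
  have "ln (te (m + 3) + U) - ln (tg (m + 3) + U) \<le> te (m + 3) / (te (m + 3) + U) * w (m + 3)"
    unfolding w_def using tg_pos[of "m + 3"] tg_te[of "m + 3"] U_pos by (intro ln_add_const_diff_le) auto
  then have 1: "U / (U + te (m + 3)) * w (m + 3) \<le> w (m + 3) - (ln (te (m + 3) + U) - ln (tg (m + 3) + U))"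
    unfolding U1[OF te_pos[of "m + 3"], symmetric] left_diff_distrib by linarith
  have "ln (ta (m + 4) + U) - ln (ta (m + 6) + U) \<le> ta (m + 4) / (ta (m + 4) + U) * \<mu> (m + 4)"
    unfolding \<mu>_def i using ta_pos[of "m + 6"] ta_decr[of "m + 4"] U_pos by (intro ln_add_const_diff_le) (auto simp: eval_nat_numeral)
  then have 2: "U / (U + ta (m + 4)) * \<mu> (m + 4) \<le> \<mu> (m + 4) - (ln (ta (m + 4) + U) - ln (ta (m + 6) + U))"
    unfolding U1[OF ta_pos[of "m + 4"], symmetric] left_diff_distrib by linarith
  have "U / (U + ta (m + 3)) * w (m + 3) \<le> U / (U + te (m + 3)) * w (m + 3)"
    using te_ta[of "m + 3"] te_pos[of "m + 3"] w_pos[of "m + 3"] U_pos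
    by (intro mult_right_mono divide_left_mono mult_pos_pos) auto
  then show ?thesis using V_lower[of m] 1 2 by linarith
qed

section \<open>Absence of wandering intervals\<close>

text \<open>A wandering interval at an end of the flat piece would make one of these limits positive.\<close>

definition persists :: "nat \<Rightarrow> bool" where
  "persists n \<longleftrightarrow> (\<exists>c>0. \<forall>k. c \<le> ta (n + 2 * k))"

lemma ta_antimono: "ta (n + 2 * k) \<le> ta n"
proof (induction k)
  case (Suc k)
  then show ?case using ta_decr[of "n + 2 * k"] by simp
qed simp

lemma persists_shift: "persists (n + 2 * j) \<longleftrightarrow> persists n"
proof
  assume "persists (n + 2 * j)"
  then obtain c where c: "0 < c" "\<And>k. c \<le> ta (n + 2 * j + 2 * k)" by (auto simp: persists_def)
  have "c \<le> ta (n + 2 * k)" for k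
    using c(2)[of k] ta_antimono[of "n + 2 * k" j] by (simp add: ac_simps)
  then show "persists n" using c by (auto simp: persists_def)
next
  assume "persists n"
  then obtain c where c: "0 < c" "\<And>k. c \<le> ta (n + 2 * k)" by (auto simp: persists_def)
  have "c \<le> ta (n + 2 * j + 2 * k)" for k
    using c(2)[of "j + k"] by (simp add: algebra_simps)
  then show "persists (n + 2 * j)" using c by (auto simp: persists_def)
qed

lemma v_add_even: "v1 (n + 2 * k) = v1 n" "v3 (n + 2 * k) = v3 n"
  by (induction k) (auto simp: v_add_2[simplified])

text \<open>Away from the edge \<open>v3\<close> is bounded below and Lipschitz, so its logarithmic
  increment is controlled by \<open>te n - tg n\<close>, which is at most
  \<open>te n * w n\<close>.\<close>

lemma V_le_if_bounded_below:
  assumes c: "0 < c" "c \<le> tg n" and n: "1 \<le> n"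
  shows "V n \<le> Lam ^ 3 * L / v3 n c * w n"
proof -
  define z where "z = v3 n c"
  have z: "0 < z" "z \<le> v3 n (tg n)" using c v3_positive[OF c(1)] v3_mono[OF c(2)] by (simp_all add: z_def)
  have taL: "ta n \<le> L" using ta_bound[OF n] pts by (auto split: if_splits)
  have "V n \<le> (v3 n (te n) - v3 n (tg n)) / v3 n (tg n)"
    unfolding V_def using z v3_mono[of "tg n" "te n" n] tg_te[of n] by (intro ln_diff_le_if_less) auto
  also have "\<dots> \<le> (Lam ^ 3 * (te n - tg n)) / z"
  proof (rule frac_le)
    show "v3 n (te n) - v3 n (tg n) \<le> Lam ^ 3 * (te n - tg n)"
      using tg_te[of n] te_ta[of n] tg_pos[of n] taL by (intro v3_lip) auto
  qed (use z tg_te[of n] Lam_nonneg in auto)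
  also have "\<dots> \<le> (Lam ^ 3 * (L * w n)) / z"
  proof (intro divide_right_mono mult_left_mono)
    have "(te n - tg n) / te n \<le> w n" unfolding w_def using tg_pos[of n] tg_te[of n] by (intro ln_diff_ge_if_less) auto
    then have "te n - tg n \<le> te n * w n" using te_pos[of n] by (simp add: pos_divide_le_eq mult.commute)
    also have "\<dots> \<le> L * w n" using te_ta[of n] taL w_pos[of n] by (intro mult_right_mono) auto
    finally show "te n - tg n \<le> L * w n" .
  qed (use z Lam_nonneg in auto)
  finally show ?thesis by (simp add: z_def)
qed

text \<open>Under the hypothesis \<open>V\<close> is at most a multiple of \<open>w\<close>, so
  \<open>V_lower'\<close> gives \<open>\<kappa> * \<mu> (m + 4 + 2 * k) \<le> K * \<mu> (m + 5 + 2 *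
  k)\<close>. Both sides telescope: finite total shrinking for one parity forces it for the
  other.\<close>

lemma persists_previous: "persists (m + 5) \<Longrightarrow> persists (m + 4)"
proof -
  assume "persists (m + 5)"
  then obtain c where c: "0 < c" "\<And>k. c \<le> ta (m + 5 + 2 * k)" by (auto simp: persists_def)
  define K where "K = Lam ^ 3 * L / v3 (m + 5) c"
  define \<kappa> where "\<kappa> = U / (U + ta (m + 4))"
  have K: "0 \<le> K" using Lam_nonneg L_pos v3_positive[OF c(1), of "m + 5"] by (simp add: K_def)
  have \<kappa>: "0 < \<kappa>" using U_pos ta_pos[of "m + 4"] by (simp add: \<kappa>_def)
  have step: "\<kappa> * \<mu> (m + 4 + 2 * k) \<le> K * \<mu> (m + 5 + 2 * k)" for k
  proof -
    have i: "m + 2 * k + 3 = m + 3 + 2 * k" "m + 2 * k + 4 = m + 4 + 2 * k" "m + 2 * k + 5 = m + 5 + 2 * k" by simp_all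
    have mu: "0 < \<mu> (m + 4 + 2 * k)" using w_pos w_le_mu less_le_trans by blast
    have "c \<le> ta (m + 5 + 2 * k + 2)" using c(2)[of "Suc k"] by simp
    then have tg: "c \<le> tg (m + 5 + 2 * k)" using ta_tg[of "m + 5 + 2 * k"] by linarith
    have "\<kappa> * \<mu> (m + 4 + 2 * k) \<le> U / (U + ta (m + 4 + 2 * k)) * \<mu> (m + 4 + 2 * k)"
      unfolding \<kappa>_def using ta_antimono[of "m + 4" k] ta_pos mu U_pos
      by (intro mult_right_mono divide_left_mono mult_pos_pos) (auto intro: add_pos_pos)
    also have "\<dots> \<le> V (m + 5 + 2 * k)"
    proof -
      have "0 \<le> U / (U + ta (m + 3 + 2 * k)) * w (m + 3 + 2 * k)"
        using U_pos ta_pos[of "m + 3 + 2 * k"] w_pos[of "m + 3 + 2 * k"] by simp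
      then show ?thesis using V_lower'[of "m + 2 * k"] unfolding i by linarith
    qed
    also have "\<dots> \<le> K * w (m + 5 + 2 * k)"
      using V_le_if_bounded_below[OF c(1) tg] by (simp add: K_def v_add_even)
    also have "\<dots> \<le> K * \<mu> (m + 5 + 2 * k)" using K w_le_mu by (intro mult_left_mono)
    finally show ?thesis .
  qed
  have sum: "\<kappa> * (ln (ta (m + 4)) - ln (ta (m + 4 + 2 * k))) \<le> K * (ln (ta (m + 5)) - ln (ta (m + 5 + 2 * k)))" for k
  proof (induction k)
    case (Suc k)
    have i: "m + 4 + 2 * Suc k = m + 4 + 2 * k + 2" "m + 5 + 2 * Suc k = m + 5 + 2 * k + 2" by simp_all
    show ?case using Suc step[of k] unfolding \<mu>_def i by (simp only: right_diff_distrib) 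
  qed simp
  define D where "D = K * (ln (ta (m + 5)) - ln c)"
  have "exp (ln (ta (m + 4)) - D / \<kappa>) \<le> ta (m + 4 + 2 * k)" for k
  proof -
    have "K * (ln (ta (m + 5)) - ln (ta (m + 5 + 2 * k))) \<le> D"
      unfolding D_def using c(2)[of k] c(1) K by (intro mult_left_mono) auto
    then have "\<kappa> * (ln (ta (m + 4)) - ln (ta (m + 4 + 2 * k))) \<le> D" using sum[of k] by linarith
    then have "ln (ta (m + 4)) - ln (ta (m + 4 + 2 * k)) \<le> D / \<kappa>" using \<kappa> by (simp add: pos_le_divide_eq mult.commute)
    then have "exp (ln (ta (m + 4)) - D / \<kappa>) \<le> exp (ln (ta (m + 4 + 2 * k)))" by simp
    then show ?thesis using ta_pos by simp
  qed
  then show "persists (m + 4)" unfolding persists_def using exp_gt_zero by blast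
qed

lemma persists_both: "persists n \<Longrightarrow> persists 0 \<and> persists 1"
proof -
  assume n: "persists n"
  have "n + 2 * 3 = n + 1 + 5" "n + 1 + 4 = n + 1 + 2 * 2" by simp_all
  then have n1: "persists (n + 1)" using n persists_shift[of n 3] persists_previous[of "n + 1"] persists_shift[of "n + 1" 2] by metis
  show ?thesis
  proof (cases "even n")
    case True
    then obtain j where "n = 0 + 2 * j" by auto
    then show ?thesis using n n1 persists_shift[of 0 j] persists_shift[of 1 j] by (simp add: add.commute)
  next
    case False
    then obtain j where "n = 1 + 2 * j" by (metis oddE add.commute)
    moreover from this have "n + 1 = 0 + 2 * (j + 1)" by simp
    ultimately show ?thesis using n n1 persists_shift[of 0 "j + 1"] persists_shift[of 1 j] by metis
  qed
qed

lemma s_even: "even n \<Longrightarrow> s n = 1" and s_odd: "odd n \<Longrightarrow> s n = - 1"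
  using s_cases[of n] by auto

lemma edge_even: "even n \<Longrightarrow> edge n = x4"
  by (simp add: edge_def)

text \<open>
  If both limits are positive, with \<open>b\<close> the limit of \<open>a\<close> over odd indices, then the cross-ratios of
  \<open>N (2 * k + 3)\<close>, \<open>- b\<close>, \<open>0\<close>, \<open>N (2 * k + 2)\<close> degenerate. Hence the images \<open>M k\<close> of \<open>(- b, 0)\<close> under
  the closest returns eventually grow, although they are disjoint.
\<close>

lemma not_persists: "\<not> persists n"
proof
  assume "persists n"
  then have "persists 0" "persists 1" using persists_both by auto
  then obtain c c1 where c: "0 < c" "\<And>k. c \<le> ta (2 * k)" and c1: "0 < c1" "\<And>k. c1 \<le> ta (1 + 2 * k)"
    by (auto simp: persists_def)
  have a_ge: "v1 1 c1 \<le> a (1 + 2 * k)" for k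
    using v1_mono[OF c1(2)[of k], of 1] v1_images(1)[of "1 + 2 * k"] unfolding v_add_even by simp
  have z: "0 < v1 1 c1" by (rule v1_positive[OF c1(1)])
  have dec: "decseq (\<lambda>k. a (1 + 2 * k))"
  proof (rule decseq_SucI)
    show "a (1 + 2 * Suc k) \<le> a (1 + 2 * k)" for k using a_decr[of "1 + 2 * k"] by simp
  qed
  obtain b where b: "(\<lambda>k. a (1 + 2 * k)) \<longlonglongrightarrow> b" "\<And>k. b \<le> a (1 + 2 * k)"
    using decseq_convergent[OF dec, of "v1 1 c1"] a_ge by blast
  have bpos: "0 < b" using LIMSEQ_le_const[OF b(1), of "v1 1 c1"] a_ge z by force
  have b_less: "b < g (2 * k + 1)" for k
    using b(2)[of "Suc k"] a_g[of "2 * k + 1"] by simp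
  have g_lim: "(\<lambda>k. g (1 + 2 * k)) \<longlonglongrightarrow> b"
  proof (rule tendsto_sandwich[OF _ _ tendsto_const b(1)])
    have "b \<le> g (1 + 2 * k) \<and> g (1 + 2 * k) \<le> a (1 + 2 * k)" for k
      using b_less[of k] g_e[of "1 + 2 * k"] e_a[of "1 + 2 * k"] by simp
    then show "eventually (\<lambda>k. b \<le> g (1 + 2 * k)) sequentially" "eventually (\<lambda>k. g (1 + 2 * k) \<le> a (1 + 2 * k)) sequentially"
      by simp_all
  qed
  have "decseq (\<lambda>k. ta (2 * k))"
  proof (rule decseq_SucI)
    show "ta (2 * Suc k) \<le> ta (2 * k)" for k using ta_decr[of "2 * k"] by simp
  qed
  then obtain t where t: "(\<lambda>k. ta (2 * k)) \<longlonglongrightarrow> t"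
    using decseq_convergent[of "\<lambda>k. ta (2 * k)" c] c(2) by blast
  \<comment> \<open>\<open>M k\<close> is the length of the image of \<open>(- b, 0)\<close> under
    \<open>H (2 * k + 4)\<close>, \<open>R k\<close> the gap between \<open>AA (2 * k + 4)\<close>
    and \<open>AA (2 * k + 2)\<close>. \<open>\<delta> k\<close> tends to \<open>0\<close> because
    \<open>g (2 * k + 3)\<close> tends to \<open>b\<close>.\<close>
  define M where "M k = ta (2 * k + 4) - (H (2 * k + 4) (- b) - x4)" for k
  define R where "R k = ta (2 * k + 2) - ta (2 * k + 4)" for k
  define \<delta> where "\<delta> k = (F (F (- b)) - F (F (- g (2 * k + 3)))) / (F (F 0) - F (F (- b)))" for k
  \<comment> \<open>\<open>A (2 * k + 5)\<close> is at or beyond \<open>- b\<close> and is carried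
    to \<open>AA (2 * k + 6)\<close>, so the image fits into the next gap.\<close>
  have M_le: "M k \<le> R (Suc k)" for k
  proof -
    have i: "1 + 2 * (k + 2) = 2 * k + 5" by simp
    have "A (2 * k + 5) \<le> - b" using b(2)[of "k + 2"] unfolding i by (simp add: A_eq_a s_odd)
    then have "H (2 * k + 4) (A (2 * k + 5)) \<le> H (2 * k + 4) (- b)" unfolding H_def by (rule S_mono)
    moreover have "H (2 * k + 4) (A (2 * k + 5)) = x4 + ta (2 * k + 6)"
    proof -
      have "2 * k + 4 + 1 = 2 * k + 5" "2 * k + 4 + 2 = 2 * k + 6" by simp_all
      then show ?thesis using H_A_Suc[of "2 * k + 4"] AA_eq[of "2 * k + 6"] by (simp only:) (simp add: edge_even s_even)
    qed
    ultimately show ?thesis by (simp add: M_def R_def eval_nat_numeral)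
  qed
  have main: "0 < M k \<and> F (F (- b)) < F (F 0) \<and> c / ta 0 * (R k / (R k + M k)) \<le> \<delta> k" for k
  proof -
    have i: "2 * k + 1 + 3 = 2 * k + 4" "2 * k + 1 + 1 = 2 * k + 2" "2 * k + 3 + 1 = 2 * k + 4" "2 * k + 2 + 2 = 2 * k + 4" by simp_all
    have N3: "N (2 * k + 3) = - g (2 * k + 3)" "N (2 * k + 2) = g (2 * k + 2)"
      by (simp_all add: N_eq_g s_even s_odd del: add_2_eq_Suc')
    have s0: "s 0 = 1" by (simp add: s_def)
    have g3: "g (2 * k + 3) < g (2 * k + 1)"
      using g_e[of "2 * k + 3"] e_a[of "2 * k + 3"] a_g[of "2 * k + 1"] by (simp add: eval_nat_numeral)
    have ord: "s 0 * N (2 * k + 3) < s 0 * (- b)" "s 0 * (- b) < s 0 * 0" "s 0 * 0 < s 0 * N (2 * k + 2)"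
      using b_less[of "k + 1"] bpos g_pos[of "2 * k + 2"] unfolding N3 s0 by (simp_all add: eval_nat_numeral)
    have J: "x \<in> J (2 * k + 1)" if "s 0 * N (2 * k + 3) < s 0 * x" "s 0 * x < s 0 * N (2 * k + 2)" for x
      using that g3 unfolding N3 s0 J_def i by (simp add: s_def)
    have H4: "H (2 * k + 4) (N (2 * k + 3)) = x4" "H (2 * k + 4) 0 = x4 + ta (2 * k + 4)"
      "H (2 * k + 4) (N (2 * k + 2)) = x4 + ta (2 * k + 2)"
      using H_N[of "2 * k + 3"] H_N_back[of "2 * k + 2"] AA_eq[of "2 * k + 4"] AA_eq[of "2 * k + 2"]
      unfolding i AA_def[symmetric] by (simp_all add: edge_even s_even)
    define y1 y2 y3 y4 where y: "y1 = F (F (N (2 * k + 3)))" "y2 = F (F (- b))" "y3 = F (F 0)" "y4 = F (F (N (2 * k + 2)))"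
    define h where "h = H (2 * k + 4) (- b) - x4"
    note * = H_cross_through_0[of 0 _ _ _ _ "2 * k + 1", OF ord J, unfolded i H4 s0, simplified]
    have yo: "y1 < y2" "y2 < y3" "y3 < y4" using *(1-3) by (simp_all add: y)
    have ho: "0 < h" "h < ta (2 * k + 4)" "ta (2 * k + 4) < ta (2 * k + 2)"
      using *(4-6) by (simp_all add: h_def)
    have "cross_ratio y1 y2 y3 y4 \<le> cross_ratio 0 h (ta (2 * k + 4)) (ta (2 * k + 2))"
      using *(7) cross_ratio_affine[of 1 0 x4 h "ta (2 * k + 4)" "ta (2 * k + 2)"] by (simp add: y h_def add.commute)
    \<comment> \<open>Complements contract, and the one on the right is at most
      \<open>(y2 - y1) / (y3 - y2) = \<delta> k\<close>.\<close>
    then have "1 - cross_ratio 0 h (ta (2 * k + 4)) (ta (2 * k + 2)) \<le> 1 - cross_ratio y1 y2 y3 y4" by simp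
    then have cr: "h * R k / (ta (2 * k + 4) * (R k + M k)) \<le> (y2 - y1) * (y4 - y3) / ((y3 - y1) * (y4 - y2))"
    proof -
      have RM: "R k + M k = ta (2 * k + 2) - h" "R k = ta (2 * k + 2) - ta (2 * k + 4)" by (simp_all add: R_def M_def h_def)
      have "1 - cross_ratio 0 h (ta (2 * k + 4)) (ta (2 * k + 2)) =
          (h - 0) * (ta (2 * k + 2) - ta (2 * k + 4)) / ((ta (2 * k + 4) - 0) * (ta (2 * k + 2) - h))"
        "1 - cross_ratio y1 y2 y3 y4 = (y2 - y1) * (y4 - y3) / ((y3 - y1) * (y4 - y2))"
        by (rule one_minus_cross_ratio; use ho yo in simp)+
      with \<open>1 - _ \<le> 1 - _\<close> show ?thesis unfolding RM(1) unfolding RM(2) by (simp only: diff_0_right)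
    qed
    have Mpos: "0 < M k" using ho by (simp add: M_def h_def)
    have Rpos: "0 < R k" using ho by (simp add: R_def)
    have ch: "c \<le> h"
    proof -
      have "h = ta (2 * k + 4) - M k" by (simp add: M_def h_def)
      moreover have "M k \<le> ta (2 * k + 4) - ta (2 * k + 6)" using M_le[of k] by (simp add: R_def eval_nat_numeral)
      moreover have "c \<le> ta (2 * k + 6)" 
      proof -
        have "2 * (k + 3) = 2 * k + 6" by simp
        then show ?thesis using c(2)[of "k + 3"] by metis
      qed
      ultimately show ?thesis by linarith
    qed
    have ta0: "ta (2 * k + 4) \<le> ta 0" 
    proof -
      have "0 + 2 * (k + 2) = 2 * k + 4" by simp
      then show ?thesis using ta_antimono[of 0 "k + 2"] by metis
    qed
    have "c / ta 0 * (R k / (R k + M k)) \<le> h / ta (2 * k + 4) * (R k / (R k + M k))"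
      using ch c ta0 ho Rpos Mpos by (intro mult_right_mono frac_le) auto
    also have "\<dots> = h * R k / (ta (2 * k + 4) * (R k + M k))" by simp
    also note cr
    also have "(y2 - y1) * (y4 - y3) / ((y3 - y1) * (y4 - y2)) = (y2 - y1) / (y3 - y1) * ((y4 - y3) / (y4 - y2))" by simp
    also have "\<dots> \<le> (y2 - y1) / (y3 - y2) * 1"
      using yo by (intro mult_mono frac_le) auto
    finally show ?thesis using Mpos yo by (simp add: \<delta>_def y N3)
  qed
  have "(\<lambda>k. g (2 * k + 3)) \<longlonglongrightarrow> b"
    using LIMSEQ_Suc[OF g_lim] by (simp add: algebra_simps eval_nat_numeral)
  then have "(\<lambda>k. F (F (- g (2 * k + 3)))) \<longlonglongrightarrow> F (F (- b))"
    using cont by (intro continuous_on_tendsto_compose[OF cont] tendsto_minus) auto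
  from tendsto_divide[OF tendsto_diff[OF tendsto_const this] tendsto_const, of "F (F 0) - F (F (- b))" "F (F (- b))"]
  have "\<delta> \<longlonglongrightarrow> 0" using main[of 0] unfolding \<delta>_def[abs_def] by simp
  then have "eventually (\<lambda>k. \<delta> k < c / ta 0 * (1/2)) sequentially"
    using c ta_pos[of 0] by (intro order_tendstoD(2)) auto
  then obtain k0 where k0: "\<And>k. k0 \<le> k \<Longrightarrow> \<delta> k < c / ta 0 * (1/2)" by (auto simp: eventually_sequentially)
  \<comment> \<open>Small \<open>\<delta> (Suc k)\<close> forces
    \<open>R (Suc k) < M (Suc k)\<close>; together with \<open>M_le\<close> the images grow, while
    the gaps containing them shrink to \<open>0\<close>.\<close>
  have M_mono: "M k \<le> M (Suc k)" if "k0 \<le> k" for k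
  proof -
    have "c / ta 0 * (R (Suc k) / (R (Suc k) + M (Suc k))) < c / ta 0 * (1/2)"
      using main[of "Suc k"] k0[of "Suc k"] that by simp
    then have "R (Suc k) / (R (Suc k) + M (Suc k)) < 1/2"
      using c ta_pos[of 0] by (subst (asm) mult_less_cancel_left_pos) auto
    moreover have "0 < R (Suc k)" using main[of k] M_le[of k] by linarith
    ultimately have "R (Suc k) < M (Suc k)" using main[of "Suc k"] by (simp add: divide_simps)
    then show ?thesis using M_le[of k] by linarith
  qed
  have M_ge: "M k0 \<le> M (k0 + j)" for j
  proof (induction j)
    case (Suc j)
    then show ?case using M_mono[of "k0 + j"] by simp
  qed simp
  have "(\<lambda>k. R (Suc k)) \<longlonglongrightarrow> 0"
  proof -
    have "(\<lambda>k. ta (2 * (k + 2)) - ta (2 * (k + 3))) \<longlonglongrightarrow> t - t"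
      by (intro tendsto_diff LIMSEQ_ignore_initial_segment[OF t])
    then show ?thesis by (simp add: R_def algebra_simps)
  qed
  then have "eventually (\<lambda>k. R (Suc k) < M k0) sequentially"
    using main[of k0] by (intro order_tendstoD(2)) auto
  then obtain k1 where k1: "\<And>k. k1 \<le> k \<Longrightarrow> R (Suc k) < M k0" by (auto simp: eventually_sequentially)
  show False using k1[of "k0 + k1"] M_le[of "k0 + k1"] M_ge[of k1] by simp
qed

lemma ta_tendsto_0: "ta \<longlonglongrightarrow> 0"
proof (rule LIMSEQ_I)
  fix r :: real assume r: "0 < r"
  have *: "\<exists>k. ta (n + 2 * k) < r" for n
    using not_persists[of n] r unfolding persists_def by (meson not_le)
  obtain k0 k1 where k: "ta (0 + 2 * k0) < r" "ta (1 + 2 * k1) < r" using * by blast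
  have "norm (ta n - 0) < r" if n: "2 * k0 + 2 * k1 + 1 \<le> n" for n
  proof -
    have "\<exists>j. n = 0 + 2 * k0 + 2 * j \<or> n = 1 + 2 * k1 + 2 * j" using n by presburger
    then obtain j where "n = 0 + 2 * k0 + 2 * j \<or> n = 1 + 2 * k1 + 2 * j" by blast
    then have "ta n < r" using k ta_antimono[of "0 + 2 * k0" j] ta_antimono[of "1 + 2 * k1" j] by (auto simp del: add_0)
    then show ?thesis using ta_pos[of n] by simp
  qed
  then show "\<exists>no. \<forall>n\<ge>no. norm (ta n - 0) < r" by blast
qed

section \<open>The recursion for the scaling ratios\<close>

lemma v_cases: "v1 n = v1 0 \<and> v3 n = v3 0 \<and> ell n = ell 0 \<or> v1 n = v1 1 \<and> v3 n = v3 1 \<and> ell n = ell 1"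
proof (cases "even n")
  case True
  then obtain j where "n = 0 + 2 * j" by auto
  then show ?thesis using v_add_even[of 0 j] True by (simp add: ell_def)
next
  case False
  then obtain j where "n = 1 + 2 * j" by (metis oddE add.commute)
  then show ?thesis using v_add_even[of 1 j] False by (simp add: ell_def)
qed

text \<open>\<open>v1\<close> and \<open>v3\<close> depend on the parity of the index alone, so one
  \<open>d\<close> and one \<open>K\<close> serve all indices.\<close>

lemma power_law_bounds:
  obtains d K where "0 < d" "0 \<le> K"
    "\<And>n r t. 0 < r \<Longrightarrow> r \<le> t \<Longrightarrow> t < d \<Longrightarrow> \<bar>ln (v1 n t) - ln (v1 n r) - ell n * (ln t - ln r)\<bar> \<le> K * (t - r)"
    "\<And>n r t. 0 < r \<Longrightarrow> r \<le> t \<Longrightarrow> t < d \<Longrightarrow> \<bar>ln (v3 n t) - ln (v3 n r) - ell n * (ln t - ln r)\<bar> \<le> K * (t - r)"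
proof -
  define P where "P v l d K \<longleftrightarrow> (\<forall>r t. 0 < r \<and> r \<le> t \<and> t < d \<longrightarrow> \<bar>ln (v t) - ln (v r) - l * (ln t - ln r)\<bar> \<le> K * (t - r))"
    for v :: "real \<Rightarrow> real" and l d K
  have ex: "\<exists>d>0. \<exists>K\<ge>0. P v l d K" if "power_like l v" for v l
    using that unfolding power_like_def P_def by meson
  have weaken: "P v l d' K'" if "P v l d K" "d' \<le> d" "K \<le> K'" for v l d K d' K'
    unfolding P_def
  proof (intro allI impI)
    fix r t assume rt: "0 < r \<and> r \<le> t \<and> t < d'"
    then have "\<bar>ln (v t) - ln (v r) - l * (ln t - ln r)\<bar> \<le> K * (t - r)"
      using that unfolding P_def by force
    also have "\<dots> \<le> K' * (t - r)" using rt that by (intro mult_right_mono) auto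
    finally show "\<bar>ln (v t) - ln (v r) - l * (ln t - ln r)\<bar> \<le> K' * (t - r)" .
  qed
  have ex2: "\<exists>d>0. \<exists>K\<ge>0. P v l d K \<and> P v' l' d K" if vv: "power_like l v" "power_like l' v'" for v l v' l'
  proof -
    obtain d K d' K' where "0 < d" "0 \<le> K" "P v l d K" "0 < d'" "0 \<le> K'" "P v' l' d' K'"
      using ex[OF vv(1)] ex[OF vv(2)] by blast
    then show ?thesis
      by (intro exI[of _ "min d d'"] exI[of _ "max K K'"] conjI) (auto elim!: weaken)
  qed
  obtain d K d' K' where *: "0 < d" "0 \<le> K" "P (v1 0) (ell 0) d K" "P (v1 1) (ell 1) d K"
    "0 < d'" "0 \<le> K'" "P (v3 0) (ell 0) d' K'" "P (v3 1) (ell 1) d' K'"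
    using ex2[OF power_like_v1 power_like_v1, of 0 1] ex2[OF power_like_v3 power_like_v3, of 0 1] by blast
  define D M where DM: "D = min d d'" "M = max K K'"
  have "P (v1 0) (ell 0) D M" "P (v1 1) (ell 1) D M" "P (v3 0) (ell 0) D M" "P (v3 1) (ell 1) D M"
    using * by (auto simp: DM elim!: weaken)
  then have "P (v1 n) (ell n) D M" "P (v3 n) (ell n) D M" for n using v_cases[of n] by auto
  moreover have "0 < D" "0 \<le> M" using * by (auto simp: DM)
  ultimately show thesis using that[of D M] unfolding P_def by blast
qed

lemma eventually_ta_less: "0 < r \<Longrightarrow> \<exists>n0. \<forall>n\<ge>n0. ta n < r"
  using order_tendstoD(2)[OF ta_tendsto_0, of r] by (simp add: eventually_sequentially)

lemma te_tg_le: "te n - tg n \<le> te n * w n"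
proof -
  have "(te n - tg n) / te n \<le> w n" unfolding w_def using tg_pos[of n] tg_te[of n] by (intro ln_diff_ge_if_less) auto
  then show ?thesis using te_pos[of n] by (simp add: pos_divide_le_eq mult.commute)
qed

lemma ell_bounds: "1 < ell n" "ell n < 2" using exps by (auto simp: ell_def)

lemma w_tendsto_infinity: "filterlim w at_top sequentially"
proof -
  define lm where "lm = max l1 l2"
  have lm: "1 < lm" "lm < 2" "ell n \<le> lm" for n using exps by (auto simp: lm_def ell_def)
  \<comment> \<open>Gives \<open>3 * \<epsilon> < 2 - lm\<close>, which is equivalent to
    \<open>1 < nu\<close>.\<close>
  define \<epsilon> where "\<epsilon> = (2 - lm) / 4"
  have eps: "0 < \<epsilon>" "\<epsilon> < 1" using lm by (auto simp: \<epsilon>_def)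
  define nu where "nu = 2 * (1 - \<epsilon>) / (lm + \<epsilon>)"
  have nu: "1 < nu" "nu / 2 = (1 - \<epsilon>) / (lm + \<epsilon>)" using lm by (auto simp: nu_def \<epsilon>_def field_simps)
  obtain d K where dK: "0 < d" "0 \<le> K"
    and v3: "\<And>n r t. 0 < r \<Longrightarrow> r \<le> t \<Longrightarrow> t < d \<Longrightarrow> \<bar>ln (v3 n t) - ln (v3 n r) - ell n * (ln t - ln r)\<bar> \<le> K * (t - r)"
    by (rule power_law_bounds, (rule that; assumption))
  obtain n0 where n0: "\<And>n. n0 \<le> n \<Longrightarrow> ta n < min d (min (\<epsilon> / (K + 1)) (\<epsilon> * U))"
    using eventually_ta_less[of "min d (min (\<epsilon> / (K + 1)) (\<epsilon> * U))"] dK eps U_pos by auto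
  \<comment> \<open>By \<open>te_tg_le\<close> the distortion error is a small multiple of
    \<open>w\<close> itself, so no additive constant enters before growth is known.\<close>
  have V_upper: "V n \<le> (lm + \<epsilon>) * w n" if "n0 \<le> n" for n
  proof -
    have ta: "ta n < d" "ta n * (K + 1) \<le> \<epsilon>" using n0[OF that] dK by (auto simp: pos_less_divide_eq)
    have "K * te n \<le> (K + 1) * ta n" using te_ta[of n] te_pos[of n] dK by (intro mult_mono) auto
    then have Kte: "K * te n \<le> \<epsilon>" using ta by (simp add: mult.commute)
    have "V n \<le> ell n * w n + K * (te n - tg n)"
      using v3[of "tg n" "te n" n] tg_pos[of n] tg_te[of n] te_ta[of n] ta unfolding V_def w_def by linarith
    also have "\<dots> \<le> lm * w n + K * (te n * w n)"
      using lm(3)[of n] w_pos[of n] dK te_tg_le[of n] by (intro add_mono mult_right_mono mult_left_mono) auto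
    also have "K * (te n * w n) \<le> \<epsilon> * w n" using Kte w_pos[of n] by (simp add: mult_right_mono flip: mult.assoc)
    finally show ?thesis by (simp add: algebra_simps)
  qed
  have U_ge: "1 - \<epsilon> \<le> U / (U + ta n)" if "n0 \<le> n" for n
  proof -
    have "ta n < \<epsilon> * U" using n0[OF that] by simp
    then have "(1 - \<epsilon>) * (U + ta n) \<le> (1 - \<epsilon>) * (U + \<epsilon> * U)" using eps by (intro mult_left_mono) auto
    also have "\<dots> = U - \<epsilon> * \<epsilon> * U" by (simp add: algebra_simps)
    also have "\<dots> \<le> U" using U_pos eps by simp
    finally show ?thesis using U_pos ta_pos[of n] by (simp add: pos_le_divide_eq)
  qed
  show ?thesis
  proof (rule tendsto_at_top_if_two_step_growth[OF w_pos nu(1)])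
    fix n assume n: "n0 + 3 \<le> n"
    then obtain m where m: "n = m + 3" "n0 \<le> m" by (metis add_leD2 le_Suc_ex add.commute add_le_cancel_left)
    have i: "m + 3 + 1 = m + 4" "m + 3 + 2 = m + 5" by simp_all
    have "(1 - \<epsilon>) * (w (m + 3) + w (m + 4)) \<le> U / (U + ta (m + 3)) * w (m + 3) + U / (U + ta (m + 4)) * \<mu> (m + 4)"
    proof -
      have "(1 - \<epsilon>) * w (m + 3) \<le> U / (U + ta (m + 3)) * w (m + 3)"
        using U_ge[of "m + 3"] m w_pos[of "m + 3"] by (intro mult_right_mono) auto
      moreover have "(1 - \<epsilon>) * w (m + 4) \<le> U / (U + ta (m + 4)) * \<mu> (m + 4)"
        using U_ge[of "m + 4"] m w_pos[of "m + 4"] w_le_mu[of "m + 4"] U_pos ta_pos[of "m + 4"]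
        by (intro mult_mono) auto
      ultimately show ?thesis by (simp add: distrib_left)
    qed
    also have "\<dots> \<le> V (m + 5)" by (rule V_lower')
    also have "\<dots> \<le> (lm + \<epsilon>) * w (m + 5)" using V_upper[of "m + 5"] m by simp
    finally show "nu / 2 * (w n + w (n + 1)) \<le> w (n + 2)"
      unfolding m(1) i nu(2) using lm(1) eps by (simp add: pos_divide_le_eq mult.commute)
  qed
qed

lemma one_minus_cross_ratio_mono:
  assumes "p \<noteq> r" "q \<noteq> t" "p' \<noteq> r'" "q' \<noteq> t'" "cross_ratio p q r t \<le> cross_ratio p' q' r' t'"
  shows "((q' - p') * (t' - r')) / ((r' - p') * (t' - q')) \<le> ((q - p) * (t - r)) / ((r - p) * (t - q))"
  using assms by (simp flip: one_minus_cross_ratio)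

text \<open>
  The upper bound on \<open>w (n + 2)\<close> comes from the complements \<open>1 - cross_ratio\<close>, which contract: they
  bound \<open>\<rho>\<close> below by the relative gaps \<open>1 - z\<close>, \<open>1 - y\<close>, \<open>1 - Y\<close>, and these by \<open>\<alpha>\<close>.
\<close>

lemma w_recursion:
  "\<exists>C n0. \<forall>n\<ge>n0. \<bar>w (n + 2) - (if even n then 1 / l2 else 1 / l1) * (w (n + 1) + w n)\<bar> \<le> C"
proof -
  obtain d K where dK: "0 < d" "0 \<le> K"
    and v1: "\<And>n r t. 0 < r \<Longrightarrow> r \<le> t \<Longrightarrow> t < d \<Longrightarrow> \<bar>ln (v1 n t) - ln (v1 n r) - ell n * (ln t - ln r)\<bar> \<le> K * (t - r)"
    and v3: "\<And>n r t. 0 < r \<Longrightarrow> r \<le> t \<Longrightarrow> t < d \<Longrightarrow> \<bar>ln (v3 n t) - ln (v3 n r) - ell n * (ln t - ln r)\<bar> \<le> K * (t - r)"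
    by (rule power_law_bounds, (rule that; assumption))
  \<comment> \<open>Beyond \<open>n1\<close> the power laws apply, each with error at most
    \<open>1\<close>, and quotients such as \<open>(t + U) / (t' + U)\<close> lie between
    \<open>1 / 2\<close> and \<open>2\<close>.\<close>
  obtain n1 where n1: "\<And>n. n1 \<le> n \<Longrightarrow> ta n < min d (min (1 / (K + 1)) U)"
    using eventually_ta_less[of "min d (min (1 / (K + 1)) U)"] dK U_pos by auto
  \<comment> \<open>With \<open>ln x \<le> x - 1\<close>, the value \<open>4\<close> yields
    \<open>\<alpha> \<le> 1 / 5\<close> and \<open>\<rho> \<le> 1 / 4\<close>.\<close>
  obtain n2 where n2: "\<And>n. n2 \<le> n \<Longrightarrow> 4 \<le> w n"
    using w_tendsto_infinity by (auto simp: filterlim_at_top eventually_sequentially)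
  define n0 where "n0 = max n1 n2"
  define \<alpha> where "\<alpha> n = tg n / te n" for n
  define \<rho> where "\<rho> n = g n / e n" for n
  define z where "z n = te n / ta n" for n
  define y where "y n = ta (n + 2) / tg n" for n
  define Y where "Y n = a (n + 2) / g n" for n
  have pos: "0 < \<alpha> n" "0 < \<rho> n" "0 < z n" "0 < y n" "0 < Y n"
    and less1: "\<alpha> n < 1" "\<rho> n < 1" "z n < 1" "y n < 1" "Y n < 1" for n
    using ta_pos[of n] ta_pos[of "n + 2"] ta_tg[of n] tg_te[of n] te_ta[of n] a_pos[of "n + 2"] a_g[of n] g_e[of n] e_a[of n]
    by (auto simp: \<alpha>_def \<rho>_def z_def y_def Y_def)
  have ta: "ta n < d" "K * ta n \<le> 1" "ta n \<le> U" if "n0 \<le> n" for n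
  proof -
    have "ta n < 1 / (K + 1)" "ta n < d" "ta n < U" using n1[of n] that by (auto simp: n0_def)
    then have "ta n * (K + 1) < 1" using dK by (simp add: pos_less_divide_eq)
    then have "K * ta n + ta n < 1" by (simp add: algebra_simps)
    then show "ta n < d" "K * ta n \<le> 1" "ta n \<le> U" using \<open>ta n < d\<close> \<open>ta n < U\<close> ta_pos[of n] by auto
  qed
  have ln_\<alpha>: "ln (\<alpha> n) = - w n" for n using tg_pos[of n] te_pos[of n] by (simp add: \<alpha>_def w_def ln_div)
  have Kdiff: "K * (t - r) \<le> ln t - ln r" "K * (t - r) \<le> 1" if "n0 \<le> n" "0 < r" "r \<le> t" "t \<le> ta n" for n r t
  proof -
    have Kt: "K * t \<le> 1" using ta(2)[OF that(1)] that dK by (meson mult_left_mono order_trans)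
    then show "K * (t - r) \<le> 1" using that dK by (smt (verit) mult_left_mono)
    have "K * (t - r) = K * t * ((t - r) / t)" using that by simp
    also have "\<dots> \<le> 1 * ((t - r) / t)" using Kt that by (intro mult_right_mono) auto
    also have "\<dots> \<le> ln t - ln r" using ln_diff_ge_if_less[of r t] that by simp
    finally show "K * (t - r) \<le> ln t - ln r" .
  qed
  \<comment> \<open>An exponent below \<open>2\<close>, plus a distortion of at most one more
    \<open>ln t - ln r\<close>, bounds the ratio of values below by
    \<open>(r / t) ^ 3\<close>.\<close>
  have elastic: "1 - v1 n r / v1 n t \<le> 3 * (1 - r / t)" if "n0 \<le> n" "0 < r" "r \<le> t" "t \<le> ta n" for n r t
  proof -
    have "ln (v1 n t) - ln (v1 n r) \<le> ell n * (ln t - ln r) + K * (t - r)"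
      using v1[of r t n] that ta(1)[OF that(1)] by linarith
    also have "\<dots> \<le> 2 * (ln t - ln r) + (ln t - ln r)"
      using ell_bounds[of n] Kdiff(1)[OF that] that by (intro add_mono mult_right_mono) auto
    finally have "3 * ln (r / t) \<le> ln (v1 n r / v1 n t)"
      using that v1_positive[of r n] v1_positive[of t n] by (simp add: ln_div)
    then have "ln ((r / t) ^ 3) \<le> ln (v1 n r / v1 n t)" using that by (simp add: ln_realpow)
    then have "(r / t) ^ 3 \<le> v1 n r / v1 n t" using that v1_positive[of r n] v1_positive[of t n]
      by (subst (asm) ln_le_cancel_iff) auto
    moreover have "1 - x ^ 3 \<le> 3 * (1 - x)" if "0 \<le> x" "x \<le> 1" for x :: real
    proof -
      have "1 - x ^ 3 = (1 - x) * (1 + x + x * x)" by (simp add: algebra_simps power3_eq_cube)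
      also have "\<dots> \<le> (1 - x) * 3" using that mult_mono[of x 1 x 1] by (intro mult_left_mono) auto
      finally show ?thesis by simp
    qed
    from this[of "r / t"] have "1 - (r / t) ^ 3 \<le> 3 * (1 - r / t)" using that by auto
    ultimately show ?thesis by linarith
  qed
  have \<alpha>_small: "\<alpha> n \<le> 1 / 5" if "n0 \<le> n" for n
  proof -
    have "ln (5::real) \<le> 4" using ln_le_minus_one[of 5] by simp
    also have "\<dots> \<le> w n" using n2[of n] that by (simp add: n0_def)
    finally have "ln (\<alpha> n) \<le> ln (1 / 5)" by (simp add: ln_\<alpha> ln_div)
    then show ?thesis using pos(1)[of n] by simp
  qed
  have \<rho>_ln: "ln (\<rho> n) \<le> - ell n * w n + 1" if "n0 \<le> n" for n
  proof -
    have "ln (e n) - ln (g n) \<ge> ell n * w n - K * (te n - tg n)"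
      using v1[of "tg n" "te n" n] tg_pos[of n] tg_te[of n] te_ta[of n] ta(1)[OF that]
      unfolding v1_images w_def by linarith
    then show ?thesis using Kdiff(2)[OF that tg_pos[of n]] tg_te[of n] te_ta[of n] g_pos[of n] e_pos[of n]
      by (simp add: \<rho>_def ln_div) (smt (verit))
  qed
  have \<rho>_small: "\<rho> n \<le> 1 / 4" if "n0 \<le> n" for n
  proof -
    have "ln (4::real) \<le> 3" using ln_le_minus_one[of 4] by simp
    moreover have "4 \<le> ell n * w n" using mult_mono[of 1 "ell n" 4 "w n"] ell_bounds[of n] n2[of n] that by (simp add: n0_def)
    ultimately have "ln (\<rho> n) \<le> ln (1 / 4)" using \<rho>_ln[OF that] by (simp add: ln_div)
    then show ?thesis using pos(2)[of n] by simp
  qed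
  have half: "1 / 2 \<le> U / (t + U)" "1 / 2 \<le> (t + U) / (t' + U)" if "0 \<le> t" "t \<le> U" "0 \<le> t'" "t' \<le> U" for t t'
    using that U_pos by (auto simp: field_simps)
  \<comment> \<open>Complement of \<open>cross_0_g_e_e\<close>: the relative gap between
    \<open>EE\<close> and \<open>AA\<close> is at most twice the next \<open>\<rho>\<close>.\<close>
  have z_\<rho>: "(1 - z (m + 3)) / 2 \<le> \<rho> (m + 4)" if m: "n0 \<le> m" for m
  proof -
    note o = order_side[of m] tg_pos[of "m + 3"] tg_te[of "m + 3"] te_ta[of "m + 3"]
    have t3: "ta (m + 3) \<le> U" by (rule ta(3)) (use m in simp)
    from one_minus_cross_ratio_mono[OF _ _ _ _ cross_0_g_e_e[of m]]
    have "((te (m + 3) - ta (m + 3)) * (- U - tg (m + 3))) / ((tg (m + 3) - ta (m + 3)) * (- U - te (m + 3)))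
      \<le> ((g (m + 4) - 0) * (e (m + 2) - e (m + 4))) / ((e (m + 4) - 0) * (e (m + 2) - g (m + 4)))"
      using o U_pos by fastforce
    also have "\<dots> = \<rho> (m + 4) * ((e (m + 2) - e (m + 4)) / (e (m + 2) - g (m + 4)))" by (simp add: \<rho>_def)
    also have "\<dots> \<le> \<rho> (m + 4) * 1" using o pos(2)[of "m + 4"] by (intro mult_left_mono) auto
    also have "((te (m + 3) - ta (m + 3)) * (- U - tg (m + 3))) / ((tg (m + 3) - ta (m + 3)) * (- U - te (m + 3)))
      = ((ta (m + 3) - te (m + 3)) / (ta (m + 3) - tg (m + 3))) * ((tg (m + 3) + U) / (te (m + 3) + U))"
    proof -
      have "(te (m + 3) - ta (m + 3)) * (- U - tg (m + 3)) = (ta (m + 3) - te (m + 3)) * (tg (m + 3) + U)"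
        "(tg (m + 3) - ta (m + 3)) * (- U - te (m + 3)) = (ta (m + 3) - tg (m + 3)) * (te (m + 3) + U)"
        by (simp_all add: algebra_simps)
      then show ?thesis by simp
    qed
    finally have 1: "((ta (m + 3) - te (m + 3)) / (ta (m + 3) - tg (m + 3))) * ((tg (m + 3) + U) / (te (m + 3) + U)) \<le> \<rho> (m + 4)" by simp
    have "(1 - z (m + 3)) * (1 / 2) = ((ta (m + 3) - te (m + 3)) / ta (m + 3)) * (1 / 2)"
      using ta_pos[of "m + 3"] by (simp add: z_def diff_divide_distrib)
    also have "\<dots> \<le> ((ta (m + 3) - te (m + 3)) / (ta (m + 3) - tg (m + 3))) * ((tg (m + 3) + U) / (te (m + 3) + U))"
      using o t3 by (intro mult_mono half frac_le) auto
    finally show ?thesis using 1 by linarith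
  qed
  have z_half: "1 / 2 \<le> z (m + 3)" if "n0 \<le> m" for m
    using z_\<rho>[OF that] \<rho>_small[of "m + 4"] that by simp
  \<comment> \<open>Here the expanding form is used: the relative gap \<open>1 - y\<close> is at
    most twice the next \<open>\<alpha>\<close>.\<close>
  have y_half: "1 / 2 \<le> y (m + 3)" if m: "n0 \<le> m" for m
  proof -
    have i: "m + 3 + 2 = m + 5" "m + 4 + 2 = m + 6" by simp_all
    note o = ta_pos[of "m + 5"] ta_tg[of "m + 3", unfolded i] tg_te[of "m + 3"]
    note o4 = ta_pos[of "m + 6"] ta_tg[of "m + 4", unfolded i] tg_te[of "m + 4"] te_ta[of "m + 4"]
    have "1 - y (m + 3) = (tg (m + 3) - ta (m + 5)) / tg (m + 3) * 1" using o unfolding y_def i by (simp add: diff_divide_distrib)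
    also have "\<dots> \<le> (tg (m + 3) - ta (m + 5)) / tg (m + 3) * (te (m + 3) / (te (m + 3) - ta (m + 5)))"
      using o by (intro mult_left_mono) auto
    also have "\<dots> = cross_ratio 0 (ta (m + 5)) (tg (m + 3)) (te (m + 3))" by (simp add: cross_ratio_def)
    also have "\<dots> \<le> ta (m + 6) * (U + ta (m + 4)) / (ta (m + 4) * (U + ta (m + 6)))" by (rule cross_0_ta_tg_te_le)
    also have "\<dots> = (ta (m + 6) / ta (m + 4)) * ((U + ta (m + 4)) / (U + ta (m + 6)))" by simp
    also have "\<dots> \<le> \<alpha> (m + 4) * 2"
    proof (rule mult_mono)
      show "ta (m + 6) / ta (m + 4) \<le> \<alpha> (m + 4)" unfolding \<alpha>_def using o4 by (intro frac_le) auto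
      show "(U + ta (m + 4)) / (U + ta (m + 6)) \<le> 2"
        using ta(3)[of "m + 4"] m o4 U_pos by (auto simp: pos_divide_le_eq)
    qed (use o4 U_pos pos(1)[of "m + 4"] in auto)
    also have "\<dots> \<le> 1 / 2" using \<alpha>_small[of "m + 4"] m by simp
    finally show ?thesis by simp
  qed
  \<comment> \<open>A converse to \<open>z_\<rho>\<close>. The factor \<open>exp 2\<close> pays for
    replacing \<open>v1\<close> by \<open>v3\<close>, one unit of distortion each; \<open>4\<close>
    bounds the distance quotients in the cross-ratio.\<close>
  have \<rho>_z: "\<rho> (m + 4) \<le> exp 2 * 4 * (1 - z (m + 3))" if m: "n0 \<le> m" for m
  proof -
    have i: "m + 1 + 2 = m + 3" by simp
    note o = tg_pos[of "m + 3"] tg_te[of "m + 3"] te_ta[of "m + 3"] ta_tg[of "m + 1", unfolded i] tg_te[of "m + 1"]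
    have o4: "0 < tg (m + 4)" "tg (m + 4) \<le> te (m + 4)" "te (m + 4) \<le> ta (m + 4)" "te (m + 4) < d" "n0 \<le> m + 4"
      using tg_pos[of "m + 4"] tg_te[of "m + 4"] te_ta[of "m + 4"] ta(1)[of "m + 4"] m by auto
    have "ln (\<rho> (m + 4)) = - (ln (v1 (m + 4) (te (m + 4))) - ln (v1 (m + 4) (tg (m + 4))))"
      using g_pos[of "m + 4"] e_pos[of "m + 4"] unfolding v1_images \<rho>_def by (simp add: ln_div)
    also have "\<dots> \<le> - (ln (v3 (m + 4) (te (m + 4))) - ln (v3 (m + 4) (tg (m + 4)))) + 2"
      using v1[of "tg (m + 4)" "te (m + 4)" "m + 4"] v3[of "tg (m + 4)" "te (m + 4)" "m + 4"] o4
        Kdiff(2)[OF o4(5,1,2,3)] by linarith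
    also have "\<dots> = ln (exp 2 * (v3 (m + 4) (tg (m + 4)) / v3 (m + 4) (te (m + 4))))"
      using v3_pos[of m] by (simp add: ln_mult ln_div)
    finally have "\<rho> (m + 4) \<le> exp 2 * (v3 (m + 4) (tg (m + 4)) / v3 (m + 4) (te (m + 4)))"
      using v3_pos[of m] pos(2)[of "m + 4"] by (subst (asm) ln_le_cancel_iff) auto
    also have "\<dots> \<le> exp 2 * cross_ratio (te (m + 1)) (ta (m + 3)) (te (m + 3)) (tg (m + 3))"
      using v3_ratio_le[of m] by (intro mult_left_mono) auto
    also have "cross_ratio (te (m + 1)) (ta (m + 3)) (te (m + 3)) (tg (m + 3)) =
      ((ta (m + 3) - te (m + 3)) / (ta (m + 3) - tg (m + 3))) * ((te (m + 1) - tg (m + 3)) / (te (m + 1) - te (m + 3)))"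
      unfolding cross_ratio_def using o by (simp add: divide_simps) (simp add: algebra_simps)
    also have "\<dots> \<le> (2 * (1 - z (m + 3))) * 2"
    proof (rule mult_mono)
      have "tg (m + 3) = \<alpha> (m + 3) * te (m + 3)" using o by (simp add: \<alpha>_def)
      also have "\<dots> \<le> (1 / 5) * ta (m + 3)" using \<alpha>_small[of "m + 3"] m o by (intro mult_mono) auto
      finally have "ta (m + 3) / 2 \<le> ta (m + 3) - tg (m + 3)" using o by simp
      then have "(ta (m + 3) - te (m + 3)) / (ta (m + 3) - tg (m + 3)) \<le> (ta (m + 3) - te (m + 3)) / (ta (m + 3) / 2)"
        using o by (intro divide_left_mono mult_pos_pos) auto
      also have "\<dots> = 2 * (1 - z (m + 3))" using o by (simp add: z_def diff_divide_distrib)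
      finally show "(ta (m + 3) - te (m + 3)) / (ta (m + 3) - tg (m + 3)) \<le> 2 * (1 - z (m + 3))" .
      have "tg (m + 1) = \<alpha> (m + 1) * te (m + 1)" using te_pos[of "m + 1"] by (simp add: \<alpha>_def)
      also have "\<dots> \<le> (1 / 5) * te (m + 1)" using \<alpha>_small[of "m + 1"] m te_pos[of "m + 1"] by (intro mult_right_mono) auto
      finally have "te (m + 3) \<le> te (m + 1) / 5" using o by simp
      then show "(te (m + 1) - tg (m + 3)) / (te (m + 1) - te (m + 3)) \<le> 2"
        using o te_pos[of "m + 1"] by (subst pos_divide_le_eq) auto
    qed (use o less1(3)[of "m + 3"] in auto)
    finally show ?thesis by (simp add: algebra_simps)
  qed
  \<comment> \<open>\<open>32\<close> collects \<open>4\<close> from \<open>\<rho>_z\<close>,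
    \<open>2\<close> from the denominator in the gap \<open>1 - Y\<close>, and \<open>4\<close> from
    \<open>y\<close> and \<open>z\<close> being at least \<open>1 / 2\<close>.\<close>
  define c :: real where "c = 1 / (exp 2 * 32)"
  have c: "0 < c" by (simp add: c_def)
  \<comment> \<open>In the complement of \<open>cross_0_g_a_g\<close> the possibly tiny
    \<open>1 - z\<close> occurs on both sides, on the right by way of \<open>\<rho>_z\<close>, and
    cancels. What is left is \<open>ta (m + 5) / ta (m + 3) = y * \<alpha> * z\<close>.\<close>
  have Y_\<alpha>: "c * \<alpha> (m + 3) \<le> 1 - Y (m + 2)" if m: "n0 \<le> m" for m
  proof -
    have i: "m + 2 + 2 = m + 4" "m + 3 + 2 = m + 5" by simp_all
    note o = order_side[of m] tg_pos[of "m + 3"] tg_te[of "m + 3"] te_ta[of "m + 3"] ta_pos[of "m + 5"] ta_tg[of "m + 3", unfolded i]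
    define X where "X = (1 - z (m + 3)) * (ta (m + 5) / ta (m + 3))"
    from one_minus_cross_ratio_mono[OF _ _ _ _ cross_0_g_a_g[of m]]
    have 1: "((te (m + 3) - ta (m + 3)) * (0 - ta (m + 5))) / ((ta (m + 5) - ta (m + 3)) * (0 - te (m + 3)))
      \<le> ((g (m + 4) - 0) * (g (m + 2) - a (m + 4))) / ((a (m + 4) - 0) * (g (m + 2) - g (m + 4)))"
      using o by fastforce
    have "X = (ta (m + 3) - te (m + 3)) / ta (m + 3) * (ta (m + 5) / ta (m + 3))"
      using o by (simp add: X_def z_def diff_divide_distrib)
    also have "\<dots> \<le> (ta (m + 3) - te (m + 3)) / (ta (m + 3) - ta (m + 5)) * (ta (m + 5) / te (m + 3))"
      using o by (intro mult_mono divide_left_mono mult_pos_pos) auto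
    also have "\<dots> = ((te (m + 3) - ta (m + 3)) * (0 - ta (m + 5))) / ((ta (m + 5) - ta (m + 3)) * (0 - te (m + 3)))"
      using o by (simp add: divide_simps) (simp add: algebra_simps)
    also note 1
    also have "((g (m + 4) - 0) * (g (m + 2) - a (m + 4))) / ((a (m + 4) - 0) * (g (m + 2) - g (m + 4)))
      = (g (m + 4) / a (m + 4)) * ((g (m + 2) - a (m + 4)) / (g (m + 2) - g (m + 4)))" by simp
    also have "\<dots> \<le> \<rho> (m + 4) * (2 * (1 - Y (m + 2)))"
    proof (rule mult_mono)
      show "g (m + 4) / a (m + 4) \<le> \<rho> (m + 4)" unfolding \<rho>_def using o by (intro divide_left_mono mult_pos_pos) auto
      have "g (m + 4) = \<rho> (m + 4) * e (m + 4)" using o by (simp add: \<rho>_def)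
      also have "\<dots> \<le> (1 / 4) * g (m + 2)" using \<rho>_small[of "m + 4"] m o by (intro mult_mono) auto
      finally have "g (m + 2) / 2 \<le> g (m + 2) - g (m + 4)" using o by simp
      then have "(g (m + 2) - a (m + 4)) / (g (m + 2) - g (m + 4)) \<le> (g (m + 2) - a (m + 4)) / (g (m + 2) / 2)"
        using o by (intro divide_left_mono mult_pos_pos) auto
      also have "\<dots> = 2 * (1 - Y (m + 2))" using o unfolding Y_def i by (simp add: diff_divide_distrib)
      finally show "(g (m + 2) - a (m + 4)) / (g (m + 2) - g (m + 4)) \<le> 2 * (1 - Y (m + 2))" .
    qed (use o pos(2)[of "m + 4"] in auto)
    also have "\<dots> \<le> (exp 2 * 4 * (1 - z (m + 3))) * (2 * (1 - Y (m + 2)))"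
      using \<rho>_z[OF m] less1(5)[of "m + 2"] by (intro mult_right_mono) auto
    finally have "(1 - z (m + 3)) * (ta (m + 5) / ta (m + 3)) \<le> (1 - z (m + 3)) * (exp 2 * 8 * (1 - Y (m + 2)))"
      by (simp add: X_def algebra_simps)
    then have 2: "ta (m + 5) / ta (m + 3) \<le> exp 2 * 8 * (1 - Y (m + 2))"
      by (rule mult_left_le_imp_le) (use less1(3)[of "m + 3"] in simp)
    have "\<alpha> (m + 3) / 4 = (1 / 2) * \<alpha> (m + 3) * (1 / 2)" by simp
    also have "\<dots> \<le> y (m + 3) * \<alpha> (m + 3) * z (m + 3)"
      using y_half[OF m] z_half[OF m] pos[of "m + 3"] by (intro mult_mono) auto
    also have "\<dots> = ta (m + 5) / ta (m + 3)" using o unfolding y_def i by (simp add: \<alpha>_def z_def)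
    finally have "\<alpha> (m + 3) / 4 \<le> exp 2 * 8 * (1 - Y (m + 2))" using 2 by (rule order_trans)
    then have "\<alpha> (m + 3) \<le> (1 - Y (m + 2)) * (exp 2 * 32)" by (simp add: algebra_simps)
    then have "\<alpha> (m + 3) / (exp 2 * 32) \<le> 1 - Y (m + 2)" by (subst pos_divide_le_eq) auto
    then show ?thesis by (simp add: c_def)
  qed
  \<comment> \<open>The complement of \<open>cross_e_a_g_e\<close> bounds \<open>1 - e / a\<close>
    below by a product of two relative gaps, each at least a multiple of an \<open>\<alpha>\<close>.
    The constant is \<open>36 = 2 * 3 * 3 * 2\<close>: a factor from \<open>U\<close>, two uses of
    \<open>elastic\<close>, one of \<open>z_\<rho>\<close>.\<close>
  have \<rho>_lower: "c * c / 36 * (\<alpha> (m + 3) * \<alpha> (m + 4)) \<le> \<rho> (m + 5)" if m: "n0 \<le> m" for m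
  proof -
    have i: "m + 2 + 2 = m + 4" "m + 3 + 2 = m + 5" "m + 1 + 3 = m + 4" "m + 1 + 4 = m + 5" "m + 1 + 2 = m + 3" by simp_all
    note o = order_side[of m] tg_pos[of "m + 3"] tg_te[of "m + 3"] ta_pos[of "m + 5"] ta_tg[of "m + 3", unfolded i]
    from one_minus_cross_ratio_mono[OF _ _ _ _ cross_e_a_g_e[of m]]
    have 1: "((ta (m + 5) - tg (m + 3)) * (- U - 0)) / ((0 - tg (m + 3)) * (- U - ta (m + 5)))
      \<le> ((a (m + 4) - e (m + 4)) * (e (m + 2) - g (m + 2))) / ((g (m + 2) - e (m + 4)) * (e (m + 2) - a (m + 4)))"
      using o U_pos by fastforce
    have "(1 - y (m + 3)) * (1 / 2) = ((tg (m + 3) - ta (m + 5)) / tg (m + 3)) * (1 / 2)"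
      using o unfolding y_def i by (simp add: diff_divide_distrib)
    also have "\<dots> \<le> ((tg (m + 3) - ta (m + 5)) / tg (m + 3)) * (U / (ta (m + 5) + U))"
      using o ta(3)[of "m + 5"] m by (intro mult_left_mono half(1)) auto
    also have "\<dots> = ((ta (m + 5) - tg (m + 3)) * (- U - 0)) / ((0 - tg (m + 3)) * (- U - ta (m + 5)))"
    proof -
      have "(ta (m + 5) - tg (m + 3)) * (- U - 0) = (tg (m + 3) - ta (m + 5)) * U"
        "(0 - tg (m + 3)) * (- U - ta (m + 5)) = tg (m + 3) * (ta (m + 5) + U)"
        by (simp_all add: left_diff_distrib right_diff_distrib distrib_left)
      then show ?thesis by simp
    qed
    also note 1
    also have "((a (m + 4) - e (m + 4)) * (e (m + 2) - g (m + 2))) / ((g (m + 2) - e (m + 4)) * (e (m + 2) - a (m + 4)))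
      = ((a (m + 4) - e (m + 4)) / (g (m + 2) - e (m + 4))) * ((e (m + 2) - g (m + 2)) / (e (m + 2) - a (m + 4)))" by simp
    also have "\<dots> \<le> ((a (m + 4) - e (m + 4)) / (g (m + 2) - a (m + 4))) * 1"
      using o by (intro mult_mono divide_left_mono mult_pos_pos) auto
    finally have "(1 - y (m + 3)) / 2 * (g (m + 2) - a (m + 4)) \<le> a (m + 4) - e (m + 4)"
      using o by (simp add: pos_le_divide_eq)
    moreover have "(1 - Y (m + 2)) * a (m + 4) \<le> g (m + 2) - a (m + 4)"
    proof -
      have "(1 - Y (m + 2)) * a (m + 4) \<le> (1 - Y (m + 2)) * g (m + 2)"
        using o less1(5)[of "m + 2"] by (intro mult_left_mono) auto
      also have "\<dots> = g (m + 2) - a (m + 4)" using o unfolding Y_def i by (simp add: left_diff_distrib)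
      finally show ?thesis .
    qed
    ultimately have "(1 - y (m + 3)) / 2 * ((1 - Y (m + 2)) * a (m + 4)) \<le> a (m + 4) - e (m + 4)"
      using less1(4)[of "m + 3"] by (meson diff_ge_0_iff_ge divide_nonneg_pos less_imp_le mult_left_mono order_trans zero_less_numeral)
    then have 2: "(1 - y (m + 3)) / 2 * (1 - Y (m + 2)) \<le> 1 - e (m + 4) / a (m + 4)"
      using o(1) by (simp add: pos_le_divide_eq flip: mult.assoc) (simp add: field_simps)
    have y3: "1 - Y (m + 3) \<le> 3 * (1 - y (m + 3))"
    proof -
      have "1 - v1 (m + 3) (ta (m + 5)) / v1 (m + 3) (tg (m + 3)) \<le> 3 * (1 - ta (m + 5) / tg (m + 3))"
        using o te_ta[of "m + 3"] m by (intro elastic) auto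
      moreover have "v1 (m + 3) (ta (m + 5)) = a (m + 5)"
        using v1_images(1)[of "m + 5"] v_add_2(1)[of "m + 3"] unfolding i by simp
      ultimately show ?thesis unfolding v1_images Y_def y_def i by simp
    qed
    have z4: "1 - e (m + 4) / a (m + 4) \<le> 3 * (1 - z (m + 4))"
      using elastic[of "m + 4" "te (m + 4)" "ta (m + 4)"] te_pos[of "m + 4"] te_ta[of "m + 4"] m
      unfolding v1_images z_def by simp
    have "c * c * (\<alpha> (m + 3) * \<alpha> (m + 4)) = (c * \<alpha> (m + 3)) * (c * \<alpha> (m + 4))" by simp
    also have "\<dots> \<le> (1 - Y (m + 2)) * (1 - Y (m + 3))"
      using Y_\<alpha>[of m] Y_\<alpha>[of "m + 1", unfolded i] m pos(1)[of "m + 4"] c less1(5)[of "m + 2"] by (intro mult_mono) auto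
    also have "\<dots> \<le> (1 - Y (m + 2)) * (3 * (1 - y (m + 3)))"
      using y3 less1(5)[of "m + 2"] by (intro mult_left_mono) auto
    also have "\<dots> = 6 * ((1 - y (m + 3)) / 2 * (1 - Y (m + 2)))" by simp
    also have "\<dots> \<le> 6 * (3 * (1 - z (m + 4)))" using 2 z4 by (intro mult_left_mono order_trans[OF 2 z4]) auto
    also have "\<dots> \<le> 36 * \<rho> (m + 5)" using z_\<rho>[of "m + 1", unfolded i] m by simp
    finally show ?thesis by simp
  qed
  have lower: "ell (m + 5) * w (m + 5) \<le> w (m + 3) + w (m + 4) + (1 - ln (c * c / 36))" if m: "n0 \<le> m" for m
  proof -
    have "ln (c * c / 36 * (\<alpha> (m + 3) * \<alpha> (m + 4))) \<le> ln (\<rho> (m + 5))"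
      using \<rho>_lower[OF m] c pos by (subst ln_le_cancel_iff) (auto intro!: mult_pos_pos)
    moreover have "ln (c * c / 36 * (\<alpha> (m + 3) * \<alpha> (m + 4))) = ln (c * c / 36) + (ln (\<alpha> (m + 3)) + ln (\<alpha> (m + 4)))"
    proof -
      have "0 < c * c / 36" "0 < \<alpha> (m + 3)" "0 < \<alpha> (m + 4)" using c pos by auto
      then show ?thesis using c by (subst ln_mult, simp_all add: ln_mult)
    qed
    ultimately have "ln (c * c / 36) - w (m + 3) - w (m + 4) \<le> ln (\<rho> (m + 5))"
      by (simp add: ln_\<alpha>)
    then show ?thesis using \<rho>_ln[of "m + 5"] m by simp
  qed
  have upper: "w (m + 3) + w (m + 4) - 3 \<le> ell (m + 5) * w (m + 5)" if m: "n0 \<le> m" for m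
  proof -
    have i: "m + 4 + 2 = m + 6" by simp
    have ln2: "ln (t + U) - ln (r + U) \<le> 1" if "0 < r" "r \<le> t" "t \<le> U" for r t
    proof -
      have "ln (t + U) - ln (r + U) \<le> ((t + U) - (r + U)) / (r + U)"
        using that U_pos by (intro ln_diff_le_if_less) auto
      also have "\<dots> \<le> 1" using that U_pos by (simp add: pos_divide_le_eq)
      finally show ?thesis .
    qed
    have "ln (te (m + 3) + U) - ln (tg (m + 3) + U) \<le> 1"
      using ln2[of "tg (m + 3)" "te (m + 3)"] tg_pos[of "m + 3"] tg_te[of "m + 3"] te_ta[of "m + 3"] ta(3)[of "m + 3"] m by auto
    moreover have "ln (ta (m + 4) + U) - ln (ta (m + 6) + U) \<le> 1"
      using ln2[of "ta (m + 6)" "ta (m + 4)"] ta_pos[of "m + 6"] ta_decr[of "m + 4", unfolded i] ta(3)[of "m + 4"] m by auto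
    moreover have "V (m + 5) \<le> ell (m + 5) * w (m + 5) + 1"
      using v3[of "tg (m + 5)" "te (m + 5)" "m + 5"] Kdiff(2)[of "m + 5" "tg (m + 5)" "te (m + 5)"]
        tg_pos[of "m + 5"] tg_te[of "m + 5"] te_ta[of "m + 5"] ta(1)[of "m + 5"] m unfolding V_def w_def by simp
    ultimately show ?thesis using V_lower[of m] w_le_mu[of "m + 4"] by linarith
  qed
  define C where "C = max 3 (1 - ln (c * c / 36))"
  have "\<bar>w (n + 2) - (if even n then 1 / l2 else 1 / l1) * (w (n + 1) + w n)\<bar> \<le> C" if n: "n0 + 3 \<le> n" for n
  proof -
    define m where "m = n - 3"
    have m: "n = m + 3" "n0 \<le> m" using n by (auto simp: m_def)
    have i: "m + 3 + 1 = m + 4" "m + 3 + 2 = m + 5" by simp_all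
    have el: "(if even n then 1 / l2 else 1 / l1) = 1 / ell (m + 5)" by (simp add: m ell_def)
    define x where "x = ell (m + 5) * w (m + 5) - (w (m + 4) + w (m + 3))"
    have "\<bar>x\<bar> \<le> C" using lower[OF m(2)] upper[OF m(2)] unfolding x_def C_def by linarith
    moreover have "w (m + 5) - 1 / ell (m + 5) * (w (m + 4) + w (m + 3)) = x / ell (m + 5)"
      using ell_bounds[of "m + 5"] by (simp add: x_def diff_divide_distrib)
    moreover have "\<bar>x / ell (m + 5)\<bar> \<le> \<bar>x\<bar>"
      using ell_bounds[of "m + 5"] by (simp add: abs_divide divide_le_eq mult_le_cancel_left1)
    ultimately show ?thesis unfolding el unfolding m(1) i by simp
  qed
  then show ?thesis by blast
qed

text \<open>Identifies the interval between \<open>NN n\<close> and \<open>EE n\<close> as a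
  preimage of the flat piece and keeps it clear of the cut point, so that its length may be read off
  in the coordinate.\<close>

lemma T_preimage_flat:
  assumes "1 \<le> n"
  shows "x1 < min (NN n) (EE n)" "max (NN n) (EE n) < x1 + L"
    "\<And>x. x3 < T (n + 1) x \<and> T (n + 1) x < x4 \<longleftrightarrow> min (NN n) (EE n) < x \<and> x < max (NN n) (EE n)"
proof -
  note o = tg_pos[of n] tg_te[of n] te_ta[of n] ta_bound[OF assms]
  show "x1 < min (NN n) (EE n)" "max (NN n) (EE n) < x1 + L"
    using s_cases[of n] o pts unfolding NN_eq EE_eq by (auto simp: edge_def)
  have Tmm: "T (n + 1) (min (NN n) (EE n)) = x3" "T (n + 1) (max (NN n) (EE n)) = x4"
    using s_cases[of n] o T_NN[of n] T_EE[of n] by (auto simp: NN_eq EE_eq edge_def min_def max_def)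
  have mono: "T (n + 1) x \<le> T (n + 1) y" if "x \<le> y" for x y
    unfolding T_def using that by (rule S_mono)
  have inj: "x = y" if "T (n + 1) x = T (n + 1) y" "T (n + 1) x = x3 \<or> T (n + 1) x = x4" for x y
    using S_inj_edge[of "qseq (n + 1)" "pseq (n + 1)" x y] that pts by (auto simp: T_def)
  fix x
  show "x3 < T (n + 1) x \<and> T (n + 1) x < x4 \<longleftrightarrow> min (NN n) (EE n) < x \<and> x < max (NN n) (EE n)"
  proof
    assume "x3 < T (n + 1) x \<and> T (n + 1) x < x4"
    then show "min (NN n) (EE n) < x \<and> x < max (NN n) (EE n)"
      using mono[of x "min (NN n) (EE n)"] mono[of "max (NN n) (EE n)" x] unfolding Tmm by linarith
  next
    assume x: "min (NN n) (EE n) < x \<and> x < max (NN n) (EE n)"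
    have "x3 \<le> T (n + 1) x" "T (n + 1) x \<le> x4"
      using x mono[of "min (NN n) (EE n)" x] mono[of x "max (NN n) (EE n)"] unfolding Tmm by auto
    moreover have "T (n + 1) x \<noteq> x3" "T (n + 1) x \<noteq> x4"
      using inj[of x "min (NN n) (EE n)"] inj[of x "max (NN n) (EE n)"] x unfolding Tmm by auto
    ultimately show "x3 < T (n + 1) x \<and> T (n + 1) x < x4" by simp
  qed
qed

end

section \<open>Smooth branches\<close>

text \<open>The limit is included because the inner function of a composition must enter the range
  where the outer law holds.\<close>

definition linear_germ :: "(real \<Rightarrow> real) \<Rightarrow> bool" where
  "linear_germ v \<longleftrightarrow> power_like 1 v \<and> (v \<longlongrightarrow> 0) (at_right 0)"

lemma power_like_eventually_pos:
  assumes "power_like l v" shows "eventually (\<lambda>t. 0 < v t) (at_right 0)"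
proof -
  obtain d where "0 < d" "\<And>t. 0 < t \<Longrightarrow> t < d \<Longrightarrow> 0 < v t"
    using assms unfolding power_like_def by (metis order_refl)
  then show ?thesis by (auto simp: eventually_at_right_field)
qed

lemma power_like_germ:
  assumes u: "power_like l u" and v: "linear_germ v" shows "power_like l (\<lambda>t. u (v t))"
proof -
  have lim: "\<exists>d>0. \<forall>t. 0 < t \<and> t < d \<longrightarrow> v t < e" if "0 < e" for e
  proof -
    have "eventually (\<lambda>t. v t < e) (at_right 0)"
      using v that unfolding linear_germ_def by (intro order_tendstoD(2)) auto
    then show ?thesis by (auto simp: eventually_at_right_field)
  qed
  from power_like_compose[OF u _ order_refl lim] v show ?thesis by (simp add: linear_germ_def)
qed

lemma germ_compose:
  assumes u: "linear_germ u" and v: "linear_germ v" shows "linear_germ (\<lambda>t. u (v t))"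
  unfolding linear_germ_def
proof
  show "power_like 1 (\<lambda>t. u (v t))" using power_like_germ[of 1 u v] assms by (simp add: linear_germ_def)
  have "filterlim v (at_right 0) (at_right 0)"
    unfolding filterlim_at using v power_like_eventually_pos[of 1 v]
    by (auto simp: linear_germ_def elim: eventually_mono)
  then show "((\<lambda>t. u (v t)) \<longlongrightarrow> 0) (at_right 0)"
    using u unfolding linear_germ_def by (blast intro: filterlim_compose)
qed

lemma germ_cmult: "linear_germ v \<Longrightarrow> 0 < c \<Longrightarrow> linear_germ (\<lambda>t. c * v t)"
  unfolding linear_germ_def using power_like_cmult tendsto_mult_right_zero by blast

lemma germ_scale: "0 < c \<Longrightarrow> linear_germ (\<lambda>t. c * t)"
proof (rule germ_cmult)
  show "linear_germ (\<lambda>t. t)" unfolding linear_germ_def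
  proof
    show "power_like 1 (\<lambda>t. t)" by (rule power_likeI[of 1 0]) auto
    show "((\<lambda>t::real. t) \<longlongrightarrow> 0) (at_right 0)" by (rule tendsto_ident_at)
  qed
qed

lemma bounded_on_interval:
  fixes h :: "real \<Rightarrow> real"
  assumes "continuous_on {a..b} h"
  obtains B where "0 < B" "\<And>x. a \<le> x \<Longrightarrow> x \<le> b \<Longrightarrow> \<bar>h x\<bar> \<le> B"
proof -
  have "bounded (h ` {a..b})" using assms by (intro compact_imp_bounded compact_continuous_image) auto
  then obtain B where "0 < B" "\<And>y. y \<in> h ` {a..b} \<Longrightarrow> norm y \<le> B" unfolding bounded_pos by blast
  then show thesis using that[of B] by auto
qed

lemma germ_if_C2:
  fixes h h' h'' :: "real \<Rightarrow> real"
  assumes d: "0 < d" and h0: "h 0 = 0" "0 < h' 0"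
    and d1: "\<And>t. 0 \<le> t \<Longrightarrow> t \<le> d \<Longrightarrow> (h has_real_derivative h' t) (at t within {0..d})"
    and d2: "\<And>t. 0 \<le> t \<Longrightarrow> t \<le> d \<Longrightarrow> (h' has_real_derivative h'' t) (at t within {0..d})"
    and cont: "continuous_on {0..d} h''"
  shows "linear_germ h"
  unfolding linear_germ_def
proof
  obtain B where B: "0 < B" "\<And>x. 0 \<le> x \<Longrightarrow> x \<le> d \<Longrightarrow> \<bar>h'' x\<bar> \<le> B"
    using bounded_on_interval[OF cont] by blast
  have conth: "continuous_on {0..d} h"
    by (rule DERIV_continuous_on) (use d1 in auto)
  show "power_like 1 h"
  proof (rule power_like_one_if_derivative_Lipschitz[OF d, of B])
    show "(h has_real_derivative h' t) (at t)" if "0 < t" "t < d" for t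
      using d1[of t] that at_within_interior[of t "{0..d}"] by simp
    show "\<bar>h' t - h' s\<bar> \<le> B * \<bar>t - s\<bar>" if "0 \<le> t" "t \<le> d" "0 \<le> s" "s \<le> d" for t s
      using field_differentiable_bound[of "{0..d}" h' h'' B t s] d2 B that by auto
  qed (use B h0 conth in auto)
  have "(h \<longlongrightarrow> h 0) (at 0 within {0..d})" using conth d by (auto simp: continuous_on_def)
  moreover have "at 0 within {0..d} = at_right 0"
    using d by (rule at_within_Icc_at_right)
  ultimately show "(h \<longlongrightarrow> 0) (at_right 0)" using h0 by simp
qed

lemma germ_powr_up:
  assumes "0 < y" "0 < l" shows "linear_germ (\<lambda>t. (y + t) powr l - y powr l)"
proof (rule germ_if_C2[where d = 1 and h' = "\<lambda>t. l * (y + t) powr (l - 1)" and h'' = "\<lambda>t. l * ((l - 1) * (y + t) powr (l - 1 - 1))"])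
  have p: "((\<lambda>t. (y + t) powr r) has_real_derivative r * (y + t) powr (r - 1)) (at t within {0..1})" if "0 \<le> t" for t r
  proof -
    have "((\<lambda>t. y + t) has_real_derivative 1) (at t)" by (auto intro!: derivative_eq_intros)
    from DERIV_fun_powr[OF this, of r] assms that show ?thesis by (auto intro: has_field_derivative_at_within)
  qed
  show "((\<lambda>t. (y + t) powr l - y powr l) has_real_derivative l * (y + t) powr (l - 1)) (at t within {0..1})" if "0 \<le> t" for t
    using DERIV_diff[OF p[OF that, of l] DERIV_const] by simp
  show "((\<lambda>t. l * (y + t) powr (l - 1)) has_real_derivative l * ((l - 1) * (y + t) powr (l - 1 - 1))) (at t within {0..1})" if "0 \<le> t" for t
    using DERIV_cmult[OF p[OF that, of "l - 1"], of l] by simp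
  show "continuous_on {0..1} (\<lambda>t. l * ((l - 1) * (y + t) powr (l - 1 - 1)))"
    using assms by (intro continuous_intros) auto
qed (use assms in auto)

lemma germ_powr_down:
  assumes "0 < y" "0 < l" shows "linear_germ (\<lambda>t. y powr l - (y - t) powr l)"
proof (rule germ_if_C2[where d = "y / 2" and h' = "\<lambda>t. l * (y - t) powr (l - 1)" and h'' = "\<lambda>t. l * (- ((l - 1) * (y - t) powr (l - 1 - 1)))"])
  have p: "((\<lambda>t. (y - t) powr r) has_real_derivative - (r * (y - t) powr (r - 1))) (at t within {0..y / 2})" if "t \<le> y / 2" for t r
  proof -
    have "((\<lambda>t. y - t) has_real_derivative - 1) (at t)" by (auto intro!: derivative_eq_intros)
    from DERIV_fun_powr[OF this, of r] assms that show ?thesis by (auto intro: has_field_derivative_at_within)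
  qed
  show "((\<lambda>t. y powr l - (y - t) powr l) has_real_derivative l * (y - t) powr (l - 1)) (at t within {0..y / 2})" if "t \<le> y / 2" for t
    using DERIV_diff[OF DERIV_const p[OF that, of l]] by simp
  show "((\<lambda>t. l * (y - t) powr (l - 1)) has_real_derivative l * (- ((l - 1) * (y - t) powr (l - 1 - 1)))) (at t within {0..y / 2})" if "t \<le> y / 2" for t
    using DERIV_cmult[OF p[OF that, of "l - 1"], of l] by simp
  show "continuous_on {0..y / 2} (\<lambda>t. l * (- ((l - 1) * (y - t) powr (l - 1 - 1))))"
    using assms by (intro continuous_intros) auto
qed (use assms in auto)

text \<open>Differentiability of the inverse excludes a zero derivative, by the chain rule
  \<open>h1 (\<phi> x) * g1 x = 1\<close>; monotonicity excludes a negative one.\<close>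

lemma diffeo_derivatives:
  assumes "orientation_preserving_C3_diffeo \<phi>"
  obtains g1 g2 g3 where
    "\<And>x. 0 \<le> x \<Longrightarrow> x \<le> 1 \<Longrightarrow> (\<phi> has_real_derivative g1 x) (at x within {0..1})"
    "\<And>x. 0 \<le> x \<Longrightarrow> x \<le> 1 \<Longrightarrow> (g1 has_real_derivative g2 x) (at x within {0..1})"
    "\<And>x. 0 \<le> x \<Longrightarrow> x \<le> 1 \<Longrightarrow> (g2 has_real_derivative g3 x) (at x within {0..1})"
    "\<And>x. 0 \<le> x \<Longrightarrow> x \<le> 1 \<Longrightarrow> 0 < g1 x"
proof -
  have bij: "bij_betw \<phi> {0..1} {0..1}" and smono: "strict_mono_on {0..1} \<phi>"
    and C3: "C3_on {0..1} \<phi>" "C3_on {0..1} (inv_into {0..1} \<phi>)"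
    using assms by (auto simp: orientation_preserving_C3_diffeo_def)
  obtain g1 g2 g3 where g: "\<And>x. x \<in> {0..1} \<Longrightarrow> (\<phi> has_real_derivative g1 x) (at x within {0..1})"
    "\<And>x. x \<in> {0..1} \<Longrightarrow> (g1 has_real_derivative g2 x) (at x within {0..1})"
    "\<And>x. x \<in> {0..1} \<Longrightarrow> (g2 has_real_derivative g3 x) (at x within {0..1})"
    using C3(1) unfolding C3_on_def by blast
  obtain h1 where h: "\<And>x. x \<in> {0..1} \<Longrightarrow> (inv_into {0..1} \<phi> has_real_derivative h1 x) (at x within {0..1})"
    using C3(2) unfolding C3_on_def by blast
  have pos: "0 < g1 x" if x: "x \<in> {0..1}" for x
  proof -
    have im: "\<phi> ` {0..1} = {0..1}" using bij by (simp add: bij_betw_def)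
    have "(inv_into {0..1} \<phi> \<circ> \<phi> has_real_derivative h1 (\<phi> x) * g1 x) (at x within {0..1})"
      by (rule DERIV_image_chain) (use h[of "\<phi> x"] g(1)[OF x] x im in \<open>simp_all add: im\<close>, metis atLeastAtMost_iff imageI im)
    moreover have "(inv_into {0..1} \<phi> \<circ> \<phi> has_real_derivative 1) (at x within {0..1})"
    proof (rule has_field_derivative_transform_within[OF DERIV_ident zero_less_one x])
      show "y = (inv_into {0..1} \<phi> \<circ> \<phi>) y" if "y \<in> {0..1}" for y
        using bij_betw_inv_into_left[OF bij that] by simp
    qed
    ultimately have "h1 (\<phi> x) * g1 x = 1"
      using vector_derivative_unique_within_closed_interval[of 0 "1::real" x "inv_into {0..1} \<phi> \<circ> \<phi>"] x
      by (simp add: has_real_derivative_iff_has_vector_derivative)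
    then have ne: "g1 x \<noteq> 0" by auto
    have "0 \<le> g1 x"
    proof (rule tendsto_lowerbound)
      show "((\<lambda>y. (\<phi> y - \<phi> x) / (y - x)) \<longlongrightarrow> g1 x) (at x within {0..1})"
        using g(1)[OF x] by (simp add: has_field_derivative_iff)
      have "0 \<le> (\<phi> y - \<phi> x) / (y - x)" if "y \<in> {0..1}" for y
      proof (cases "x \<le> y")
        case True
        then have "\<phi> x \<le> \<phi> y" using strict_mono_onD[OF smono, of x y] x that by (cases "x = y") (auto simp: less_imp_le)
        then show ?thesis using True by simp
      next
        case False
        then have "\<phi> y < \<phi> x" using strict_mono_onD[OF smono, of y x] x that by auto
        then show ?thesis using False by (simp add: divide_nonpos_nonpos)
      qed
      then show "eventually (\<lambda>y. 0 \<le> (\<phi> y - \<phi> x) / (y - x)) (at x within {0..1})"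
        by (auto simp: eventually_at_filter)
      show "at x within {0..1} \<noteq> bot"
        using x by (simp add: trivial_limit_within islimpt_Icc)
    qed
    then show ?thesis using ne by simp
  qed
  show thesis by (rule that[of g1 g2 g3]) (use g pos in auto)
qed

lemma diffeo_ends:
  assumes "orientation_preserving_C3_diffeo \<phi>"
  shows "\<phi> 0 = 0" "\<phi> 1 = 1" "\<And>x. 0 \<le> x \<Longrightarrow> x \<le> 1 \<Longrightarrow> 0 \<le> \<phi> x \<and> \<phi> x \<le> 1"
    "\<And>x y. 0 \<le> x \<Longrightarrow> x < y \<Longrightarrow> y \<le> 1 \<Longrightarrow> \<phi> x < \<phi> y"
proof -
  have im: "\<phi> ` {0..1} = {0..1}" and smono: "strict_mono_on {0..1} \<phi>"
    using assms by (auto simp: orientation_preserving_C3_diffeo_def bij_betw_def)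
  show less: "\<phi> x < \<phi> y" if "0 \<le> x" "x < y" "y \<le> 1" for x y
    using strict_mono_onD[OF smono, of x y] that by auto
  show range: "0 \<le> \<phi> x \<and> \<phi> x \<le> 1" if "0 \<le> x" "x \<le> 1" for x
  proof -
    have "\<phi> x \<in> \<phi> ` {0..1}" using that by auto
    then show ?thesis unfolding im by auto
  qed
  have "0 \<in> \<phi> ` {0..1}" "1 \<in> \<phi> ` {0..1}" unfolding im by auto
  then obtain x y where "0 \<le> x" "x \<le> 1" "\<phi> x = 0" "0 \<le> y" "y \<le> 1" "\<phi> y = 1" by auto
  then show "\<phi> 0 = 0" "\<phi> 1 = 1" using less[of 0 x] less[of y 1] range[of 0] range[of 1]
    by (cases "x = 0"; cases "y = 1"; force)+
qed

lemma germ_diffeo_0: "orientation_preserving_C3_diffeo \<phi> \<Longrightarrow> linear_germ \<phi>"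
  and germ_diffeo_1: "orientation_preserving_C3_diffeo \<phi> \<Longrightarrow> linear_germ (\<lambda>t. 1 - \<phi> (1 - t))"
proof -
  assume diffeo: "orientation_preserving_C3_diffeo \<phi>"
  obtain g1 g2 g3 where g: "\<And>x. 0 \<le> x \<Longrightarrow> x \<le> 1 \<Longrightarrow> (\<phi> has_real_derivative g1 x) (at x within {0..1})"
    "\<And>x. 0 \<le> x \<Longrightarrow> x \<le> 1 \<Longrightarrow> (g1 has_real_derivative g2 x) (at x within {0..1})"
    "\<And>x. 0 \<le> x \<Longrightarrow> x \<le> 1 \<Longrightarrow> (g2 has_real_derivative g3 x) (at x within {0..1})"
    "\<And>x. 0 \<le> x \<Longrightarrow> x \<le> 1 \<Longrightarrow> 0 < g1 x"
    by (rule diffeo_derivatives[OF diffeo], (rule that; assumption))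
  have cont: "continuous_on {0..1} g2" by (rule DERIV_continuous_on) (use g(3) in auto)
  show "linear_germ \<phi>"
    by (rule germ_if_C2[of 1 _ g1 g2]) (use g cont diffeo_ends[OF diffeo] in auto)
  have im: "(\<lambda>t::real. 1 - t) ` {0..1} = {0..1}"
    by (auto simp: image_iff intro!: bexI[of _ "1 - _"])
  have flip: "((\<lambda>t. h (1 - t)) has_real_derivative - h' (1 - t)) (at t within {0..1})"
    if "\<And>x. 0 \<le> x \<Longrightarrow> x \<le> 1 \<Longrightarrow> (h has_real_derivative h' x) (at x within {0..1})" "0 \<le> t" "t \<le> 1" for h h' t
  proof -
    have "((\<lambda>t. 1 - t) has_real_derivative - 1) (at t within {0..1})" by (auto intro!: derivative_eq_intros)
    from DERIV_image_chain[OF _ this, of h "h' (1 - t)"] that(1)[of "1 - t"] that(2,3)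
    show ?thesis unfolding im by (simp add: comp_def)
  qed
  show "linear_germ (\<lambda>t. 1 - \<phi> (1 - t))"
  proof (rule germ_if_C2[of 1 _ "\<lambda>t. g1 (1 - t)" "\<lambda>t. - g2 (1 - t)"])
    show "((\<lambda>t. 1 - \<phi> (1 - t)) has_real_derivative g1 (1 - t)) (at t within {0..1})" if "0 \<le> t" "t \<le> 1" for t
      using DERIV_diff[OF DERIV_const flip[OF g(1) that]] by simp
    show "((\<lambda>t. g1 (1 - t)) has_real_derivative - g2 (1 - t)) (at t within {0..1})" if "0 \<le> t" "t \<le> 1" for t
      by (rule flip[OF g(2) that])
    show "continuous_on {0..1} (\<lambda>t. - g2 (1 - t))"
      by (intro continuous_intros continuous_on_compose2[OF cont]) auto
  qed (use g(4)[of 1] diffeo_ends[OF diffeo] in auto)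
qed

lemma diffeo_Lipschitz:
  assumes "orientation_preserving_C3_diffeo \<phi>"
  obtains B where "0 < B" "\<And>x y. 0 \<le> x \<Longrightarrow> x \<le> y \<Longrightarrow> y \<le> 1 \<Longrightarrow> 0 \<le> \<phi> y - \<phi> x \<and> \<phi> y - \<phi> x \<le> B * (y - x)"
proof -
  obtain g1 g2 g3 where g: "\<And>x. 0 \<le> x \<Longrightarrow> x \<le> 1 \<Longrightarrow> (\<phi> has_real_derivative g1 x) (at x within {0..1})"
    "\<And>x. 0 \<le> x \<Longrightarrow> x \<le> 1 \<Longrightarrow> (g1 has_real_derivative g2 x) (at x within {0..1})"
    "\<And>x. 0 \<le> x \<Longrightarrow> x \<le> 1 \<Longrightarrow> (g2 has_real_derivative g3 x) (at x within {0..1})"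
    "\<And>x. 0 \<le> x \<Longrightarrow> x \<le> 1 \<Longrightarrow> 0 < g1 x"
    by (rule diffeo_derivatives[OF assms], (rule that; assumption))
  have "continuous_on {0..1} g1" by (rule DERIV_continuous_on) (use g(2) in auto)
  then obtain B where B: "0 < B" "\<And>x. 0 \<le> x \<Longrightarrow> x \<le> 1 \<Longrightarrow> \<bar>g1 x\<bar> \<le> B"
    using bounded_on_interval by blast
  show thesis
  proof (rule that[OF B(1)])
    fix x y :: real assume xy: "0 \<le> x" "x \<le> y" "y \<le> 1"
    have "norm (\<phi> y - \<phi> x) \<le> B * norm (y - x)"
      by (rule field_differentiable_bound[of "{0..1}" _ g1]) (use g B xy in auto)
    moreover have "\<phi> x \<le> \<phi> y" using diffeo_ends(4)[OF assms, of x y] xy by (cases "x = y") auto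
    ultimately show "0 \<le> \<phi> y - \<phi> x \<and> \<phi> y - \<phi> x \<le> B * (y - x)" using xy by auto
  qed
qed

text \<open>The nonvanishing first derivative matches the proviso in
  \<open>negative_schwarzian\<close> and is stable under composition.\<close>

definition regular_C3 :: "real set \<Rightarrow> (real \<Rightarrow> real) \<Rightarrow> bool" where
  "regular_C3 D h \<longleftrightarrow> (\<exists>h1 h2 h3. \<forall>x\<in>D. (h has_real_derivative h1 x) (at x) \<and>
     (h1 has_real_derivative h2 x) (at x) \<and> (h2 has_real_derivative h3 x) (at x) \<and> h1 x \<noteq> 0)"

lemma regular_C3_affine: "c \<noteq> 0 \<Longrightarrow> regular_C3 D (\<lambda>x. c * x + b)"
  unfolding regular_C3_def
  by (rule exI[of _ "\<lambda>_. c"], rule exI[of _ "\<lambda>_. 0"], rule exI[of _ "\<lambda>_. 0"])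
     (auto intro!: derivative_eq_intros)

lemma regular_C3_powr: "l \<noteq> 0 \<Longrightarrow> regular_C3 {0<..} (\<lambda>x. x powr l)"
proof -
  assume l: "l \<noteq> 0"
  have p: "((\<lambda>t. t powr r) has_real_derivative r * t powr (r - 1)) (at t)" if "0 < t" for t r :: real
    using DERIV_fun_powr[OF DERIV_ident that, of r] by simp
  show ?thesis unfolding regular_C3_def
  proof (rule exI[of _ "\<lambda>x. l * x powr (l - 1)"], rule exI[of _ "\<lambda>x. l * ((l - 1) * x powr (l - 1 - 1))"],
      rule exI[of _ "\<lambda>x. l * ((l - 1) * ((l - 1 - 1) * x powr (l - 1 - 1 - 1)))"], intro ballI conjI)
    fix x :: real assume "x \<in> {0<..}"
    then have x: "0 < x" by simp
    show "((\<lambda>x. x powr l) has_real_derivative l * x powr (l - 1)) (at x)" by (rule p[OF x])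
    show "((\<lambda>x. l * x powr (l - 1)) has_real_derivative l * ((l - 1) * x powr (l - 1 - 1))) (at x)"
      by (intro DERIV_cmult p x)
    show "((\<lambda>x. l * ((l - 1) * x powr (l - 1 - 1))) has_real_derivative l * ((l - 1) * ((l - 1 - 1) * x powr (l - 1 - 1 - 1)))) (at x)"
      by (intro DERIV_cmult p x)
    show "l * x powr (l - 1) \<noteq> 0" using l x by simp
  qed
qed

lemma regular_C3_diffeo: "orientation_preserving_C3_diffeo \<phi> \<Longrightarrow> regular_C3 {0<..<1} \<phi>"
proof -
  assume diffeo: "orientation_preserving_C3_diffeo \<phi>"
  obtain g1 g2 g3 where g: "\<And>x. 0 \<le> x \<Longrightarrow> x \<le> 1 \<Longrightarrow> (\<phi> has_real_derivative g1 x) (at x within {0..1})"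
    "\<And>x. 0 \<le> x \<Longrightarrow> x \<le> 1 \<Longrightarrow> (g1 has_real_derivative g2 x) (at x within {0..1})"
    "\<And>x. 0 \<le> x \<Longrightarrow> x \<le> 1 \<Longrightarrow> (g2 has_real_derivative g3 x) (at x within {0..1})"
    "\<And>x. 0 \<le> x \<Longrightarrow> x \<le> 1 \<Longrightarrow> 0 < g1 x"
    by (rule diffeo_derivatives[OF diffeo], (rule that; assumption))
  have at: "at x within {0..1} = at x" if "x \<in> {0<..<1}" for x :: real
    using at_within_interior[of x "{0..1}"] that by simp
  show ?thesis unfolding regular_C3_def
  proof (rule exI[of _ g1], rule exI[of _ g2], rule exI[of _ g3], rule ballI)
    fix x :: real assume x: "x \<in> {0<..<1}"
    then have "0 \<le> x" "x \<le> 1" by auto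
    from g(1-3)[OF this] g(4)[OF this]
    show "(\<phi> has_real_derivative g1 x) (at x) \<and> (g1 has_real_derivative g2 x) (at x) \<and>
      (g2 has_real_derivative g3 x) (at x) \<and> g1 x \<noteq> 0"
      unfolding at[OF x] by simp
  qed
qed

lemma regular_C3_compose:
  assumes h: "regular_C3 D' h" and g: "regular_C3 D g" and sub: "\<And>x. x \<in> D \<Longrightarrow> g x \<in> D'"
  shows "regular_C3 D (\<lambda>x. h (g x))"
proof -
  obtain h1 h2 h3 where h: "\<And>x. x \<in> D' \<Longrightarrow> (h has_real_derivative h1 x) (at x) \<and>
     (h1 has_real_derivative h2 x) (at x) \<and> (h2 has_real_derivative h3 x) (at x) \<and> h1 x \<noteq> 0"
    using h unfolding regular_C3_def by blast
  obtain g1 g2 g3 where g: "\<And>x. x \<in> D \<Longrightarrow> (g has_real_derivative g1 x) (at x) \<and>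
     (g1 has_real_derivative g2 x) (at x) \<and> (g2 has_real_derivative g3 x) (at x) \<and> g1 x \<noteq> 0"
    using g unfolding regular_C3_def by blast
  show ?thesis unfolding regular_C3_def
  proof (rule exI[of _ "\<lambda>x. h1 (g x) * g1 x"], rule exI[of _ "\<lambda>x. h2 (g x) * g1 x * g1 x + g2 x * h1 (g x)"],
      rule exI[of _ "\<lambda>x. (h3 (g x) * g1 x * g1 x + g2 x * h2 (g x)) * g1 x + g2 x * (h2 (g x) * g1 x) +
         (g3 x * h1 (g x) + h2 (g x) * g1 x * g2 x)"], intro ballI conjI)
    fix x assume x: "x \<in> D"
    note g = g[OF x] and h = h[OF sub[OF x]]
    have c: "((\<lambda>x. h (g x)) has_real_derivative h1 (g x) * g1 x) (at x)"
      "((\<lambda>x. h1 (g x)) has_real_derivative h2 (g x) * g1 x) (at x)"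
      "((\<lambda>x. h2 (g x)) has_real_derivative h3 (g x) * g1 x) (at x)"
      using h g by (auto intro: DERIV_chain2)
    show "((\<lambda>x. h (g x)) has_real_derivative h1 (g x) * g1 x) (at x)" by (rule c)
    show 2: "((\<lambda>x. h1 (g x) * g1 x) has_real_derivative h2 (g x) * g1 x * g1 x + g2 x * h1 (g x)) (at x)"
      using DERIV_mult[OF c(2)] g by blast
    have "((\<lambda>x. h2 (g x) * g1 x) has_real_derivative h3 (g x) * g1 x * g1 x + g2 x * h2 (g x)) (at x)"
      using DERIV_mult[OF c(3)] g by blast
    then have "((\<lambda>x. h2 (g x) * g1 x * g1 x) has_real_derivative
        (h3 (g x) * g1 x * g1 x + g2 x * h2 (g x)) * g1 x + g2 x * (h2 (g x) * g1 x)) (at x)"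
      using DERIV_mult g by blast
    moreover have "((\<lambda>x. g2 x * h1 (g x)) has_real_derivative g3 x * h1 (g x) + h2 (g x) * g1 x * g2 x) (at x)"
      using DERIV_mult c(2) g by blast
    ultimately show "((\<lambda>x. h2 (g x) * g1 x * g1 x + g2 x * h1 (g x)) has_real_derivative
       (h3 (g x) * g1 x * g1 x + g2 x * h2 (g x)) * g1 x + g2 x * (h2 (g x) * g1 x) +
         (g3 x * h1 (g x) + h2 (g x) * g1 x * g2 x)) (at x)"
      by (rule DERIV_add)
    show "h1 (g x) * g1 x \<noteq> 0" using g h by simp
  qed
qed

lemma regular_C3_cong:
  assumes "regular_C3 D h" "open D" "\<And>x. x \<in> D \<Longrightarrow> f x = h x"
  shows "regular_C3 D f"
proof -
  obtain h1 h2 h3 where h: "\<forall>x\<in>D. (h has_real_derivative h1 x) (at x) \<and>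
     (h1 has_real_derivative h2 x) (at x) \<and> (h2 has_real_derivative h3 x) (at x) \<and> h1 x \<noteq> 0"
    using assms(1) unfolding regular_C3_def by blast
  then have "(f has_real_derivative h1 x) (at x)" if "x \<in> D" for x
    using has_field_derivative_transform_within_open[OF _ assms(2) that, of h "h1 x" f] assms(3) that by auto
  then show ?thesis using h unfolding regular_C3_def by blast
qed

text \<open>\<open>negative_schwarzian\<close> speaks of iterated \<open>deriv\<close>; on an open
  interval these agree with the witnesses of \<open>regular_C3\<close>. Monotonicity gives the first
  derivative its sign.\<close>

lemma cross_ratio_expand_if_negative_schwarzian:
  assumes S: "negative_schwarzian F" and C3: "regular_C3 {lo<..<hi} F"
    and mono: "\<And>x y. x \<le> y \<Longrightarrow> F x \<le> F y" and cont: "continuous_on UNIV F"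
    and ord: "lo \<le> p" "p < q" "q < r" "r < t" "t \<le> hi"
  shows "cross_ratio p q r t \<le> cross_ratio (F p) (F q) (F r) (F t)"
proof -
  obtain h1 h2 h3 where h: "\<And>x. x \<in> {lo<..<hi} \<Longrightarrow> (F has_real_derivative h1 x) (at x)"
     "\<And>x. x \<in> {lo<..<hi} \<Longrightarrow> (h1 has_real_derivative h2 x) (at x)"
     "\<And>x. x \<in> {lo<..<hi} \<Longrightarrow> (h2 has_real_derivative h3 x) (at x)"
     "\<And>x. x \<in> {lo<..<hi} \<Longrightarrow> h1 x \<noteq> 0"
    using C3 unfolding regular_C3_def by blast
  have pos: "0 < h1 x" if "x \<in> {lo<..<hi}" for x
  proof -
    have "0 \<le> h1 x"
    proof (rule tendsto_lowerbound)
      show "((\<lambda>y. (F y - F x) / (y - x)) \<longlongrightarrow> h1 x) (at x)"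
        using h(1)[OF that] by (simp add: has_field_derivative_iff)
      have "0 \<le> (F y - F x) / (y - x)" for y
        using mono[of x y] mono[of y x] by (cases "x \<le> y") (auto simp: divide_nonpos_nonpos)
      then show "eventually (\<lambda>y. 0 \<le> (F y - F x) / (y - x)) (at x)" by simp
    qed simp
    then show ?thesis using h(4)[OF that] by simp
  qed
  have d1: "deriv F x = h1 x" if "x \<in> {lo<..<hi}" for x using h(1)[OF that] by (rule DERIV_imp_deriv)
  have D2: "(deriv F has_real_derivative h2 x) (at x)" if "x \<in> {lo<..<hi}" for x
    by (rule has_field_derivative_transform_within_open[OF h(2)[OF that] _ that]) (auto simp: d1)
  have d2: "deriv (deriv F) x = h2 x" if "x \<in> {lo<..<hi}" for x using D2[OF that] by (rule DERIV_imp_deriv)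
  have D3: "(deriv (deriv F) has_real_derivative h3 x) (at x)" if "x \<in> {lo<..<hi}" for x
    by (rule has_field_derivative_transform_within_open[OF h(3)[OF that] _ that]) (auto simp: d2)
  have d3: "deriv (deriv (deriv F)) x = h3 x" if "x \<in> {lo<..<hi}" for x using D3[OF that] by (rule DERIV_imp_deriv)
  have S': "h3 x / h1 x - 3 / 2 * (h2 x / h1 x)\<^sup>2 < 0" if x: "x \<in> {lo<..<hi}" for x
  proof -
    have "((deriv ^^ k) F) differentiable (at x)" if "k < 3" for k
    proof -
      have "k = 0 \<or> k = 1 \<or> k = 2" using that by auto
      then show ?thesis using h(1)[OF x] D2[OF x] D3[OF x]
        by (auto simp: real_differentiable_def eval_nat_numeral)
    qed
    moreover have "deriv F x \<noteq> 0" using pos[OF x] d1[OF x] by simp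
    ultimately have "(deriv ^^ 3) F x / deriv F x - 3 / 2 * ((deriv ^^ 2) F x / deriv F x)\<^sup>2 < 0"
      using S unfolding negative_schwarzian_def by blast
    moreover have "(deriv ^^ 2) F x = h2 x" "(deriv ^^ 3) F x = h3 x"
      using d2[OF x] d3[OF x] by (simp_all add: eval_nat_numeral)
    ultimately show ?thesis by (simp only: d1[OF x])
  qed
  have sub: "x \<in> {lo<..<hi}" if "p < x" "x < t" for x using that ord by auto
  show ?thesis
  proof (rule cross_ratio_expand[OF ord(2-4), of F h1])
    show "convex_on {p<..<t} (\<lambda>t. 1 / sqrt (h1 t))"
      by (rule convex_inverse_sqrt_derivative[of p t h1 h2 h3]) (use h S' pos sub in blast)+
    show "continuous_on {p..t} F" by (rule continuous_on_subset[OF cont]) simp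
  qed (use h(1) pos sub in blast)+
qed

lemma power_like_germ_powr: "linear_germ v \<Longrightarrow> power_like l (\<lambda>t. v t powr l)"
  by (rule power_like_germ[OF power_like_powr])

lemma germ_diffeo_0_compose: "orientation_preserving_C3_diffeo \<phi> \<Longrightarrow> linear_germ v \<Longrightarrow> linear_germ (\<lambda>t. \<phi> (v t))"
  by (rule germ_compose[OF germ_diffeo_0])

lemma germ_diffeo_1_compose:
  "orientation_preserving_C3_diffeo \<phi> \<Longrightarrow> linear_germ v \<Longrightarrow> linear_germ (\<lambda>t. 1 - \<phi> (1 - v t))"
  by (rule germ_compose[OF germ_diffeo_1])

lemma germ_powr_up_compose:
  "0 < y \<Longrightarrow> 0 < l \<Longrightarrow> linear_germ v \<Longrightarrow> linear_germ (\<lambda>t. (y + v t) powr l - y powr l)"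
  by (rule germ_compose[OF germ_powr_up])

lemma germ_powr_down_compose:
  "0 < l \<Longrightarrow> linear_germ v \<Longrightarrow> linear_germ (\<lambda>t. 1 - (1 - v t) powr l)"
  using germ_compose[OF germ_powr_down[of 1 l]] by simp

lemma regular_C3_outer: "regular_C3 D g \<Longrightarrow> c \<noteq> 0 \<Longrightarrow> regular_C3 D (\<lambda>x. c * g x + b)"
  by (rule regular_C3_compose[OF regular_C3_affine, where D' = UNIV]) auto

section \<open>Rotation number and displacement of iterates\<close>

lemma golden_irrational:
  assumes "0 < n" shows "real n * golden \<noteq> of_int k"
proof
  assume eq: "real n * golden = of_int k"
  obtain m where m: "golden ^ m < 1 / real n"
    using real_arch_pow_inv[of "1 / real n" golden] golden_bounds assms by auto
  \<comment> \<open>This integer is \<open>n\<close> times the error of a convergent: nonzero, yet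
    smaller than \<open>1\<close> in absolute value.\<close>
  define z :: int where "z = int (qseq m) * k - int n * pseq m"
  have "of_int z = real n * (real (qseq m) * golden - of_int (pseq m))"
    unfolding z_def by (simp add: algebra_simps flip: eq)
  also have "\<dots> = real n * ((- 1) ^ m * golden ^ (m + 1))" by (simp only: convergent_error)
  finally have "real_of_int \<bar>z\<bar> = real n * golden ^ (m + 1)"
    using golden_bounds by (simp add: abs_mult power_abs)
  moreover have "0 < real n * golden ^ (m + 1)" using assms golden_bounds by simp
  moreover have "real n * golden ^ (m + 1) < 1"
  proof -
    have "golden ^ (m + 1) \<le> golden ^ m" using golden_bounds by (intro power_decreasing) auto
    then have "golden ^ (m + 1) < 1 / real n" using m by linarith
    then show ?thesis using assms by (simp add: pos_less_divide_eq mult.commute)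
  qed
  ultimately have "0 < real_of_int \<bar>z\<bar>" "real_of_int \<bar>z\<bar> < 1" by linarith+
  then have "0 < \<bar>z\<bar>" "\<bar>z\<bar> < 1" by linarith+
  then show False by linarith
qed

text \<open>Displacements of an iterate at different points differ by at most \<open>L\<close>, so
  the averages form a Cauchy sequence. A weak inequality at one point iterates along multiples of
  \<open>n\<close> and passes to the limit; irrationality of \<open>golden\<close> makes it
  strict.\<close>

lemma rotation_number_sign:
  fixes F :: "real \<Rightarrow> real" and L :: real
  assumes L: "0 < L" and mono: "\<And>x y. x \<le> y \<Longrightarrow> F x \<le> F y" and shift: "\<And>x. F (x + L) = F x + L"
    and F0: "0 \<le> F 0" "F 0 \<le> L"
    and rho: "frac (lim (\<lambda>n. ((F ^^ n) 0 - 0) / (real n * L))) = golden"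
    and n: "0 < n"
  shows "(F ^^ n) x < x + of_int k * L \<longleftrightarrow> real n * golden < of_int k" "(F ^^ n) x \<noteq> x + of_int k * L"
proof -
  have shift_int: "F (x + of_int k * L) = F x + of_int k * L" for x and k :: int
  proof (induction k rule: int_induct[where k = 0])
    case (step1 i)
    then show ?case using shift[of "x + of_int i * L"] by (simp add: algebra_simps)
  next
    case (step2 i)
    then show ?case using shift[of "x + of_int (i - 1) * L"] by (simp add: algebra_simps)
  qed simp
  have Fn_shift: "(F ^^ n) (x + of_int k * L) = (F ^^ n) x + of_int k * L" for n x and k :: int
    by (induction n) (auto simp: shift_int)
  have Fn_mono: "x \<le> y \<Longrightarrow> (F ^^ n) x \<le> (F ^^ n) y" for n x y
    by (induction n) (auto intro: mono)
  define a where "a n = (F ^^ n) 0" for n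
  have near: "\<bar>((F ^^ n) x - x) - a n\<bar> \<le> L" for n x
  proof -
    define k where "k = \<lfloor>x / L\<rfloor>"
    define y where "y = x - of_int k * L"
    have "of_int k \<le> x / L" "x / L < of_int k + 1" by (auto simp: k_def)
    then have y: "0 \<le> y" "y \<le> L" using L by (auto simp: y_def field_simps)
    have "(F ^^ n) x = (F ^^ n) y + of_int k * L" using Fn_shift[of n y k] by (simp add: y_def)
    moreover have "a n \<le> (F ^^ n) y" "(F ^^ n) y \<le> a n + L"
      using Fn_mono[OF y(1), of n] Fn_mono[OF y(2), of n] Fn_shift[of n 0 1] by (simp_all add: a_def)
    ultimately show ?thesis using y by (simp add: y_def abs_le_iff)
  qed
  have add: "\<bar>a (n + m) - (a n + a m)\<bar> \<le> L" for n m
    using near[of n "a m"] by (simp add: a_def funpow_add)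
  have mult: "\<bar>a (n * m) - real n * a m\<bar> \<le> real n * L" for n m
  proof (induction n)
    case 0
    then show ?case by (simp add: a_def)
  next
    case (Suc n)
    then show ?case using add[of m "n * m"] by (simp add: algebra_simps abs_le_iff)
  qed
  define b where "b n = a n / (real n * L)" for n
  have b_mult: "\<bar>b (n * m) - b m\<bar> \<le> 1 / real m" if "0 < n" "0 < m" for n m
  proof -
    have "b (n * m) - b m = (a (n * m) - real n * a m) / (real n * real m * L)"
      using that L by (simp add: b_def field_simps)
    then have "\<bar>b (n * m) - b m\<bar> = \<bar>a (n * m) - real n * a m\<bar> / (real n * real m * L)"
      using that L by (simp add: abs_mult)
    also have "\<dots> \<le> (real n * L) / (real n * real m * L)"
      using mult[of n m] that L by (intro divide_right_mono) auto
    also have "\<dots> = 1 / real m" using that L by simp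
    finally show ?thesis .
  qed
  have b_diff: "\<bar>b n - b m\<bar> \<le> 1 / real n + 1 / real m" if "0 < n" "0 < m" for n m
    using b_mult[of n m] b_mult[of m n] that by (simp add: mult.commute)
  have "Cauchy b"
  proof (rule metric_CauchyI)
    fix e :: real assume e: "0 < e"
    obtain M where M: "0 < M" "2 / e < real M" using reals_Archimedean2[of "max 1 (2 / e)"] by (metis less_max_iff_disj max.strict_boundedE max_less_iff_conj of_nat_0_less_iff zero_less_one less_trans)
    have "dist (b m) (b n) < e" if "M \<le> m" "M \<le> n" for m n
    proof -
      have "\<bar>b m - b n\<bar> \<le> 1 / real m + 1 / real n" using b_diff[of m n] that M by auto
      also have "\<dots> \<le> 1 / real M + 1 / real M" using that M by (intro add_mono divide_left_mono) auto
      also have "\<dots> < e" using M e by (simp add: field_simps)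
      finally show ?thesis by (simp add: dist_real_def)
    qed
    then show "\<exists>M. \<forall>m\<ge>M. \<forall>n\<ge>M. dist (b m) (b n) < e" by blast
  qed
  then obtain \<rho> where \<rho>: "b \<longlonglongrightarrow> \<rho>" using Cauchy_convergent convergent_def by blast
  have b_\<rho>: "\<bar>b n - \<rho>\<bar> \<le> 1 / real n" if "0 < n" for n
  proof (rule LIMSEQ_le)
    show "(\<lambda>m. \<bar>b n - b m\<bar>) \<longlonglongrightarrow> \<bar>b n - \<rho>\<bar>" by (intro tendsto_intros \<rho>)
    have "(\<lambda>m. 1 / real n + 1 / real m) \<longlonglongrightarrow> 1 / real n + 0" by (intro tendsto_intros lim_1_over_n)
    then show "(\<lambda>m. 1 / real n + 1 / real m) \<longlonglongrightarrow> 1 / real n" by simp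
    show "\<exists>N. \<forall>m\<ge>N. \<bar>b n - b m\<bar> \<le> 1 / real n + 1 / real m"
      using b_diff that by (intro exI[of _ 1]) auto
  qed
  have a_nonneg: "0 \<le> a n" and a_le: "a n \<le> real n * L" for n
  proof -
    show "0 \<le> a n"
    proof (induction n)
      case (Suc n)
      then show ?case using mono[OF Suc] F0 by (simp add: a_def)
    qed (simp add: a_def)
    show "a n \<le> real n * L"
    proof (induction n)
      case (Suc n)
      have "a (Suc n) \<le> F (real n * L)" using mono[OF Suc] by (simp add: a_def)
      also have "\<dots> = F 0 + real n * L" using shift_int[of 0 "int n"] by simp
      finally show ?case using F0 by (simp add: algebra_simps)
    qed (simp add: a_def)
  qed
  \<comment> \<open>The rotation number is known only modulo \<open>1\<close>. The position of
    \<open>F 0\<close> puts the limit into \<open>{0..1}\<close>, and the value \<open>1\<close>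
    would have fractional part \<open>0\<close>.\<close>
  have "0 \<le> \<rho>" by (rule LIMSEQ_le_const[OF \<rho>]) (use a_nonneg L in \<open>auto simp: b_def\<close>)
  moreover have "b n \<le> 1" for n using a_le[of n] L by (cases "n = 0") (simp_all add: b_def)
  then have "\<rho> \<le> 1" by (intro LIMSEQ_le_const2[OF \<rho>]) auto
  moreover have "frac \<rho> = golden"
  proof -
    have "b = (\<lambda>n. ((F ^^ n) 0 - 0) / (real n * L))" by (simp add: b_def a_def fun_eq_iff)
    then show ?thesis using rho limI[OF \<rho>] by simp
  qed
  ultimately have \<rho>_eq: "\<rho> = golden"
    using golden_bounds frac_eq[of \<rho>] by (cases "\<rho> = 1") auto
  have le: "real n * golden \<le> of_int k" if *: "(F ^^ n) x \<le> x + of_int k * L" for x and k :: int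
  proof (rule ccontr)
    assume "\<not> real n * golden \<le> of_int k"
    then have pos: "0 < real n * golden - of_int k" by simp
    obtain m where m: "0 < m" "2 / (real n * golden - of_int k) < real m"
      using reals_Archimedean2[of "2 / (real n * golden - of_int k)"] pos by (metis divide_pos_pos less_trans of_nat_0_less_iff zero_less_numeral)
    have it: "(F ^^ (j * n)) x \<le> x + of_int (int j * k) * L" for j
    proof (induction j)
      case (Suc j)
      have "(F ^^ (Suc j * n)) x = (F ^^ n) ((F ^^ (j * n)) x)" by (simp add: funpow_add)
      also have "\<dots> \<le> (F ^^ n) (x + of_int (int j * k) * L)" by (rule Fn_mono[OF Suc])
      also have "\<dots> = (F ^^ n) x + of_int (int j * k) * L" by (rule Fn_shift)
      also have "\<dots> \<le> x + of_int (int (Suc j) * k) * L" using * by (simp add: algebra_simps)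
      finally show ?case .
    qed simp
    have "a (m * n) \<le> real m * of_int k * L + L"
      using near[of "m * n" x] it[of m] by (simp add: abs_le_iff)
    then have "a (m * n) \<le> (real m * of_int k + 1) * L" by (simp add: algebra_simps)
    then have "b (m * n) \<le> ((real m * of_int k + 1) * L) / (real (m * n) * L)"
      unfolding b_def using L by (intro divide_right_mono) auto
    also have "\<dots> = (real m * of_int k + 1) / real (m * n)" using L by simp
    finally have "golden - 1 / real (m * n) \<le> (real m * of_int k + 1) / real (m * n)"
      using b_\<rho>[of "m * n"] m n \<rho>_eq by (simp add: abs_le_iff)
    then have "golden \<le> (real m * of_int k + 2) / (real m * real n)"
      by (simp add: add_divide_distrib)
    then have "real m * (real n * golden - of_int k) \<le> 2" using m n by (simp add: field_simps)
    then show False using m pos by (simp add: field_simps)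
  qed
  have ge: "of_int k \<le> real n * golden" if *: "x + of_int k * L \<le> (F ^^ n) x" for x and k :: int
  proof (rule ccontr)
    assume "\<not> of_int k \<le> real n * golden"
    then have pos: "0 < of_int k - real n * golden" by simp
    obtain m where m: "0 < m" "2 / (of_int k - real n * golden) < real m"
      using reals_Archimedean2[of "2 / (of_int k - real n * golden)"] pos by (metis divide_pos_pos less_trans of_nat_0_less_iff zero_less_numeral)
    have it: "x + of_int (int j * k) * L \<le> (F ^^ (j * n)) x" for j
    proof (induction j)
      case (Suc j)
      have "x + of_int (int (Suc j) * k) * L \<le> (F ^^ n) x + of_int (int j * k) * L" using * by (simp add: algebra_simps)
      also have "\<dots> = (F ^^ n) (x + of_int (int j * k) * L)" by (rule Fn_shift[symmetric])
      also have "\<dots> \<le> (F ^^ n) ((F ^^ (j * n)) x)" by (rule Fn_mono[OF Suc])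
      also have "\<dots> = (F ^^ (Suc j * n)) x" by (simp add: funpow_add)
      finally show ?case .
    qed simp
    have "real m * of_int k * L - L \<le> a (m * n)"
      using near[of "m * n" x] it[of m] by (simp add: abs_le_iff)
    then have "(real m * of_int k - 1) * L \<le> a (m * n)" by (simp add: algebra_simps)
    then have "((real m * of_int k - 1) * L) / (real (m * n) * L) \<le> b (m * n)"
      unfolding b_def using L by (intro divide_right_mono) auto
    moreover have "((real m * of_int k - 1) * L) / (real (m * n) * L) = (real m * of_int k - 1) / real (m * n)" using L by simp
    ultimately have "(real m * of_int k - 1) / real (m * n) \<le> golden + 1 / real (m * n)"
      using b_\<rho>[of "m * n"] m n \<rho>_eq by (simp add: abs_le_iff)
    then have "(real m * of_int k - 2) / (real m * real n) \<le> golden"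
      by (simp add: diff_divide_distrib)
    then have "real m * (of_int k - real n * golden) \<le> 2" using m n by (simp add: field_simps)
    then show False using m pos by (simp add: field_simps)
  qed
  show "(F ^^ n) x < x + of_int k * L \<longleftrightarrow> real n * golden < of_int k"
    using le[of x k] ge[of x k] golden_irrational[OF n, of k] by fastforce
  show "(F ^^ n) x \<noteq> x + of_int k * L"
    using le[of x k] ge[of x k] golden_irrational[OF n, of k] by fastforce
qed

section \<open>Increasing Lipschitz branches\<close>

definition increasing_Lipschitz :: "(real \<Rightarrow> real) \<Rightarrow> real \<Rightarrow> real \<Rightarrow> bool" where
  "increasing_Lipschitz h a b \<longleftrightarrow> (\<exists>K\<ge>0. \<forall>x y. a \<le> x \<and> x < y \<and> y \<le> b \<longrightarrow> h x < h y \<and> h y - h x \<le> K * (y - x))"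

lemma increasing_Lipschitz_affine: "0 < c \<Longrightarrow> increasing_Lipschitz (\<lambda>x. c * x + d) a b"
  unfolding increasing_Lipschitz_def by (intro exI[of _ c]) (auto simp: algebra_simps)

lemma increasing_Lipschitz_powr: "1 \<le> l \<Longrightarrow> increasing_Lipschitz (\<lambda>x. x powr l) 0 1"
  unfolding increasing_Lipschitz_def
proof (intro exI[of _ l] conjI allI impI)
  fix x y :: real assume l: "1 \<le> l" and "0 \<le> x \<and> x < y \<and> y \<le> 1"
  then have xy: "0 \<le> x" "x < y" "y \<le> 1" by auto
  show "x powr l < y powr l" using l xy by (intro powr_less_mono2) auto
  have der: "((\<lambda>x. x powr l) has_real_derivative l * z powr (l - 1)) (at z)" if "x < z" for z
    using DERIV_fun_powr[OF DERIV_ident, of z l] that xy by simp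
  have "\<exists>d z. x < z \<and> z < y \<and> ((\<lambda>x. x powr l) has_real_derivative d) (at z) \<and> y powr l - x powr l = (y - x) * d"
  proof (rule MVT[OF xy(2)])
    show "continuous_on {x..y} (\<lambda>x. x powr l)" using l xy by (intro continuous_on_powr' continuous_intros) auto
    show "(\<lambda>x. x powr l) differentiable (at z)" if "x < z" for z
      using der[OF that] by (auto simp: real_differentiable_def)
  qed
  then obtain d z where z: "x < z" "z < y" "((\<lambda>x. x powr l) has_real_derivative d) (at z)" "y powr l - x powr l = (y - x) * d" by blast
  have d: "d = l * z powr (l - 1)" by (rule DERIV_unique[OF z(3) der[OF z(1)]])
  have "z powr (l - 1) \<le> 1" using l z xy by (intro powr_le1) auto
  then have "d \<le> l" using d l by (simp add: mult_le_cancel_left1)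
  then have "(y - x) * d \<le> (y - x) * l" using xy by (intro mult_left_mono) auto
  then show "y powr l - x powr l \<le> l * (y - x)" unfolding z(4) by (simp add: mult.commute)
qed simp

lemma increasing_Lipschitz_diffeo:
  assumes "orientation_preserving_C3_diffeo \<phi>" shows "increasing_Lipschitz \<phi> 0 1"
proof -
  obtain B where B: "0 < B" "\<And>x y. 0 \<le> x \<Longrightarrow> x \<le> y \<Longrightarrow> y \<le> 1 \<Longrightarrow> 0 \<le> \<phi> y - \<phi> x \<and> \<phi> y - \<phi> x \<le> B * (y - x)"
    using diffeo_Lipschitz[OF assms] by metis
  then show ?thesis unfolding increasing_Lipschitz_def
    by (intro exI[of _ B]) (auto intro: diffeo_ends(4)[OF assms])
qed

lemma increasing_Lipschitz_compose:
  assumes h: "increasing_Lipschitz h c d" and g: "increasing_Lipschitz g a b"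
    and range: "\<And>x. a \<le> x \<Longrightarrow> x \<le> b \<Longrightarrow> c \<le> g x \<and> g x \<le> d"
  shows "increasing_Lipschitz (\<lambda>x. h (g x)) a b"
proof -
  obtain K where K: "0 \<le> K" "\<And>x y. c \<le> x \<Longrightarrow> x < y \<Longrightarrow> y \<le> d \<Longrightarrow> h x < h y \<and> h y - h x \<le> K * (y - x)"
    using h unfolding increasing_Lipschitz_def by blast
  obtain M where M: "0 \<le> M" "\<And>x y. a \<le> x \<Longrightarrow> x < y \<Longrightarrow> y \<le> b \<Longrightarrow> g x < g y \<and> g y - g x \<le> M * (y - x)"
    using g unfolding increasing_Lipschitz_def by blast
  have "h (g x) < h (g y) \<and> h (g y) - h (g x) \<le> K * M * (y - x)" if "a \<le> x" "x < y" "y \<le> b" for x y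
  proof -
    have 1: "g x < g y" "g y - g x \<le> M * (y - x)" using M(2)[OF that] by auto
    have 2: "h (g x) < h (g y)" "h (g y) - h (g x) \<le> K * (g y - g x)"
      using K(2)[OF _ 1(1)] range[of x] range[of y] that by auto
    have "K * (g y - g x) \<le> K * (M * (y - x))" using 1 K by (intro mult_left_mono) auto
    then show ?thesis using 2 by (simp add: mult.assoc)
  qed
  then show ?thesis unfolding increasing_Lipschitz_def using K M by (intro exI[of _ "K * M"]) auto
qed

lemma increasing_Lipschitz_flip:
  "increasing_Lipschitz h a b \<Longrightarrow> increasing_Lipschitz (\<lambda>x. - h (- x)) (- b) (- a)"
proof -
  assume "increasing_Lipschitz h a b"
  then obtain K where K: "0 \<le> K" "\<And>x y. a \<le> x \<Longrightarrow> x < y \<Longrightarrow> y \<le> b \<Longrightarrow> h x < h y \<and> h y - h x \<le> K * (y - x)"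
    unfolding increasing_Lipschitz_def by blast
  have "- h (- x) < - h (- y) \<and> - h (- y) - - h (- x) \<le> K * (y - x)" if "- b \<le> x" "x < y" "y \<le> - a" for x y
    using K(2)[of "- y" "- x"] that by auto
  then show ?thesis unfolding increasing_Lipschitz_def using K(1) by blast
qed

lemma increasing_Lipschitz_cong:
  "increasing_Lipschitz h a b \<Longrightarrow> (\<And>x. a \<le> x \<Longrightarrow> x \<le> b \<Longrightarrow> f x = h x) \<Longrightarrow> increasing_Lipschitz f a b"
  unfolding increasing_Lipschitz_def by (metis less_imp_le order_trans)

lemma increasing_Lipschitz_join:
  assumes "increasing_Lipschitz h a b" "increasing_Lipschitz h b c"
  shows "increasing_Lipschitz h a c"
proof -
  obtain K where K: "0 \<le> K" "\<And>x y. a \<le> x \<Longrightarrow> x < y \<Longrightarrow> y \<le> b \<Longrightarrow> h x < h y \<and> h y - h x \<le> K * (y - x)"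
    using assms(1) unfolding increasing_Lipschitz_def by blast
  obtain M where M: "0 \<le> M" "\<And>x y. b \<le> x \<Longrightarrow> x < y \<Longrightarrow> y \<le> c \<Longrightarrow> h x < h y \<and> h y - h x \<le> M * (y - x)"
    using assms(2) unfolding increasing_Lipschitz_def by blast
  have "h x < h y \<and> h y - h x \<le> max K M * (y - x)" if xy: "a \<le> x" "x < y" "y \<le> c" for x y
  proof -
    have up: "h x < h y \<and> h y - h x \<le> max K M * (y - x)" if "h x < h y \<and> h y - h x \<le> R * (y - x)" "R \<le> max K M" "x < y" for x y R
    proof -
      have "R * (y - x) \<le> max K M * (y - x)" using that by (intro mult_right_mono) auto
      then show ?thesis using that by linarith
    qed
    consider "y \<le> b" | "b \<le> x" | "x < b" "b < y" by linarith
    then show ?thesis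
    proof cases
      case 1
      then show ?thesis using up[of x y K] K(2) xy by auto
    next
      case 2
      then show ?thesis using up[of x y M] M(2) xy by auto
    next
      case 3
      have "h x < h b \<and> h b - h x \<le> max K M * (b - x)" using up[of x b K] K(2) xy 3 by auto
      moreover have "h b < h y \<and> h y - h b \<le> max K M * (y - b)" using up[of b y M] M(2) xy 3 by auto
      ultimately show ?thesis by (auto simp: algebra_simps)
    qed
  qed
  then show ?thesis unfolding increasing_Lipschitz_def using K(1) by (intro exI[of _ "max K M"]) auto
qed

lemma increasing_Lipschitz_outer:
  "increasing_Lipschitz h a b \<Longrightarrow> 0 < c \<Longrightarrow> increasing_Lipschitz (\<lambda>x. c * h x + d) a b"
proof -
  assume "increasing_Lipschitz h a b" and c: "0 < c"
  then obtain K where K: "0 \<le> K" "\<And>x y. a \<le> x \<Longrightarrow> x < y \<Longrightarrow> y \<le> b \<Longrightarrow> h x < h y \<and> h y - h x \<le> K * (y - x)"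
    unfolding increasing_Lipschitz_def by blast
  have "c * h x + d < c * h y + d \<and> (c * h y + d) - (c * h x + d) \<le> c * K * (y - x)"
    if "a \<le> x" "x < y" "y \<le> b" for x y
  proof -
    have "c * (h y - h x) \<le> c * (K * (y - x))" using K(2)[OF that] c by (intro mult_left_mono) auto
    then show ?thesis using K(2)[OF that] c by (simp add: algebra_simps)
  qed
  then show ?thesis unfolding increasing_Lipschitz_def using K(1) c by (intro exI[of _ "c * K"]) auto
qed

lemma increasing_Lipschitz_diffeo_affine:
  assumes "orientation_preserving_C3_diffeo \<phi>" "0 < c" "0 \<le> c * a + d" "c * b + d \<le> 1"
  shows "increasing_Lipschitz (\<lambda>x. \<phi> (c * x + d)) a b"
proof (rule increasing_Lipschitz_compose[OF increasing_Lipschitz_diffeo[OF assms(1)] increasing_Lipschitz_affine[OF assms(2)]])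
  fix x assume "a \<le> x" "x \<le> b"
  then have "c * a \<le> c * x" "c * x \<le> c * b" using assms(2) by auto
  then show "0 \<le> c * x + d \<and> c * x + d \<le> 1" using assms by linarith
qed

section \<open>The lift of a Fibonacci map\<close>

locale fibonacci_map =
  fixes l1 l2 :: real and f :: flat_tuple
  assumes exps: "1 < l1" "l1 < 2" "1 < l2" "l2 < 2"
    and fib: "f \<in> fibonacci_class l1 l2"
begin

abbreviation x1 :: real where "x1 \<equiv> pt1 f"
abbreviation x2 :: real where "x2 \<equiv> pt2 f"
abbreviation x3 :: real where "x3 \<equiv> pt3 f"
abbreviation x4 :: real where "x4 \<equiv> pt4 f"
abbreviation L :: real where "L \<equiv> circle_length f"
abbreviation F :: "real \<Rightarrow> real" where "F \<equiv> lift_map l1 l2 f"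
abbreviation c :: "real \<Rightarrow> real" where "c \<equiv> circle_map l1 l2 f"
abbreviation s :: real where "s \<equiv> spar f"

lemma in_class: "x1 < 0" "0 < x3" "x3 < x4" "x4 < 1" "0 < x2" "x2 < 1" "0 < s" "s < 1"
    "orientation_preserving_C3_diffeo (phi f)" "orientation_preserving_C3_diffeo (phil f)"
    "orientation_preserving_C3_diffeo (phir f)"
  and rho: "rotation_number l1 l2 f = golden" and schwarz: "negative_schwarzian F"
  using fib by (auto simp: fibonacci_class_def flat_class_def)

lemma L_eq: "L = 1 - x1" by (simp add: circle_length_def)
lemma L_gt: "1 < L" using in_class by (simp add: L_eq)

definition q :: real where "q = 1 / (1 - s powr l2)"

lemma s_powr: "0 < s powr l2" "s powr l2 < 1" and q_pos: "0 < q"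
proof -
  show "0 < s powr l2" using in_class by simp
  show "s powr l2 < 1" using powr_less_mono2[of l2 s 1] in_class exps by simp
  then show "0 < q" by (simp add: q_def)
qed

lemma qmap_eq: "qmap l2 s y = q * (((1 - s) * y + s) powr l2 - s powr l2)"
  by (simp add: qmap_def q_def)

lemma q_one: "q * (1 - s powr l2) = 1" using s_powr by (simp add: q_def)

lemma lift_shift: "F (x + L) = F x + L"
proof -
  have "(x + L - x1) / L = (x - x1) / L + 1" using L_gt by (simp add: divide_simps)
  then have fl: "real_of_int \<lfloor>(x + L - x1) / L\<rfloor> = real_of_int \<lfloor>(x - x1) / L\<rfloor> + 1" by simp
  define k where "k = real_of_int \<lfloor>(x - x1) / L\<rfloor>"
  have "x + L - (k + 1) * L = x - k * L" by (simp add: algebra_simps)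
  then show ?thesis unfolding lift_map_def fl Let_def k_def[symmetric] by (simp add: algebra_simps)
qed

lemma lift_base: "x1 \<le> x \<Longrightarrow> x < 1 \<Longrightarrow> F x = c x + (if x < 0 then 0 else L)"
proof -
  assume "x1 \<le> x" "x < 1"
  then have "0 \<le> (x - x1) / L" "(x - x1) / L < 1" using L_gt by (auto simp: L_eq)
  then have "\<lfloor>(x - x1) / L\<rfloor> = 0" by (simp add: floor_eq_iff)
  then show ?thesis by (simp add: lift_map_def Let_def)
qed

text \<open>This and the following formulas are stated on closed branches: with the added turn,
  adjacent branches agree at their common endpoint, whence continuity of the lift.\<close>

lemma F_left: "x1 \<le> x \<Longrightarrow> x \<le> 0 \<Longrightarrow>
    F x = (1 - x2) * (q * (((1 - s) * phi f (1 - x / x1) + s) powr l2 - s powr l2)) + x2"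
proof (cases "x = 0")
  case True
  then show ?thesis using lift_base[of 0] in_class diffeo_ends(2)[OF in_class(9)] q_one
    by (simp add: circle_map_def L_eq)
next
  case False
  assume x: "x1 \<le> x" "x \<le> 0"
  have "(x1 - x) / x1 = 1 - x / x1" using in_class by (simp add: diff_divide_distrib)
  then show ?thesis using lift_base[of x] x False in_class
    by (simp add: circle_map_def qmap_eq)
qed

lemma F_mid: "0 \<le> x \<Longrightarrow> x \<le> x3 \<Longrightarrow> F x = L + x1 * phil f (1 - x / x3) powr l1"
proof (cases "x = 0")
  case True
  then show ?thesis using lift_base[of 0] in_class diffeo_ends(2)[OF in_class(10)]
    by (simp add: circle_map_def)
next
  case False
  assume x: "0 \<le> x" "x \<le> x3"
  have "(x3 - x) / x3 = 1 - x / x3" using in_class by (simp add: diff_divide_distrib)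
  then show ?thesis using lift_base[of x] x False in_class by (simp add: circle_map_def)
qed

lemma F_flat: "x3 \<le> x \<Longrightarrow> x \<le> x4 \<Longrightarrow> F x = L"
proof (cases "x = x3")
  case True
  then show ?thesis using F_mid[of x3] in_class diffeo_ends(1)[OF in_class(10)] by simp
next
  case False
  assume x: "x3 \<le> x" "x \<le> x4"
  then show ?thesis using lift_base[of x] False in_class by (simp add: circle_map_def)
qed

lemma F_right: "x4 \<le> x \<Longrightarrow> x \<le> 1 \<Longrightarrow> F x = L + x2 * phir f ((x - x4) / (1 - x4)) powr l2"
proof -
  assume x: "x4 \<le> x" "x \<le> 1"
  consider "x = x4" | "x = 1" | "x4 < x" "x < 1" using x by linarith
  then show ?thesis
  proof cases
    case 1
    then show ?thesis using F_flat[of x4] in_class diffeo_ends(1)[OF in_class(11)] by simp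
  next
    case 2
    have "F 1 = F x1 + L" using lift_shift[of x1] by (simp add: L_eq)
    then show ?thesis using 2 F_left[of x1] in_class diffeo_ends(1)[OF in_class(9)] diffeo_ends(2)[OF in_class(11)] by simp
  next
    case 3
    then show ?thesis using lift_base[of x] in_class by (simp add: circle_map_def)
  qed
qed

lemma F_0: "F 0 = 1" and F_1: "F 1 = L + x2"
  using F_mid[of 0] F_right[of 1] in_class diffeo_ends(2)[OF in_class(10)] diffeo_ends(2)[OF in_class(11)] by (simp_all add: L_eq)

lemma increasing_left: "increasing_Lipschitz F x1 0"
proof (rule increasing_Lipschitz_cong)
  let ?u = "\<lambda>x. phi f ((- 1 / x1) * x + 1)"
  have il: "increasing_Lipschitz ?u x1 0"
    using in_class by (intro increasing_Lipschitz_diffeo_affine) (auto simp: divide_simps)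
  have range: "0 \<le> ?u x \<and> ?u x \<le> 1" if "x1 \<le> x" "x \<le> 0" for x
    by (rule diffeo_ends(3)[OF in_class(9)]) (use that in_class in \<open>auto simp: divide_simps\<close>)
  have "increasing_Lipschitz (\<lambda>x. ((1 - s) * ?u x + s) powr l2) x1 0"
  proof (rule increasing_Lipschitz_compose[OF increasing_Lipschitz_powr increasing_Lipschitz_outer[OF il]])
    show "0 \<le> (1 - s) * ?u x + s \<and> (1 - s) * ?u x + s \<le> 1" if "x1 \<le> x" "x \<le> 0" for x
    proof -
      have "(1 - s) * ?u x \<le> (1 - s) * 1" "0 \<le> (1 - s) * ?u x"
        using range[OF that] in_class(7,8) by (auto intro!: mult_left_mono mult_nonneg_nonneg simp del: mult_1_right)
      moreover have "(1 - s) * 1 = 1 - s" by simp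
      ultimately show ?thesis using in_class(7) by linarith
    qed
  qed (use exps in_class in auto)
  then show "increasing_Lipschitz (\<lambda>x. ((1 - x2) * q) * ((1 - s) * ?u x + s) powr l2 + (x2 - (1 - x2) * q * s powr l2)) x1 0"
    by (rule increasing_Lipschitz_outer) (use in_class q_pos in simp)
  show "F x = ((1 - x2) * q) * ((1 - s) * ?u x + s) powr l2 + (x2 - (1 - x2) * q * s powr l2)" if "x1 \<le> x" "x \<le> 0" for x
  proof -
    have "(- 1 / x1) * x + 1 = 1 - x / x1" by simp
    then show ?thesis using F_left[OF that] by (simp only:) (simp add: algebra_simps)
  qed
qed

lemma increasing_mid: "increasing_Lipschitz F 0 x3"
proof (rule increasing_Lipschitz_cong)
  let ?u = "\<lambda>x. phil f ((1 / x3) * x + 1)"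
  have il: "increasing_Lipschitz ?u (- x3) 0"
    using in_class by (intro increasing_Lipschitz_diffeo_affine) (auto simp: divide_simps)
  have "increasing_Lipschitz (\<lambda>x. ?u x powr l1) (- x3) 0"
  proof (rule increasing_Lipschitz_compose[OF increasing_Lipschitz_powr il])
    show "0 \<le> ?u x \<and> ?u x \<le> 1" if "- x3 \<le> x" "x \<le> 0" for x
      by (rule diffeo_ends(3)[OF in_class(10)]) (use that in_class in \<open>auto simp: divide_simps\<close>)
  qed (use exps in auto)
  then have "increasing_Lipschitz (\<lambda>x. (- x1) * ?u x powr l1 + (- L)) (- x3) 0"
    by (rule increasing_Lipschitz_outer) (use in_class in simp)
  from increasing_Lipschitz_flip[OF this]
  show "increasing_Lipschitz (\<lambda>x. - ((- x1) * ?u (- x) powr l1 + (- L))) 0 x3" by simp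
  show "F x = - ((- x1) * ?u (- x) powr l1 + (- L))" if "0 \<le> x" "x \<le> x3" for x
    using F_mid[OF that] by (simp add: algebra_simps)
qed

lemma increasing_right: "increasing_Lipschitz F x4 1"
proof (rule increasing_Lipschitz_cong)
  let ?u = "\<lambda>x. phir f ((1 / (1 - x4)) * x + (- x4 / (1 - x4)))"
  have u: "(1 / (1 - x4)) * x + (- x4 / (1 - x4)) = (x - x4) / (1 - x4)" for x
    by (simp add: diff_divide_distrib)
  have il: "increasing_Lipschitz ?u x4 1"
    by (rule increasing_Lipschitz_diffeo_affine[OF in_class(11)]) (unfold u, use in_class in auto)
  have "increasing_Lipschitz (\<lambda>x. ?u x powr l2) x4 1"
  proof (rule increasing_Lipschitz_compose[OF increasing_Lipschitz_powr il])
    show "0 \<le> ?u x \<and> ?u x \<le> 1" if "x4 \<le> x" "x \<le> 1" for x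
      unfolding u by (rule diffeo_ends(3)[OF in_class(11)]) (use that in_class in \<open>auto simp: divide_simps\<close>)
  qed (use exps in auto)
  then show "increasing_Lipschitz (\<lambda>x. x2 * ?u x powr l2 + L) x4 1"
    by (rule increasing_Lipschitz_outer) (use in_class in simp)
  show "F x = x2 * ?u x powr l2 + L" if "x4 \<le> x" "x \<le> 1" for x
    using F_right[OF that] unfolding u by simp
qed

lemma lift_shift_int: "F (x + of_int k * L) = F x + of_int k * L"
proof (induction k rule: int_induct[where k = 0])
  case (step1 i)
  then show ?case using lift_shift[of "x + of_int i * L"] by (simp add: algebra_simps)
next
  case (step2 i)
  then show ?case using lift_shift[of "x + of_int (i - 1) * L"] by (simp add: algebra_simps)
qed simp

text \<open>The branches on \<open>{x1..x3}\<close>, moved by one turn, continue the one on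
  \<open>{x4..1}\<close>; together they cover a period outside the flat piece.\<close>

lemma increasing_main: "increasing_Lipschitz F x4 (x3 + L)"
proof -
  have "increasing_Lipschitz F x1 x3" by (rule increasing_Lipschitz_join[OF increasing_left increasing_mid])
  then obtain K where K: "0 \<le> K" "\<And>x y. x1 \<le> x \<Longrightarrow> x < y \<Longrightarrow> y \<le> x3 \<Longrightarrow> F x < F y \<and> F y - F x \<le> K * (y - x)"
    unfolding increasing_Lipschitz_def by blast
  have "F x < F y \<and> F y - F x \<le> K * (y - x)" if "1 \<le> x" "x < y" "y \<le> x3 + L" for x y
    using K(2)[of "x - L" "y - L"] that lift_shift[of "x - L"] lift_shift[of "y - L"] by (simp add: L_eq)
  then have "increasing_Lipschitz F 1 (x3 + L)" unfolding increasing_Lipschitz_def using K(1) by blast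
  with increasing_right show ?thesis by (rule increasing_Lipschitz_join)
qed

lemma reduce_mod: obtains k :: int where "u \<le> x - of_int k * L" "x - of_int k * L < u + L"
proof
  show "u \<le> x - of_int \<lfloor>(x - u) / L\<rfloor> * L" "x - of_int \<lfloor>(x - u) / L\<rfloor> * L < u + L"
    using floor_divide_lower[of L "x - u"] floor_divide_upper[of L "x - u"] L_gt by (auto simp: algebra_simps)
qed

lemma lift_Lipschitz: "\<exists>K\<ge>0. \<forall>x y. x \<le> y \<and> y \<le> x + L \<longrightarrow> F x \<le> F y \<and> F y - F x \<le> K * (y - x)"
proof -
  obtain K where K: "0 \<le> K" "\<And>x y. x4 \<le> x \<Longrightarrow> x < y \<Longrightarrow> y \<le> x3 + L \<Longrightarrow> F x < F y \<and> F y - F x \<le> K * (y - x)"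
    using increasing_main unfolding increasing_Lipschitz_def by blast
  define P where "P a b \<longleftrightarrow> (\<forall>x y. a \<le> x \<and> x \<le> y \<and> y \<le> b \<longrightarrow> F x \<le> F y \<and> F y - F x \<le> K * (y - x))" for a b
  have join: "P a d" if "P a b" "P b d" for a b d
    unfolding P_def
  proof (intro allI impI)
    fix x y assume xy: "a \<le> x \<and> x \<le> y \<and> y \<le> d"
    consider "y \<le> b" | "b \<le> x" | "x < b" "b < y" by linarith
    then show "F x \<le> F y \<and> F y - F x \<le> K * (y - x)"
    proof cases
      case 3
      have "F x \<le> F b \<and> F b - F x \<le> K * (b - x)" "F b \<le> F y \<and> F y - F b \<le> K * (y - b)"
        using that xy 3 unfolding P_def by auto
      then show ?thesis by (auto simp: algebra_simps)
    qed (use that xy in \<open>auto simp: P_def\<close>)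
  qed
  have "P x3 x4" unfolding P_def using F_flat K(1) by auto
  moreover have "P x4 (x3 + L)" unfolding P_def
  proof (intro allI impI)
    fix x y assume "x4 \<le> x \<and> x \<le> y \<and> y \<le> x3 + L"
    then show "F x \<le> F y \<and> F y - F x \<le> K * (y - x)"
      using K(2)[of x y] K(1) by (cases "x = y") (auto simp: less_imp_le)
  qed
  ultimately have P1: "P x3 (x3 + L)" by (rule join)
  have "P (x3 + L) (x3 + L + L)" unfolding P_def
  proof (intro allI impI)
    fix x y assume "x3 + L \<le> x \<and> x \<le> y \<and> y \<le> x3 + L + L"
    then have "F (x - L) \<le> F (y - L) \<and> F (y - L) - F (x - L) \<le> K * ((y - L) - (x - L))"
      using P1[unfolded P_def, rule_format, of "x - L" "y - L"] by linarith
    then show "F x \<le> F y \<and> F y - F x \<le> K * (y - x)"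
      using lift_shift[of "x - L"] lift_shift[of "y - L"] by simp
  qed
  with P1 have P2: "P x3 (x3 + L + L)" by (rule join)
  \<comment> \<open>An interval of length at most \<open>L\<close> can be moved to start in the
    period beginning at \<open>x3\<close>, so two consecutive periods suffice.\<close>
  show ?thesis
  proof (intro exI[of _ K] conjI allI impI K(1))
    fix x y assume xy: "x \<le> y \<and> y \<le> x + L"
    obtain k :: int where k: "x3 \<le> x - of_int k * L" "x - of_int k * L < x3 + L" by (rule reduce_mod)
    have "F (x - of_int k * L) \<le> F (y - of_int k * L) \<and>
        F (y - of_int k * L) - F (x - of_int k * L) \<le> K * ((y - of_int k * L) - (x - of_int k * L))"
      using P2[unfolded P_def, rule_format, of "x - of_int k * L" "y - of_int k * L"] k xy by linarith
    moreover have "F (z - of_int k * L) = F z - of_int k * L" for z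
      using lift_shift_int[of z "- k"] by simp
    ultimately show "F x \<le> F y" "F y - F x \<le> K * (y - x)" by auto
  qed
qed

lemma lift_mono: "x \<le> y \<Longrightarrow> F x \<le> F y"
proof -
  assume xy: "x \<le> y"
  obtain k :: int where k: "x \<le> y - of_int k * L" "y - of_int k * L < x + L" by (rule reduce_mod)
  have "F x \<le> F (y - of_int k * L)" using lift_Lipschitz k by (meson less_imp_le)
  also have "\<dots> = F y - of_int k * L" using lift_shift_int[of y "- k"] by simp
  also have "\<dots> \<le> F y"
  proof -
    have "0 < (of_int k + 1) * L" using xy k L_gt by (simp add: algebra_simps)
    then have "0 < of_int k + (1::real)" using L_gt by (simp add: zero_less_mult_iff)
    then have "0 \<le> k" by linarith
    then show ?thesis using L_gt by simp
  qed
  finally show ?thesis .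
qed

lemma lift_cont: "continuous_on UNIV F"
proof (rule continuous_onI)
  obtain K where K: "0 \<le> K" "\<And>x y. x \<le> y \<Longrightarrow> y \<le> x + L \<Longrightarrow> F x \<le> F y \<and> F y - F x \<le> K * (y - x)"
    using lift_Lipschitz by blast
  fix x e :: real assume e: "0 < e"
  define d where "d = min L (e / (K + 1))"
  have d: "0 < d" "d \<le> L" using e K L_gt by (auto simp: d_def)
  have "dist (F y) (F x) \<le> e" if "dist y x < d" for y
  proof -
    have "\<bar>F y - F x\<bar> \<le> K * \<bar>y - x\<bar>"
      using K(2)[of x y] K(2)[of y x] that d by (cases "x \<le> y") (auto simp: dist_real_def)
    also have "\<dots> \<le> (K + 1) * (e / (K + 1))"
      using that K by (intro mult_mono) (auto simp: dist_real_def d_def)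
    also have "\<dots> = e" using K by simp
    finally show ?thesis by (simp add: dist_real_def)
  qed
  then show "\<exists>d>0. \<forall>y\<in>UNIV. dist y x < d \<longrightarrow> dist (F y) (F x) \<le> e" using d by blast
qed

lemma lift_flat:
  assumes xy: "x < y" "F x = F y"
  shows "\<exists>k::int. x3 + of_int k * L \<le> x \<and> y \<le> x4 + of_int k * L"
proof -
  obtain k :: int where k: "x3 \<le> x - of_int k * L" "x - of_int k * L < x3 + L" by (rule reduce_mod)
  define u v where "u = x - of_int k * L" "v = y - of_int k * L"
  have uv: "u < v" "x3 \<le> u" "u < x3 + L" using xy k by (auto simp: u_v_def)
  have "F (z - of_int k * L) = F z - of_int k * L" for z using lift_shift_int[of z "- k"] by simp
  then have Fuv: "F u = F v" using xy by (simp add: u_v_def)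
  have strict: "F a < F b" if "x4 \<le> a" "a < b" "b \<le> x3 + L" for a b
    using increasing_main that unfolding increasing_Lipschitz_def by blast
  have "v \<le> x4"
  proof (rule ccontr)
    assume v: "\<not> v \<le> x4"
    \<comment> \<open>Clipping to the strictly increasing part: if \<open>v\<close> lay beyond
      \<open>x4\<close>, then \<open>F\<close> would already increase from \<open>a\<close> to
      \<open>b\<close>.\<close>
    define a b where "a = max u x4" "b = min v (x3 + L)"
    have ab: "F a < F b" using v uv in_class L_gt by (intro strict) (auto simp: a_b_def)
    have "F a = F u" using F_flat[of u] F_flat[of x4] uv in_class by (auto simp: a_b_def max_def)
    moreover have "F b \<le> F v" by (rule lift_mono) (simp add: a_b_def)
    ultimately show False using ab Fuv by simp
  qed
  then show ?thesis using uv by (intro exI[of _ k]) (auto simp: u_v_def)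
qed

lemma rot:
  assumes "0 < n"
  shows "(F ^^ n) x < x + of_int k * L \<longleftrightarrow> real n * golden < of_int k" "(F ^^ n) x \<noteq> x + of_int k * L"
  by (rule rotation_number_sign[of L F n, OF _ lift_mono lift_shift _ _ _ assms];
      use L_gt F_0 in_class rho in \<open>simp add: rotation_number_def\<close>)+

section \<open>Smoothness of the branches and local laws at the special points\<close>

lemma regular_left: "regular_C3 {x1<..<0} F"
proof (rule regular_C3_cong)
  let ?u = "\<lambda>x. phi f ((- 1 / x1) * x + 1)"
  have "regular_C3 {x1<..<0} ?u"
    by (rule regular_C3_compose[OF regular_C3_diffeo[OF in_class(9)] regular_C3_affine])
       (use in_class in \<open>auto simp: divide_simps\<close>)
  moreover have "0 < ?u x" if "x \<in> {x1<..<0}" for x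
    using diffeo_ends(4)[OF in_class(9), of 0 "(- 1 / x1) * x + 1"] diffeo_ends(1)[OF in_class(9)] that in_class
    by (auto simp: divide_simps)
  ultimately have "regular_C3 {x1<..<0} (\<lambda>x. ((1 - s) * ?u x + s) powr l2)"
    using in_class exps
    by (intro regular_C3_compose[OF regular_C3_powr] regular_C3_compose[OF regular_C3_affine, where D' = UNIV])
       (auto intro!: add_pos_pos mult_pos_pos)
  then show "regular_C3 {x1<..<0} (\<lambda>x. ((1 - x2) * q) * ((1 - s) * ?u x + s) powr l2 + (x2 - (1 - x2) * q * s powr l2))"
    by (rule regular_C3_outer) (use in_class q_pos in auto)
  show "F x = ((1 - x2) * q) * ((1 - s) * ?u x + s) powr l2 + (x2 - (1 - x2) * q * s powr l2)" if "x \<in> {x1<..<0}" for x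
  proof -
    have "(- 1 / x1) * x + 1 = 1 - x / x1" by simp
    then show ?thesis using F_left[of x] that by (simp only:) (simp add: algebra_simps)
  qed
qed simp

lemma regular_mid: "regular_C3 {0<..<x3} F"
proof (rule regular_C3_cong)
  let ?u = "\<lambda>x. phil f ((- 1 / x3) * x + 1)"
  have "regular_C3 {0<..<x3} ?u"
    by (rule regular_C3_compose[OF regular_C3_diffeo[OF in_class(10)] regular_C3_affine])
       (use in_class in \<open>auto simp: divide_simps\<close>)
  moreover have "0 < ?u x" if "x \<in> {0<..<x3}" for x
    using diffeo_ends(4)[OF in_class(10), of 0 "(- 1 / x3) * x + 1"] diffeo_ends(1)[OF in_class(10)] that in_class
    by (auto simp: divide_simps)
  ultimately have "regular_C3 {0<..<x3} (\<lambda>x. ?u x powr l1)"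
    using exps by (intro regular_C3_compose[OF regular_C3_powr]) auto
  then show "regular_C3 {0<..<x3} (\<lambda>x. x1 * ?u x powr l1 + L)"
    by (rule regular_C3_outer) (use in_class in auto)
  show "F x = x1 * ?u x powr l1 + L" if "x \<in> {0<..<x3}" for x
    using F_mid[of x] that by simp
qed simp

lemma regular_right: "regular_C3 {x4<..<1} F"
proof (rule regular_C3_cong)
  let ?u = "\<lambda>x. phir f ((1 / (1 - x4)) * x + (- x4 / (1 - x4)))"
  have u: "(1 / (1 - x4)) * x + (- x4 / (1 - x4)) = (x - x4) / (1 - x4)" for x
    by (simp add: diff_divide_distrib)
  have "regular_C3 {x4<..<1} ?u"
    by (rule regular_C3_compose[OF regular_C3_diffeo[OF in_class(11)] regular_C3_affine])
       (unfold u, use in_class in \<open>auto simp: divide_simps\<close>)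
  moreover have "0 < ?u x" if "x \<in> {x4<..<1}" for x
    unfolding u using diffeo_ends(4)[OF in_class(11), of 0 "(x - x4) / (1 - x4)"] diffeo_ends(1)[OF in_class(11)] that in_class
    by (auto simp: divide_simps)
  ultimately have "regular_C3 {x4<..<1} (\<lambda>x. ?u x powr l2)"
    using exps by (intro regular_C3_compose[OF regular_C3_powr]) auto
  then show "regular_C3 {x4<..<1} (\<lambda>x. x2 * ?u x powr l2 + L)"
    by (rule regular_C3_outer) (use in_class in auto)
  show "F x = x2 * ?u x powr l2 + L" if "x \<in> {x4<..<1}" for x
    using F_right[of x] that unfolding u by simp
qed simp

text \<open>Translated so that \<open>q'\<close> falls into one period, an interval without excluded
  points lies in a single smooth branch.\<close>

lemma lift_cross:
  assumes ord: "p < q'" "q' < r" "r < t"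
    and reg: "\<And>x k::int. p < x \<Longrightarrow> x < t \<Longrightarrow> x \<noteq> of_int k * L \<and> x \<noteq> x1 + of_int k * L \<and>
      \<not> (x3 + of_int k * L \<le> x \<and> x \<le> x4 + of_int k * L)"
  shows "cross_ratio p q' r t \<le> cross_ratio (F p) (F q') (F r) (F t)"
proof -
  obtain k :: int where k: "x1 \<le> q' - of_int k * L" "q' - of_int k * L < x1 + L" by (rule reduce_mod)
  define d where "d = of_int k * L"
  have no: "\<not> (p - d < z \<and> z < t - d)" if "z = x1 \<or> z = 0 \<or> z = 1 \<or> z = x3 \<or> z = x4" for z
  proof
    assume "p - d < z \<and> z < t - d"
    then have z: "p < z + d" "z + d < t" by auto
    have "1 + d = x1 + of_int (k + 1) * L" by (simp add: d_def L_eq algebra_simps)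
    then show False using reg[OF z, of k] reg[OF z, of "k + 1"] that in_class by (auto simp: d_def)
  qed
  have flat: "\<not> (x3 \<le> q' - d \<and> q' - d \<le> x4)" using reg[of q' k] ord by (auto simp: d_def)
  have "\<exists>lo hi. regular_C3 {lo<..<hi} F \<and> lo \<le> p - d \<and> t - d \<le> hi"
  proof -
    consider "x1 \<le> q' - d" "q' - d \<le> 0" | "0 \<le> q' - d" "q' - d \<le> x3" | "x4 \<le> q' - d" "q' - d < 1"
      using k flat by (fastforce simp: d_def L_eq)
    then show ?thesis
    proof cases
      case 1
      then show ?thesis using no[of x1] no[of 0] no[of "q' - d"] ord
        by (intro exI[of _ x1] exI[of _ 0] conjI regular_left) auto
    next
      case 2
      then show ?thesis using no[of x3] no[of 0] no[of "q' - d"] ord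
        by (intro exI[of _ 0] exI[of _ x3] conjI regular_mid) auto
    next
      case 3
      then show ?thesis using no[of x4] no[of 1] no[of "q' - d"] ord
        by (intro exI[of _ x4] exI[of _ 1] conjI regular_right) auto
    qed
  qed
  then obtain lo hi where lh: "regular_C3 {lo<..<hi} F" "lo \<le> p - d" "t - d \<le> hi" by blast
  have "cross_ratio (p - d) (q' - d) (r - d) (t - d) \<le> cross_ratio (F (p - d)) (F (q' - d)) (F (r - d)) (F (t - d))"
    by (rule cross_ratio_expand_if_negative_schwarzian[OF schwarz lh(1) lift_mono lift_cont]) (use lh ord in auto)
  moreover have "F (z - d) = F z - d" for z using lift_shift_int[of z "- k"] by (simp add: d_def)
  moreover have "cross_ratio (a - d) (b - d) (u - d) (v - d) = cross_ratio a b u v" for a b u v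
    using cross_ratio_affine[of 1 a "- d"] by simp
  ultimately show ?thesis by simp
qed

lemma pow_right: "power_like l2 (\<lambda>t. F (x4 + t) - L)"
proof (rule power_like_cong)
  show "power_like l2 (\<lambda>t. x2 * phir f ((1 / (1 - x4)) * t) powr l2)"
    by (rule power_like_cmult, rule power_like_germ_powr, rule germ_diffeo_0_compose, rule in_class(11), rule germ_scale)
       (use in_class in simp_all)
  show "0 < 1 - x4" using in_class by simp
  show "F (x4 + t) - L = x2 * phir f ((1 / (1 - x4)) * t) powr l2" if "0 < t" "t < 1 - x4" for t
    using F_right[of "x4 + t"] that by simp
qed

lemma pow_left: "power_like l1 (\<lambda>t. L - F (x3 - t))"
proof (rule power_like_cong)
  show "power_like l1 (\<lambda>t. (- x1) * phil f ((1 / x3) * t) powr l1)"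
    by (rule power_like_cmult, rule power_like_germ_powr, rule germ_diffeo_0_compose, rule in_class(10), rule germ_scale)
       (use in_class in simp_all)
  show "0 < x3" using in_class by simp
  show "L - F (x3 - t) = (- x1) * phil f ((1 / x3) * t) powr l1" if "0 < t" "t < x3" for t
  proof -
    have "1 - (x3 - t) / x3 = (1 / x3) * t" using in_class by (simp add: diff_divide_distrib)
    then show ?thesis using F_mid[of "x3 - t"] that by simp
  qed
qed

text \<open>Right of \<open>0\<close> the middle branch has \<open>phil\<close> near
  \<open>1\<close>, far from its critical point, and leads to the right of \<open>x1\<close>. There
  the left branch is smooth with positive slope because \<open>0 < s\<close>.\<close>

lemma pow0_right: "power_like 1 (\<lambda>t. F (F t) - F (F 0))"
proof (rule power_like_cong)
  let ?v = "\<lambda>t. 1 - (1 - (1 - phil f (1 - (1 / x3) * t))) powr l1"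
  let ?w = "\<lambda>t. (s + (1 - s) * phi f (?v t)) powr l2 - s powr l2"
  have v: "linear_germ ?v"
    by (rule germ_powr_down_compose, use exps in simp, rule germ_diffeo_1_compose, rule in_class(10), rule germ_scale)
       (use in_class in simp)
  have "linear_germ ?w"
    by (rule germ_powr_up_compose, rule in_class(7), use exps in simp, rule germ_cmult,
        rule germ_diffeo_0_compose, rule in_class(9), rule v) (use in_class in simp)
  then show "power_like 1 (\<lambda>t. (1 - x2) * q * ?w t)"
    using in_class q_pos unfolding linear_germ_def by (intro power_like_cmult) auto
  show "0 < x3" using in_class by simp
  fix t assume t: "0 < t" "t < x3"
  define P where "P = phil f (1 - t / x3) powr l1"
  have "0 \<le> phil f (1 - t / x3) \<and> phil f (1 - t / x3) \<le> 1"
    by (rule diffeo_ends(3)[OF in_class(10)]) (use t in auto)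
  then have P: "0 \<le> P" "P \<le> 1" using exps by (auto simp: P_def powr_le1)
  have "F t = x1 * P + L" using F_mid[of t] t by (simp add: P_def)
  then have "F (F t) = F (x1 * P) + L" using lift_shift by simp
  moreover have "F (x1 * P) = (1 - x2) * (q * (((1 - s) * phi f (1 - P) + s) powr l2 - s powr l2)) + x2"
  proof -
    have "x1 * 1 \<le> x1 * P" "x1 * P \<le> 0" using P in_class(1) by (auto intro: mult_left_mono_neg mult_nonpos_nonneg)
    then show ?thesis using F_left[of "x1 * P"] in_class by simp
  qed
  moreover have "F (F 0) = x2 + L" by (simp add: F_0 F_1)
  ultimately show "F (F t) - F (F 0) = (1 - x2) * q * ?w t"
    by (simp add: P_def add.commute)
qed

text \<open>Left of \<open>0\<close> the left branch has \<open>phi\<close> near \<open>1\<close>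
  and leads to \<open>1 - W t\<close>, just below \<open>1\<close>, where the right branch has
  \<open>phir\<close> near \<open>1\<close>. The radius \<open>d\<close> keeps this point in the
  right branch.\<close>

lemma pow0_left: "power_like 1 (\<lambda>t. F (F 0) - F (F (- t)))"
proof -
  let ?v = "\<lambda>t. (1 - s) * (1 - phi f (1 - (1 / (- x1)) * t))"
  define W where "W t = (1 - x2) * q * (1 - (1 - ?v t) powr l2)" for t
  let ?w = "\<lambda>t. 1 - (1 - (1 - phir f (1 - (1 / (1 - x4)) * W t))) powr l2"
  have W: "linear_germ W" unfolding W_def[abs_def]
    by (rule germ_cmult, rule germ_powr_down_compose, use exps in simp, rule germ_cmult,
        rule germ_diffeo_1_compose, rule in_class(9), rule germ_scale) (use in_class q_pos in simp_all)
  have "linear_germ ?w"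
    by (rule germ_powr_down_compose, use exps in simp, rule germ_diffeo_1_compose, rule in_class(11),
        rule germ_cmult, rule W) (use in_class in simp)
  then have pl: "power_like 1 (\<lambda>t. x2 * ?w t)"
    using in_class unfolding linear_germ_def by (intro power_like_cmult) auto
  have "eventually (\<lambda>t. W t < 1 - x4) (at_right 0)"
    using W in_class unfolding linear_germ_def by (intro order_tendstoD(2)) auto
  moreover have "eventually (\<lambda>t. 0 < W t) (at_right 0)"
    using W unfolding linear_germ_def by (blast intro: power_like_eventually_pos)
  ultimately have "eventually (\<lambda>t. 0 < W t \<and> W t < 1 - x4) (at_right 0)"
    by eventually_elim simp
  then obtain d where d: "0 < d" "\<And>t. 0 < t \<Longrightarrow> t < d \<Longrightarrow> 0 < W t \<and> W t < 1 - x4"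
    by (auto simp: eventually_at_right_field)
  show ?thesis
  proof (rule power_like_cong[OF pl])
    show "0 < min d (- x1)" using d in_class by simp
    fix t assume "0 < t" "t < min d (- x1)"
    then have t: "0 < t" "t < d" "t < - x1" by auto
    have "F (- t) = (1 - x2) * (q * (((1 - s) * phi f (1 - (1 / (- x1)) * t) + s) powr l2 - s powr l2)) + x2"
      using F_left[of "- t"] t by simp
    also have "(1 - s) * phi f (1 - (1 / (- x1)) * t) + s = 1 - ?v t" by (simp add: algebra_simps)
    also have "(1 - x2) * (q * ((1 - ?v t) powr l2 - s powr l2)) + x2 = (1 - x2) * (q * (1 - s powr l2)) + x2 - W t"
      by (simp add: W_def algebra_simps)
    finally have Ft: "F (- t) = 1 - W t" unfolding q_one by simp
    have Wt: "0 < W t" "W t < 1 - x4" using d t by auto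
    have "(1 - W t - x4) / (1 - x4) = 1 - (1 / (1 - x4)) * W t" using in_class by (simp add: divide_simps)
    then have "F (1 - W t) = L + x2 * phir f (1 - (1 / (1 - x4)) * W t) powr l2"
      using F_right[of "1 - W t"] Wt by simp
    moreover have "F (F 0) = x2 + L" by (simp add: F_0 F_1)
    ultimately show "F (F 0) - F (F (- t)) = x2 * ?w t" by (simp add: Ft algebra_simps)
  qed
qed

lemma fibonacci_lift_F: "\<exists>K. fibonacci_lift F L x1 x3 x4 l1 l2 K"
proof -
  obtain K where K: "\<And>x y. x \<le> y \<Longrightarrow> y \<le> x + L \<Longrightarrow> F y - F x \<le> K * (y - x)"
    using lift_Lipschitz by blast
  have "fibonacci_lift F L x1 x3 x4 l1 l2 K"
  proof
    show "F 0 = x1 + L" by (simp add: F_0 L_eq)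
    show "x4 < x1 + L" using in_class by (simp add: L_eq)
    show "F x = L" if "x3 \<le> x" "x \<le> x4" for x by (rule F_flat[OF that])
    show "\<exists>k::int. x3 + of_int k * L \<le> x \<and> y \<le> x4 + of_int k * L" if "x < y" "F x = F y" for x y
      by (rule lift_flat[OF that])
    show "cross_ratio p q r t \<le> cross_ratio (F p) (F q) (F r) (F t)"
      if "p < q" "q < r" "r < t" "\<And>x k::int. p < x \<Longrightarrow> x < t \<Longrightarrow> x \<noteq> of_int k * L \<and> x \<noteq> x1 + of_int k * L \<and>
        \<not> (x3 + of_int k * L \<le> x \<and> x \<le> x4 + of_int k * L)" for p q r t
      by (rule lift_cross[OF that])
  qed (fact in_class lift_cont lift_shift exps pow_right pow_left pow0_right pow0_left | rule lift_mono rot K; assumption)+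
  then show ?thesis by blast
qed

section \<open>The scaling ratios of a Fibonacci map\<close>

lemma circle_map_lift: "x1 \<le> x \<Longrightarrow> x \<le> 1 \<Longrightarrow> x1 \<le> c x \<and> c x \<le> 1 \<and> (\<exists>k::int. F x = c x + of_int k * L)"
proof -
  assume x: "x1 \<le> x" "x \<le> 1"
  consider "x < 0" | "0 \<le> x" "x < 1" | "x = 1" using x by linarith
  then show ?thesis
  proof cases
    case 1
    have "F x = c x" using lift_base[of x] x 1 by simp
    moreover have "F x1 = x2" using lift_shift[of x1] F_1 by (simp add: L_eq)
    moreover have "F x1 \<le> F x" "F x \<le> F 0" using x 1 by (auto intro: lift_mono)
    ultimately show ?thesis using F_0 in_class by (auto intro!: exI[of _ 0])
  next
    case 2
    have "F x = c x + L" using lift_base[of x] x 2 by simp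
    moreover have "F 0 \<le> F x" "F x \<le> F 1" using x 2 by (auto intro: lift_mono)
    ultimately show ?thesis using F_0 F_1 in_class by (auto simp: L_eq intro!: exI[of _ 1])
  next
    case 3
    have "c x = x2" using 3 in_class diffeo_ends(2)[OF in_class(11)] by (simp add: circle_map_def)
    then show ?thesis using F_1 3 in_class by (auto intro!: exI[of _ 1])
  qed
qed

lemma circle_map_funpow:
  "x1 \<le> x \<Longrightarrow> x \<le> 1 \<Longrightarrow> x1 \<le> (c ^^ n) x \<and> (c ^^ n) x \<le> 1 \<and> (\<exists>k::int. (F ^^ n) x = (c ^^ n) x + of_int k * L)"
proof (induction n)
  case (Suc n)
  then obtain k :: int where k: "x1 \<le> (c ^^ n) x" "(c ^^ n) x \<le> 1" "(F ^^ n) x = (c ^^ n) x + of_int k * L" by blast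
  obtain j :: int where j: "F ((c ^^ n) x) = c ((c ^^ n) x) + of_int j * L"
    using circle_map_lift[OF k(1,2)] by blast
  have "(F ^^ Suc n) x = (c ^^ Suc n) x + of_int (j + k) * L"
    using j lift_shift_int[of "(c ^^ n) x" k] by (simp add: k(3) algebra_simps)
  moreover have "x1 \<le> (c ^^ Suc n) x" "(c ^^ Suc n) x \<le> 1" using circle_map_lift[OF k(1,2)] by simp_all
  ultimately show ?case by blast
qed (auto intro!: exI[of _ 0])

lemma flat_iterate_preimage:
  "flat_iterate l1 l2 f (- int (qseq n)) =
    {x \<in> {x1..1}. \<exists>m::int. x3 + of_int m * L < (F ^^ qseq n) x \<and> (F ^^ qseq n) x < x4 + of_int m * L}"
proof -
  have "(c ^^ qseq n) x \<in> flat_piece f \<longleftrightarrow>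
      (\<exists>m::int. x3 + of_int m * L < (F ^^ qseq n) x \<and> (F ^^ qseq n) x < x4 + of_int m * L)"
    if x: "x1 \<le> x" "x \<le> 1" for x
  proof -
    obtain k :: int where k: "x1 \<le> (c ^^ qseq n) x" "(c ^^ qseq n) x \<le> 1" "(F ^^ qseq n) x = (c ^^ qseq n) x + of_int k * L"
      using circle_map_funpow[OF x, of "qseq n"] by blast
    show ?thesis
    proof
      assume "(c ^^ qseq n) x \<in> flat_piece f"
      then show "\<exists>m::int. x3 + of_int m * L < (F ^^ qseq n) x \<and> (F ^^ qseq n) x < x4 + of_int m * L"
        by (intro exI[of _ k]) (simp add: k(3) flat_piece_def)
    next
      assume "\<exists>m::int. x3 + of_int m * L < (F ^^ qseq n) x \<and> (F ^^ qseq n) x < x4 + of_int m * L"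
      then obtain m :: int where m: "x3 + of_int m * L < (F ^^ qseq n) x" "(F ^^ qseq n) x < x4 + of_int m * L" by blast
      have "of_int (m - k) * L < of_int 1 * L" "of_int (- 1) * L < of_int (m - k) * L"
        using m k in_class by (auto simp: algebra_simps L_eq)
      then have "m - k < 1" "- 1 < m - k"
        unfolding mult_less_cancel_right_pos[OF less_trans[OF zero_less_one L_gt]] of_int_less_iff .
      then have "m = k" by linarith
      then show "(c ^^ qseq n) x \<in> flat_piece f" using m k by (simp add: flat_piece_def)
    qed
  qed
  moreover have "- int (qseq n) < 0" using qseq_pos[of n] by linarith
  ultimately show ?thesis by (auto simp: flat_iterate_def)
qed

lemma flat_iterate_0: "flat_iterate l1 l2 f 0 = {x3<..<x4}"
  by (simp add: flat_iterate_def flat_piece_def)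

lemma endpoints_0: "endpoints (flat_iterate l1 l2 f 0) = {x3, x4}"
  using in_class by (simp add: flat_iterate_0 endpoints_def)

lemma gap_eq: "gap l1 l2 f (- int (qseq n)) 0 =
    Min ((\<lambda>(a, b). circle_dist f a b) ` (endpoints (flat_iterate l1 l2 f (- int (qseq n))) \<times> {x3, x4}))"
  unfolding gap_def endpoints_0 by (intro arg_cong[where f = Min]) auto

text \<open>\<open>comparable\<close> concerns all indices, including those not covered by the
  asymptotic description. The preimage lies in the closed set \<open>C\<close> of points that reach
  a translate of \<open>0\<close> at time \<open>qseq n + 1\<close>; neither edge belongs to
  \<open>C\<close>, so the gap is positive.\<close>

lemma scaling_ratio_bounds: "0 < scaling_ratio l1 l2 f n" "scaling_ratio l1 l2 f n < 1"
proof -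
  define A where "A = flat_iterate l1 l2 f (- int (qseq n))"
  obtain K where "fibonacci_lift F L x1 x3 x4 l1 l2 K" using fibonacci_lift_F by blast
  then interpret fl: fibonacci_lift F L x1 x3 x4 l1 l2 K .
  define C where "C = {x \<in> {x1..1}. (F ^^ (qseq n + 1)) x / L \<in> \<int>}"
  have "closed C"
  proof -
    have "closed ({x1..1} \<inter> (\<lambda>x. (F ^^ (qseq n + 1)) x / L) -` \<int>)"
      by (intro continuous_closed_preimage closed_Ints continuous_intros continuous_on_subset[OF fl.funpow_cont])
         (use L_gt in auto)
    then show ?thesis by (simp add: C_def Int_def vimage_def)
  qed
  have sub: "A \<subseteq> C"
  proof
    fix x assume "x \<in> A"
    then obtain m :: int where x: "x1 \<le> x" "x \<le> 1" and m: "x3 + of_int m * L < (F ^^ qseq n) x" "(F ^^ qseq n) x < x4 + of_int m * L"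
      unfolding A_def flat_iterate_preimage by auto
    have "F ((F ^^ qseq n) x) = L + of_int m * L"
      using lift_shift_int[of "(F ^^ qseq n) x - of_int m * L" m] F_flat[of "(F ^^ qseq n) x - of_int m * L"] m by simp
    then have "(F ^^ (qseq n + 1)) x / L = of_int (1 + m)" using L_gt by (simp add: add_divide_distrib)
    then show "x \<in> C" using x by (simp add: C_def)
  qed
  have edge: "x \<noteq> x3 \<and> x \<noteq> x4" if "x \<in> C" for x
  proof (rule ccontr)
    assume "\<not> (x \<noteq> x3 \<and> x \<noteq> x4)"
    then have "F x = 0 + of_int 1 * L" using F_flat[of x] in_class by auto
    then have "(F ^^ (qseq n + 1)) x = (F ^^ qseq n) 0 + of_int 1 * L"
      using fl.funpow_shift[of "qseq n" 0 1] by (simp add: funpow_swap1)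
    moreover have "(F ^^ (qseq n + 1)) x / L \<in> \<int>" using that unfolding C_def by blast
    then obtain k :: int where "(F ^^ (qseq n + 1)) x / L = of_int k" by (rule Ints_cases)
    ultimately have "(F ^^ qseq n) 0 = 0 + of_int (k - 1) * L" using L_gt by (simp add: field_simps)
    then show False using rot(2)[of "qseq n" 0 "k - 1"] qseq_pos[of n] by auto
  qed
  have ex: "\<exists>x\<in>A. \<exists>k::int. (F ^^ qseq n) x = y - of_int k * L" if y: "x3 < y" "y < x4" for y
  proof -
    obtain x where x: "(F ^^ qseq n) x = y" using fl.S_surj[of "qseq n" 0 y] by (auto simp: fl.S_def)
    obtain k :: int where k: "x1 \<le> x - of_int k * L" "x - of_int k * L < x1 + L" by (rule reduce_mod)
    have "(F ^^ qseq n) (x - of_int k * L) = y - of_int k * L"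
      using fl.funpow_shift[of "qseq n" x "- k"] x by simp
    moreover have "x - of_int k * L \<in> A"
      unfolding A_def flat_iterate_preimage using k y calculation
      by (auto simp: L_eq intro!: exI[of _ "- k"])
    ultimately show ?thesis by blast
  qed
  \<comment> \<open>Two values inside the flat piece have distinct preimages in \<open>A\<close>,
    which makes the length positive.\<close>
  define y1 y2 where "y1 = (2 * x3 + x4) / 3" "y2 = (x3 + 2 * x4) / 3"
  have y: "x3 < y1" "y1 < y2" "y2 < x4" using in_class by (auto simp: y1_y2_def)
  obtain a k b j where ab: "a \<in> A" "(F ^^ qseq n) a = y1 - of_int k * L" "b \<in> A" "(F ^^ qseq n) b = y2 - of_int j * L"
    using ex[of y1] ex[of y2] y by (metis less_trans)
  have "a \<noteq> b"
  proof
    assume "a = b"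
    then have *: "y2 - y1 = of_int (j - k) * L" using ab by (simp add: algebra_simps)
    have "0 < of_int (j - k) * L" "of_int (j - k) * L < L" using y in_class L_gt unfolding *[symmetric] by auto
    then have "0 < j - k" "j - k < 1" by (blast intro: fl.int_mult_bounds)+
    then show False by linarith
  qed
  have bdd: "bdd_above A" "bdd_below A" using sub by (auto simp: C_def intro!: bdd_aboveI[of _ 1] bdd_belowI[of _ x1])
  have len: "0 < interval_length A"
  proof -
    have "Inf A \<le> a" "Inf A \<le> b" "a \<le> Sup A" "b \<le> Sup A" using ab bdd by (auto intro: cInf_lower cSup_upper)
    then show ?thesis using \<open>a \<noteq> b\<close> by (auto simp: interval_length_def)
  qed
  have "Inf A \<in> C" "Sup A \<in> C"
    using sub bdd ab(1) \<open>closed C\<close> by (auto intro!: closed_subset_contains_Inf closed_subset_contains_Sup)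
  then have in_C: "x \<in> C" if "x \<in> endpoints A" for x using that by (auto simp: endpoints_def)
  have "0 < circle_dist f x y" if "x \<in> endpoints A" "y = x3 \<or> y = x4" for x y
    using in_C[OF that(1)] edge[OF in_C[OF that(1)]] that(2) in_class by (auto simp: circle_dist_def C_def L_eq)
  moreover have "gap l1 l2 f (- int (qseq n)) 0 \<in> (\<lambda>(a, b). circle_dist f a b) ` (endpoints A \<times> {x3, x4})"
    unfolding gap_eq A_def by (rule Min_in) (auto simp: endpoints_def)
  ultimately have "0 < gap l1 l2 f (- int (qseq n)) 0" by auto
  then show "0 < scaling_ratio l1 l2 f n" "scaling_ratio l1 l2 f n < 1"
    using len unfolding scaling_ratio_def half_closed_gap_def A_def by simp_all
qed

text \<open>The index is shifted because \<open>NN n\<close> and \<open>EE n\<close> bound the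
  preimage of index \<open>- qseq (n + 1)\<close>.\<close>

lemma scaling_ratio_asymptotics:
  "\<exists>w C n0. filterlim w at_top sequentially \<and>
    (\<forall>n\<ge>n0. ln (scaling_ratio l1 l2 f (n + 1)) = - w n \<and>
       \<bar>w (n + 2) - (if even n then 1 / l2 else 1 / l1) * (w (n + 1) + w n)\<bar> \<le> C)"
proof -
  obtain K where "fibonacci_lift F L x1 x3 x4 l1 l2 K" using fibonacci_lift_F by blast
  then interpret fl: fibonacci_lift F L x1 x3 x4 l1 l2 K .
  \<comment> \<open>Below this threshold no distance measured around the other side of the circle is
    shorter than \<open>tg n\<close>.\<close>
  have UL: "0 < (L - fl.U) / 2" using in_class by (simp add: fl.U_def L_eq)
  obtain n1 where n1: "\<And>n. n1 \<le> n \<Longrightarrow> fl.ta n < (L - fl.U) / 2" using fl.eventually_ta_less[OF UL] by blast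
  obtain C n2 where C: "\<And>n. n2 \<le> n \<Longrightarrow> \<bar>fl.w (n + 2) - (if even n then 1 / l2 else 1 / l1) * (fl.w (n + 1) + fl.w n)\<bar> \<le> C"
    using fl.w_recursion by blast
  have "ln (scaling_ratio l1 l2 f (n + 1)) = - fl.w n" if n: "n1 \<le> n" "1 \<le> n" for n
  proof -
    define lo hi where "lo = min (fl.NN n) (fl.EE n)" "hi = max (fl.NN n) (fl.EE n)"
    note pre = fl.T_preimage_flat[OF n(2), folded lo_hi_def]
    define A where "A = flat_iterate l1 l2 f (- int (qseq (n + 1)))"
    have T: "fl.T (n + 1) x = (F ^^ qseq (n + 1)) x - of_int (pseq (n + 1)) * L" for x
      by (simp add: fl.T_def fl.S_def)
    have A: "A = {lo<..<hi}"
    proof (intro set_eqI iffI)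
      fix x assume "x \<in> A"
      then obtain m :: int where x: "x1 \<le> x" "x \<le> 1" and m: "x3 + of_int m * L < (F ^^ qseq (n + 1)) x" "(F ^^ qseq (n + 1)) x < x4 + of_int m * L"
        unfolding A_def flat_iterate_preimage by auto
      define j where "j = m - pseq (n + 1)"
      have "fl.T (n + 1) (x - of_int j * L) = (F ^^ qseq (n + 1)) x - of_int m * L"
      proof -
        have "(F ^^ qseq (n + 1)) (x - of_int j * L) = (F ^^ qseq (n + 1)) x - of_int j * L"
          using fl.funpow_shift[of "qseq (n + 1)" x "- j"] by simp
        then show ?thesis unfolding T by (simp only: j_def of_int_diff left_diff_distrib)
      qed
      then have xj: "lo < x - of_int j * L" "x - of_int j * L < hi"
        using pre(3)[of "x - of_int j * L"] m by auto
      have "- L < of_int j * L" "of_int j * L < L" using xj pre(1,2) x L_eq by linarith+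
      then have "- 1 < j" "j < 1" by (blast intro: fl.int_mult_bounds)+
      then have "j = 0" by linarith
      then show "x \<in> {lo<..<hi}" using xj by simp
    next
      fix x assume x: "x \<in> {lo<..<hi}"
      then have "x3 < fl.T (n + 1) x \<and> fl.T (n + 1) x < x4" using pre(3)[of x] by simp
      then show "x \<in> A" unfolding A_def flat_iterate_preimage T using x pre(1,2)
        by (auto simp: L_eq intro!: exI[of _ "pseq (n + 1)"])
    qed
    note o = fl.tg_pos[of n] fl.tg_te[of n] fl.te_ta[of n] n1[OF n(1)] fl.U_pos
    have lohi: "lo < hi" using o fl.s_cases[of n] by (auto simp: lo_hi_def fl.NN_eq fl.EE_eq)
    have ends: "endpoints A = {fl.NN n, fl.EE n}" using lohi by (auto simp: endpoints_def A lo_hi_def)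
    have len: "interval_length A = fl.te n - fl.tg n"
      using lohi o fl.s_cases[of n] by (auto simp: interval_length_def A lo_hi_def fl.NN_eq fl.EE_eq)
    have gap: "gap l1 l2 f (- int (qseq (n + 1))) 0 = fl.tg n"
      unfolding gap_eq ends[unfolded A_def]
    proof (rule Min_eqI)
      have e: "{x3, x4} = {fl.edge n, fl.edge (Suc n)}" by (auto simp: fl.edge_def)
      have d: "\<bar>fl.NN n - fl.edge n\<bar> = fl.tg n" "\<bar>fl.EE n - fl.edge n\<bar> = fl.te n"
        "\<bar>fl.NN n - fl.edge (Suc n)\<bar> = fl.tg n + fl.U" "\<bar>fl.EE n - fl.edge (Suc n)\<bar> = fl.te n + fl.U"
        using o fl.s_cases[of n] fl.edge_diff[of n] by (auto simp: fl.NN_eq fl.EE_eq fl.U_def)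
      show "fl.tg n \<le> y" if "y \<in> (\<lambda>(a, b). circle_dist f a b) ` ({fl.NN n, fl.EE n} \<times> {x3, x4})" for y
        using that o unfolding e by (auto simp: circle_dist_def d)
      have "circle_dist f (fl.NN n) (fl.edge n) = fl.tg n" using o by (simp add: circle_dist_def d)
      then show "fl.tg n \<in> (\<lambda>(a, b). circle_dist f a b) ` ({fl.NN n, fl.EE n} \<times> {x3, x4})"
        unfolding e by (intro image_eqI[of _ _ "(fl.NN n, fl.edge n)"]) auto
    qed simp
    have "scaling_ratio l1 l2 f (n + 1) = fl.tg n / fl.te n"
      unfolding scaling_ratio_def half_closed_gap_def gap len[unfolded A_def] by simp
    then show ?thesis using o by (simp add: fl.w_def ln_div)
  qed
  then show ?thesis using C fl.w_tendsto_infinity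
    by (intro exI[of _ fl.w] exI[of _ C] exI[of _ "max 1 (max n1 n2)"]) auto
qed

end

theorem proposition1p2:
  fixes l1 l2 :: real
  assumes "(l1, l2) \<in> {1<..<2} \<times> {1<..<2}"
  shows "\<exists>lam_u lam_s :: real. 1 < lam_u \<and> lam_s \<in> {0<..<1} \<and>
    (\<forall>f \<in> fibonacci_class l1 l2.
      \<exists>c_u c_u' c_plus c_plus' c_s c_s' :: real.
        comparable (\<lambda>p. ln (scaling_ratio l1 l2 f (2 * p)))
                   (\<lambda>p. c_u * lam_u ^ p + c_s * lam_s ^ p + c_plus) \<and>
        comparable (\<lambda>p. ln (scaling_ratio l1 l2 f (2 * p + 1)))
                   (\<lambda>p. c_u' * lam_u ^ p + c_s' * lam_s ^ p + c_plus'))"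
proof -
  have l: "1 < l1" "l1 < 2" "1 < l2" "l2 < 2" using assms by auto
  \<comment> \<open>The reciprocals are interchanged because the sequence \<open>v\<close> below is
    \<open>w\<close> shifted by one index, which swaps parities.\<close>
  define b1 b2 where "b1 = 1 / l2" "b2 = 1 / l1"
  have b: "0 < b1" "0 < b2" "b1 < 1" "b2 < 1" using l by (auto simp: b1_b2_def)
  have "1 / 2 < b1" "1 / 2 < b2" using l by (auto simp: b1_b2_def field_simps)
  then have "1 < b1 + b2" by simp
  from recursion_eigenvalue[OF b this] obtain lam_u where
    lam: "1 < lam_u" "lam_u\<^sup>2 - (b1 + b2 + b1 * b2) * lam_u + b1 * b2 = 0" by blast
  \<comment> \<open>The other root of the characteristic polynomial, whose constant term is
    \<open>b1 * b2\<close>.\<close>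
  define lam_s where "lam_s = b1 * b2 / lam_u"
  have lam_s: "lam_s \<in> {0<..<1}"
  proof -
    have "b1 * b2 < 1 * 1" using b by (intro mult_strict_mono) auto
    then show ?thesis using b lam by (simp add: lam_s_def pos_divide_less_eq)
  qed
  have "\<exists>c_u c_u' c_plus c_plus' c_s c_s' :: real.
        comparable (\<lambda>p. ln (scaling_ratio l1 l2 f (2 * p)))
                   (\<lambda>p. c_u * lam_u ^ p + c_s * lam_s ^ p + c_plus) \<and>
        comparable (\<lambda>p. ln (scaling_ratio l1 l2 f (2 * p + 1)))
                   (\<lambda>p. c_u' * lam_u ^ p + c_s' * lam_s ^ p + c_plus')"
    if f: "f \<in> fibonacci_class l1 l2" for f
  proof -
    interpret fibonacci_map l1 l2 f using l f by unfold_locales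
    obtain w C n0 where w: "filterlim w at_top sequentially"
      "\<And>n. n0 \<le> n \<Longrightarrow> ln (scaling_ratio l1 l2 f (n + 1)) = - w n"
      "\<And>n. n0 \<le> n \<Longrightarrow> \<bar>w (n + 2) - (if even n then 1 / l2 else 1 / l1) * (w (n + 1) + w n)\<bar> \<le> C"
      using scaling_ratio_asymptotics by blast
    define v where "v n = - ln (scaling_ratio l1 l2 f n)" for n
    have v: "v (n + 1) = w n" if "n0 \<le> n" for n using w(2)[OF that] by (simp add: v_def)
    have pos: "0 < v n" for n using scaling_ratio_bounds[of n] by (simp add: v_def)
    have rec: "\<bar>v (n + 2) - (if even n then b2 else b1) * (v (n + 1) + v n)\<bar> \<le> C" if n: "n0 + 1 \<le> n" for n
    proof -
      obtain k where k: "n = k + 1" "n0 \<le> k" using n by (cases n) auto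
      have "v (k + 3) = w (k + 2)" "v (k + 2) = w (k + 1)" "v (k + 1) = w k"
        using v[of "k + 2"] v[of "k + 1"] v[of k] k by (simp_all add: eval_nat_numeral)
      moreover have "n + 2 = k + 3" "n + 1 = k + 2" using k by simp_all
      moreover have "(if even n then b2 else b1) = (if even k then 1 / l2 else 1 / l1)"
        by (simp add: k b1_b2_def)
      ultimately show ?thesis using w(3)[OF k(2)] k(1) by (simp only:)
    qed
    have lim: "filterlim v at_top sequentially"
    proof -
      have "filterlim (\<lambda>n. v (n + 1)) at_top sequentially"
        by (rule filterlim_cong[THEN iffD1, OF refl refl _ w(1)])
           (use v in \<open>auto simp: eventually_sequentially intro!: exI[of _ n0]\<close>)
      then show ?thesis using filterlim_sequentially_Suc[of v at_top] by simp
    qed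
    have ln_eq: "ln (scaling_ratio l1 l2 f n) = - v n" for n by (simp add: v_def)
    show ?thesis unfolding ln_eq
      using two_step_recursion_growth[OF b lam pos rec lim, where m = lam_s] by blast
  qed
  then show ?thesis using lam(1) lam_s by blast
qed

end
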